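(* Let $n$ be a positive odd integer, let $p_1,\dots,p_n$ be positive odd integers, and let $P=P(p_1,p_2,\dots,p_n)$ be the corresponding pretzel knot (a positive pretzel knot of odd type). Then $$u^{\Delta}(P)=\frac14\sum_{1\le i<j\le n}p_ip_j+\frac18(n-1)\quad\bigl(=a_2(P)\bigr),$$ where $u^{\Delta}(P)$ is the $\Delta$-unknotting number of $P$ and $a_2(P)$ is the second coefficient of its Conway polynomial.
   Context: A $\Delta$-move is a local move on knot diagrams. Inside a disk, the diagram consists of three arcs, each pair crossing exactly once, bounding a small triangle, with cyclic over/under information (arc 1 passes over arc 2, arc 2 over arc 3, arc 3 over arc 1, up to relabelling). The move replaces this by the diagram with the same endpoints obtained by pushing one arc across the crossing of the other two (so the triangle is reversed, as in a Reidemeister III move), keeping the over/under information of each pair. Diagrams may also be changed by ambient isotopy (Reidemeister moves). Any two knots are related by finitely many $\Delta$-moves (Murakami–Nakanishi). The $\Delta$-Gordian distance $d_G^{\Delta}(K,K')$ is the minimum number of $\Delta$-moves needed to deform $K$ into $K'$, and the $\Delta$-unknotting number is $u^{\Delta}(K)=d_G^{\Delta}(K,O)$, with $O$ the trivial knot. The Conway polynomial $\nabla_L(z)$ is defined by $\nabla_O=1$ and $\nabla_{L_+}-\nabla_{L_-}=z\nabla_{L_0}$; for a knot $K$, $a_2(K)$ is the coefficient of $z^2$. The pretzel link $P(p_1,\dots,p_n)$ is obtained from $n$ vertical two-strand twisted columns (twisted bands) placed side by side, the $i$-th having $|p_i|$ half-twists (crossings) with handedness given by the sign of $p_i$, by joining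 adjacent columns cyclically at the top and at the bottom in the standard way. It is a knot iff exactly one $p_i$ is even, or all $p_i$ are odd and $n$ is odd. A positive pretzel knot is one whose standard diagram has all crossings positive or all crossings negative; it is of odd type when $n$ and all $p_i$ are odd and positive. Knots are not distinguished from their mirror images ($u^\Delta$ and $a_2$ are invariant under mirror image). *)

theory Defs
  imports "HOL-Library.Extended_Real" "HOL-Computational_Algebra.Polynomial"
begin

section \<open>Oriented link diagrams\<close>

text \<open>
  A diagram is put in general position with respect to the height function and is read from bottom
  to top as a word of elementary slices.  Each slice acts on the strands, which are numbered
  from left to right starting with 0, at the current height:
  \<^item> \<open>Cup i b\<close> is a local minimum; it creates strands \<open>i\<close> and \<open>i + 1\<close>, the left one being oriented
    upwards iff \<open>b\<close>, and the right one the other way;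
  \<^item> \<open>Cap i\<close> is a local maximum; it joins the strands \<open>i\<close> and \<open>i + 1\<close>;
  \<^item> \<open>Cross i s\<close> is a crossing of the strands \<open>i\<close> and \<open>i + 1\<close>; the strand running from the lower
    left to the upper right is the overcrossing one iff \<open>s\<close>.

  Every link diagram is planar isotopic to such a word, and every such word is planar.
\<close>

datatype slice = Cup nat bool | Cap nat | Cross nat bool

type_synonym diagram = "slice list"

text \<open>The list records the orientations of the strands at the current height (\<open>True\<close> for upwards).\<close>

fun act :: "slice \<Rightarrow> bool list \<Rightarrow> bool list option" where
  "act (Cup i b) w =
     (if i \<le> length w then Some (take i w @ [b, \<not> b] @ drop i w) else None)"
| "act (Cap i) w =
     (if i + 1 < length w \<and> w ! i \<noteq> w ! (i + 1) then Some (take i w @ drop (i + 2) w) else None)"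
| "act (Cross i s) w =
     (if i + 1 < length w then Some (take i w @ [w ! (i + 1), w ! i] @ drop (i + 2) w) else None)"

fun run :: "diagram \<Rightarrow> bool list \<Rightarrow> bool list option" where
  "run [] w = Some w"
| "run (g # D) w = Option.bind (act g w) (run D)"

definition is_diagram :: "diagram \<Rightarrow> bool" where
  "is_diagram D \<longleftrightarrow> run D [] = Some []"

definition unknot :: diagram where
  "unknot = [Cup 0 True, Cap 0]"


section \<open>Isotopy\<close>

fun ins :: "slice \<Rightarrow> nat" where
  "ins (Cup i b) = 0" | "ins (Cap i) = 2" | "ins (Cross i s) = 2"

fun outs :: "slice \<Rightarrow> nat" where
  "outs (Cup i b) = 2" | "outs (Cap i) = 0" | "outs (Cross i s) = 2"

fun pos :: "slice \<Rightarrow> nat" where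
  "pos (Cup i b) = i" | "pos (Cap i) = i" | "pos (Cross i s) = i"

fun shift :: "nat \<Rightarrow> slice \<Rightarrow> slice" where
  "shift k (Cup i b) = Cup (i + k) b"
| "shift k (Cap i) = Cap (i + k)"
| "shift k (Cross i s) = Cross (i + k) s"

text \<open>
  The first six rules are the planar isotopies of diagrams presented as words of slices: exchange of
  the heights of two slices, the second of which lies to the right of the first; cancellation of a
  minimum against a maximum; passing a strand across a maximum or a minimum.  The others are the
  Reidemeister moves.  In \<open>R3\<close> the three strands
  cross pairwise; numbering them from left to right at the bottom, 1 is over 2 iff \<open>s\<close>, 1 is over 3
  iff \<open>t\<close> and 2 is over 3 iff \<open>u\<close>, so that the excluded case \<open>s = u \<and> t \<noteq> s\<close> is exactly the one in
  which the over/under information is cyclic.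
\<close>

inductive isotopy_rule :: "diagram \<Rightarrow> diagram \<Rightarrow> bool" where
  exchange: "pos g \<le> pos h \<Longrightarrow> isotopy_rule [g, shift (outs g) h] [shift (ins g) h, g]"
| zigzag_right: "isotopy_rule [Cup (i + 1) b, Cap i] []"
| zigzag_left: "isotopy_rule [Cup i b, Cap (i + 1)] []"
| slide_cap: "isotopy_rule [Cross i s, Cap (i + 1)] [Cross (i + 1) (\<not> s), Cap i]"
| slide_cup: "isotopy_rule [Cup (i + 1) b, Cross i s] [Cup i b, Cross (i + 1) (\<not> s)]"
| R1_cap: "isotopy_rule [Cross i s, Cap i] [Cap i]"
| R1_cup: "isotopy_rule [Cup i b, Cross i s] [Cup i (\<not> b)]"
| R2: "isotopy_rule [Cross i s, Cross i (\<not> s)] []"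
| R3: "\<not> (s = u \<and> t \<noteq> s) \<Longrightarrow>
    isotopy_rule [Cross i s, Cross (i + 1) t, Cross i u] [Cross (i + 1) u, Cross i t, Cross (i + 1) s]"

text \<open>
  The three strands of a \<open>\<Delta>\<close>-move join opposite endpoints on the boundary of the disk, so after a
  rotation of the disk they may be taken to run from bottom to top.
\<close>

inductive delta_rule :: "diagram \<Rightarrow> diagram \<Rightarrow> bool" where
  "delta_rule [Cross i s, Cross (i + 1) (\<not> s), Cross i s]
              [Cross (i + 1) s, Cross i (\<not> s), Cross (i + 1) s]"

inductive local_move :: "(diagram \<Rightarrow> diagram \<Rightarrow> bool) \<Rightarrow> diagram \<Rightarrow> diagram \<Rightarrow> bool"
  for rule :: "diagram \<Rightarrow> diagram \<Rightarrow> bool" where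
  "rule l r \<or> rule r l \<Longrightarrow> is_diagram (A @ l @ B) \<Longrightarrow> is_diagram (A @ r @ B) \<Longrightarrow>
    local_move rule (A @ l @ B) (A @ r @ B)"

definition isotopic :: "diagram \<Rightarrow> diagram \<Rightarrow> bool" where
  "isotopic = (local_move isotopy_rule)\<^sup>*\<^sup>*"


section \<open>The \<open>\<Delta>\<close>-Gordian distance\<close>

definition delta_connected :: "nat \<Rightarrow> diagram \<Rightarrow> diagram \<Rightarrow> bool" where
  "delta_connected k = ((isotopic OO local_move delta_rule) ^^ k) OO isotopic"

text \<open>The value is \<open>\<infinity>\<close> if no sequence of \<open>\<Delta>\<close>-moves exists.\<close>

definition delta_gordian_distance :: "diagram \<Rightarrow> diagram \<Rightarrow> enat" where
  "delta_gordian_distance D D' = Inf {enat k | k. delta_connected k D D'}"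

definition delta_unknotting_number :: "diagram \<Rightarrow> enat" where
  "delta_unknotting_number D = delta_gordian_distance D unknot"


section \<open>The Conway polynomial\<close>

text \<open>
  The orientation-respecting smoothing of a crossing of strands \<open>i\<close> and \<open>i + 1\<close>, where \<open>w\<close> is the
  list of orientations just below the crossing.
\<close>

definition smoothing :: "nat \<Rightarrow> bool list \<Rightarrow> diagram" where
  "smoothing i w = (if w ! i = w ! (i + 1) then [] else [Cap i, Cup i (w ! (i + 1))])"

text \<open>
  A crossing \<open>Cross i s\<close> above \<open>w\<close> is positive iff \<open>s \<longleftrightarrow> w ! i = w ! (i + 1)\<close>.  The
  function that takes a diagram to the Conway polynomial of the link is, on nonempty diagrams, the
  one characterised by the following properties.
\<close>

definition conway_polynomial :: "(diagram \<Rightarrow> int poly) \<Rightarrow> bool" where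
  "conway_polynomial nabla \<longleftrightarrow>
     (\<forall>D D'. is_diagram D \<and> isotopic D D' \<longrightarrow> nabla D = nabla D') \<and>
     nabla unknot = 1 \<and>
     (\<forall>A i B w s. is_diagram (A @ [Cross i s] @ B) \<and> run A [] = Some w \<and>
        (s \<longleftrightarrow> w ! i = w ! (i + 1)) \<longrightarrow>
        nabla (A @ [Cross i s] @ B) - nabla (A @ [Cross i (\<not> s)] @ B) =
          [:0, 1:] * nabla (A @ smoothing i w @ B))"


section \<open>Pretzel links\<close>

text \<open>
  The \<open>i\<close>-th column (counted from 0) consists of the strands \<open>2 * i\<close> and \<open>2 * i + 1\<close>.  At the bottom
  and at the top, one outer arc joins the first strand to the last one, and the other arcs join the
  right strand of each column to the left strand of the next.  The values of \<open>b\<close> are the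
  orientations of the arcs at the bottom, \<open>b 0\<close> being that of the outer one.
\<close>

definition pretzel :: "(nat \<Rightarrow> bool) \<Rightarrow> int list \<Rightarrow> diagram" where
  "pretzel b ps =
     Cup 0 (b 0) # map (\<lambda>i. Cup (2 * i - 1) (b i)) [1..<length ps]
     @ concat (map (\<lambda>i. replicate (nat \<bar>ps ! i\<bar>) (Cross (2 * i) (ps ! i > 0))) [0..<length ps])
     @ map (\<lambda>i. Cap (2 * i - 1)) (rev [1..<length ps]) @ [Cap 0]"

lemma run_append: "run (D @ E) w = Option.bind (run D w) (run E)"
proof (induction D arbitrary: w)
  case (Cons g D)
  then show ?case by (cases "act g w") auto
qed auto

text \<open>For odd columns, \<open>pretzel b ps\<close> is coherently oriented if \<open>b 0\<close> differs from the other values.\<close>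

lemma is_diagram_pretzel_odd:
  assumes "ps \<noteq> []" and odd_ps: "\<And>x. x \<in> set ps \<Longrightarrow> odd x"
    and b: "\<And>i. 0 < i \<Longrightarrow> b i = (\<not> b 0)"
  shows "is_diagram (pretzel b ps)"
proof -
  define c where "c = b 0"
  define alt where "alt c m = concat (replicate m [c, \<not> c])" for c :: bool and m :: nat
  have alt_Suc: "alt c (Suc m) = alt c m @ [c, \<not> c]" for c m
    by (induction m) (auto simp: alt_def)
  have alt_Cons: "alt c (Suc m) = [c, \<not> c] @ alt c m" for c m
    by (auto simp: alt_def)
  have len[simp]: "length (alt c m) = 2 * m" for c m
    by (induction m) (auto simp: alt_def)
  have cups: "run (map (\<lambda>i. Cup (2 * i - 1) (b i)) [1..<Suc m]) [c, \<not> c] = Some (alt c (Suc m))" for m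
  proof (induction m)
    case 0
    then show ?case by (simp add: alt_def)
  next
    case (Suc m)
    have "b (Suc m) = (\<not> c)" using b c_def by simp
    moreover have "alt c (Suc m) = (alt c m @ [c]) @ [\<not> c]" by (simp add: alt_Suc)
    ultimately have "act (Cup (2 * Suc m - 1) (b (Suc m))) (alt c (Suc m)) = Some (alt c (Suc (Suc m)))"
      by (simp add: alt_Suc)
    then show ?case using Suc by (simp add: run_append)
  qed
  have twist: "run (replicate k (Cross (length u) s)) (u @ [x, y] @ v) =
      Some (u @ (if odd k then [y, x] else [x, y]) @ v)" for k s u v and x y :: bool
    by (induction k arbitrary: x y) (auto simp: nth_append)
  have cols: "m \<le> length ps \<Longrightarrow>
      run (concat (map (\<lambda>i. replicate (nat \<bar>ps ! i\<bar>) (Cross (2 * i) (ps ! i > 0))) [0..<m]))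
        (alt c (length ps)) = Some (alt (\<not> c) m @ alt c (length ps - m))" for m
  proof (induction m)
    case 0
    then show ?case by (simp add: alt_def)
  next
    case (Suc m)
    have "odd (ps ! m)" using odd_ps Suc.prems by simp
    then have o: "odd (nat \<bar>ps ! m\<bar>)" by (simp add: even_nat_iff)
    have e: "alt c (length ps - m) = [c, \<not> c] @ alt c (length ps - Suc m)"
      using Suc.prems alt_Cons[of c "length ps - Suc m"] by (simp add: Suc_diff_Suc)
    have "run (replicate (nat \<bar>ps ! m\<bar>) (Cross (2 * m) (ps ! m > 0)))
        (alt (\<not> c) m @ [c, \<not> c] @ alt c (length ps - Suc m))
        = Some (alt (\<not> c) m @ [\<not> c, c] @ alt c (length ps - Suc m))"
      using twist[of "nat \<bar>ps ! m\<bar>" "alt (\<not> c) m" _ c "\<not> c"] o by simp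
    then show ?case using Suc e by (simp add: run_append alt_Suc)
  qed
  have caps: "run (map (\<lambda>i. Cap (2 * i - 1)) (rev [1..<Suc m])) (alt d (Suc m)) = Some [d, \<not> d]" for m d
  proof (induction m)
    case 0
    then show ?case by (simp add: alt_def)
  next
    case (Suc m)
    have "act (Cap (2 * Suc m - 1)) (alt d (Suc (Suc m))) = Some (alt d (Suc m))"
      by (simp add: alt_Suc nth_append)
    then show ?case using Suc by simp
  qed
  obtain m where m: "length ps = Suc m" using assms(1) by (cases ps) auto
  define U where "U = map (\<lambda>i. Cup (2 * i - 1) (b i)) [1..<length ps]"
  define X where
    "X = concat (map (\<lambda>i. replicate (nat \<bar>ps ! i\<bar>) (Cross (2 * i) (ps ! i > 0))) [0..<length ps])"
  define K where "K = map (\<lambda>i. Cap (2 * i - 1)) (rev [1..<length ps])"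
  have "run U [c, \<not> c] = Some (alt c (length ps))"
    unfolding U_def m by (rule cups)
  moreover have "run X (alt c (length ps)) = Some (alt (\<not> c) (length ps))"
    using cols[of "length ps"] unfolding X_def by (simp add: alt_def)
  moreover have "run K (alt (\<not> c) (length ps)) = Some [\<not> c, c]"
    unfolding K_def m using caps[of m "\<not> c"] by simp
  moreover have "pretzel b ps = Cup 0 c # U @ X @ K @ [Cap 0]"
    by (simp add: pretzel_def U_def X_def K_def c_def)
  ultimately show ?thesis
    by (simp add: is_diagram_def run_append)
qed

end

theory Submission
  imports Defs "HOL-Computational_Algebra.Formal_Power_Series"
begin

text \<open>
  Upper bound.  Two crossings of the last column form a clasp, that is, a hook of one strand round the
  other.  The hook is slid along the strand it encloses through all the other columns until it reaches
  its own strand and disappears; every undercrossing on the way costs one \<open>\<Delta>\<close>-move.  So the last column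
  can be lowered by 2 at the cost of half the sum of the others.  A last column \<open>-1\<close> merges with the
  preceding column \<open>q\<close> into a clasp of \<open>q - 1\<close> crossings, which is undone in the same way, and two columns
  have disappeared.

  Lower bound.  For a knot, the coefficient of \<open>h\<^sup>2\<close> in the Jones polynomial \<open>V\<close>, expanded at \<open>a = - exp h\<close> as
  a state sum of the Kauffman bracket, is \<open>96 a\<^sub>2\<close> up to an additive constant.  A \<open>\<Delta>\<close>-move changes it by 16
  times a state sum at \<open>h = 0\<close>, where states are colourings of the components by two colours; counting them
  bounds this sum by 6.

  Both for \<open>V\<close> and for an arbitrary Conway polynomial, the skein relation at a crossing of a column lowers
  the column by 2 or deletes it, which gives the same recursion as the count of \<open>\<Delta>\<close>-moves above.
\<close>

section \<open>Deformations of diagrams\<close>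

text \<open>The theorem assumes a Conway polynomial and does not construct one, so its second
  coefficient cannot bound the number of moves from below; the bracket is an explicit sum and can.
  With t = a^(-4) = exp (- 4 h) the normalised Jones polynomial of a knot begins with 1 - 3 a_2 (t -
  1)^2, and the circle factor, -2 at h = 0, turns this into the coefficient 96 a_2. As 16 times 6 is
  also 96, a \<Delta>-move changes a_2 by at most one. The two bounds meet because a crossing change
  of a knot alters a_2 by the linking number of the link obtained by smoothing. For a crossing of
  the last column that link is the pretzel link without this column, and its linking number is, up
  to sign, half the sum of the other columns: exactly the number of \<Delta>-moves spent on the
  hook. This is why the parity of the number of columns governs all inductions: odd numbers give
  knots, even ones give two-component links.\<close>

lemma run_append_Some: "run (D @ E) w = Some v \<longleftrightarrow> (\<exists>x. run D w = Some x \<and> run E x = Some v)"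
  by (simp add: run_append Option.bind_eq_Some_conv)

section \<open>Cutting words at the position of a slice\<close>

lemma split2: assumes "i + 1 < length w"
  obtains p a b q where "w = p @ a # b # q" "length p = i"
proof -
  have "w = take i w @ w ! i # w ! (i+1) # drop (i+2) w"
    using assms by (metis Cons_nth_drop_Suc Suc_eq_plus1 Suc_lessD add_2_eq_Suc' id_take_nth_drop)
  then show thesis using that[of "take i w"] assms by simp
qed

lemma split3: assumes "i + 2 < length w"
  obtains p a b c q where "w = p @ a # b # c # q" "length p = i"
proof -
  obtain p a b r where 1: "w = p @ a # b # r" "length p = i"
    by (rule split2[of i w]) (use assms in auto)
  then obtain c q where "r = c # q" using assms by (cases r) auto
  then show thesis using that[of p a b c q] 1 by simp
qed

lemma split1: assumes "i < length w"
  obtains p a q where "w = p @ a # q" "length p = i"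
  using assms id_take_nth_drop[OF assms] that[of "take i w"] by (metis length_take min.absorb4)

lemma split0: assumes "i \<le> length w"
  obtains p q where "w = p @ q" "length p = i"
  using assms that[of "take i w" "drop i w"] by simp

lemma act_Cup: "length p = i \<Longrightarrow> act (Cup i b) (p @ q) = Some (p @ b # (\<not> b) # q)" by simp
lemma act_Cap: "length p = i \<Longrightarrow> act (Cap i) (p @ a # b # q) = (if a \<noteq> b then Some (p @ q) else None)"
  by (auto simp: nth_append)
lemma act_Cross: "length p = i \<Longrightarrow> act (Cross i s) (p @ a # b # q) = Some (p @ b # a # q)"
  by (auto simp: nth_append)

lemma act_defined: "act g w = Some v \<Longrightarrow> pos g + ins g \<le> length w"
  by (cases g) (auto split: if_splits)

lemma split_ins: assumes "pos g + ins g \<le> length w" obtains p x q where "w = p @ x @ q" "length p = pos g" "length x = ins g"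
  using that[of "take (pos g) w" "take (ins g) (drop (pos g) w)" "drop (pos g + ins g) w"] assms
  by (simp) (metis append_take_drop_id drop_drop add.commute)

text \<open>
  The relation is asserted in every context in which \<open>D\<close> is coherently oriented, so that chains of
  local moves need not mention orientations; only the creation of slices has side conditions.
\<close>

definition deform :: "nat \<Rightarrow> diagram \<Rightarrow> diagram \<Rightarrow> bool" where
  "deform k D E \<longleftrightarrow> (\<forall>w v. run D w = Some v \<longrightarrow> run E w = Some v \<and>
     (\<forall>A B. run A [] = Some w \<longrightarrow> run B v = Some [] \<longrightarrow> delta_connected k (A @ D @ B) (A @ E @ B)))"

section \<open>Isotopies and \<Delta>-moves as a calculus of relations\<close>

lemma isotopic_refl[simp]: "isotopic D D" by (simp add: isotopic_def)
lemma isotopic_trans: "isotopic D E \<Longrightarrow> isotopic E F \<Longrightarrow> isotopic D F" by (simp add: isotopic_def)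

lemma local_move_sym: "local_move rule D E \<Longrightarrow> local_move rule E D"
  by (induction rule: local_move.induct) (blast intro: local_move.intros)

lemma isotopic_sym: "isotopic D E \<Longrightarrow> isotopic E D"
  unfolding isotopic_def
  by (induction rule: rtranclp_induct) (auto intro: converse_rtranclp_into_rtranclp local_move_sym)

lemma delta_connected_0[simp]: "delta_connected 0 D E \<longleftrightarrow> isotopic D E"
  by (simp add: delta_connected_def OO_def)

text \<open>Relational powers can be unfolded at either end; taking off the first \<Delta>-move is
  the form that suits inductions on \<open>k\<close>.\<close>

lemma delta_connected_Suc: "delta_connected (Suc k) D E \<longleftrightarrow>
  (\<exists>X Y. isotopic D X \<and> local_move delta_rule X Y \<and> delta_connected k Y E)"
  unfolding delta_connected_def relpowp_Suc_right by (subst relpowp_commute[symmetric]) (auto simp: OO_def)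

lemma isotopic_delta_connected: "isotopic D E \<Longrightarrow> delta_connected k E F \<Longrightarrow> delta_connected k D F"
  by (cases k) (auto simp: delta_connected_Suc intro: isotopic_trans)

lemma delta_connected_trans: "delta_connected j D E \<Longrightarrow> delta_connected k E F \<Longrightarrow> delta_connected (j + k) D F"
proof (induction j arbitrary: D)
  case 0
  then show ?case by (simp add: isotopic_delta_connected)
next
  case (Suc j)
  then show ?case by (auto simp: delta_connected_Suc)
qed

lemma delta_connected_1: "local_move delta_rule D E \<Longrightarrow> delta_connected 1 D E"
  unfolding One_nat_def delta_connected_Suc delta_connected_0 using isotopic_refl by blast

lemma delta_connected_sym: "delta_connected k D E \<Longrightarrow> delta_connected k E D"
proof (induction k arbitrary: D)
  case 0
  then show ?case by (simp add: isotopic_sym)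
next
  case (Suc k)
  then obtain X Y where 1: "isotopic D X" "local_move delta_rule X Y" "delta_connected k Y E"
    unfolding delta_connected_Suc by blast
  have "delta_connected (k + 1) E X"
    using Suc.IH[OF 1(3)] delta_connected_1[OF local_move_sym[OF 1(2)]] by (rule delta_connected_trans)
  then have "delta_connected (k + 1 + 0) E D"
    by (rule delta_connected_trans) (simp add: isotopic_sym 1)
  then show ?case by simp
qed

lemma deform_refl[simp]: "deform 0 D D" by (simp add: deform_def)

lemma deform_trans [trans]: "deform j D E \<Longrightarrow> deform k E F \<Longrightarrow> deform (j + k) D F"
  unfolding deform_def using delta_connected_trans by blast

lemma deform_trans0: "deform 0 D E \<Longrightarrow> deform k E F \<Longrightarrow> deform k D F" "deform k D E \<Longrightarrow> deform 0 E F \<Longrightarrow> deform k D F"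
  using deform_trans[of 0 D E k F] deform_trans[of k D E 0 F] by auto

text \<open>The two sides of a rule may be defined on different words: \<open>[]\<close> runs on
  every word, a cancelling pair of crossings only where its strands exist. The second hypothesis
  excludes this obstruction to inverting a rule.\<close>

lemma deform_sym:
  assumes "deform k D E" "\<And>w v. run E w = Some v \<Longrightarrow> run D w \<noteq> None"
  shows "deform k E D"
  unfolding deform_def
proof (intro allI impI)
  fix w v assume E: "run E w = Some v"
  then obtain v' where D: "run D w = Some v'" using assms(2) by fastforce
  then have "v' = v" using assms(1) E by (auto simp: deform_def)
  then show "run D w = Some v \<and>
    (\<forall>A B. run A [] = Some w \<longrightarrow> run B v = Some [] \<longrightarrow> delta_connected k (A @ E @ B) (A @ D @ B))"
    using assms(1) D unfolding deform_def by (blast intro: delta_connected_sym)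
qed

lemma deform_context: assumes "deform k D E" shows "deform k (X @ D @ Y) (X @ E @ Y)"
  unfolding deform_def
proof (intro allI impI conjI)
  fix w v assume "run (X @ D @ Y) w = Some v"
  then obtain x y where r: "run X w = Some x" "run D x = Some y" "run Y y = Some v"
    by (auto simp: run_append_Some)
  then have e: "run E x = Some y" using assms by (auto simp: deform_def)
  show "run (X @ E @ Y) w = Some v" using r e by (auto simp: run_append_Some)
  fix A B assume "run A [] = Some w" "run B v = Some []"
  then have "run (A @ X) [] = Some x" "run (Y @ B) y = Some []" using r by (auto simp: run_append_Some)
  then have "delta_connected k ((A @ X) @ D @ (Y @ B)) ((A @ X) @ E @ (Y @ B))"
    using assms r e unfolding deform_def by blast
  then show "delta_connected k (A @ (X @ D @ Y) @ B) (A @ (X @ E @ Y) @ B)" by simp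
qed

lemma deform_in: "deform k l r \<Longrightarrow> D = X @ l @ Y \<Longrightarrow> E = X @ r @ Y \<Longrightarrow> deform k D E"
  using deform_context by blast

text \<open>Meant for explicit words: once the position \<open>n\<close> is named, evaluating
  \<open>take\<close> and \<open>drop\<close> settles the side conditions, so a chain of diagrams is
  checked by simplification.\<close>

lemma deform_at:
  assumes "deform k l r" "take (length l) (drop n D) = l" "E = take n D @ r @ drop (n + length l) D"
  shows "deform k D E"
proof (rule deform_in[OF assms(1) _ assms(3)])
  show "D = take n D @ l @ drop (n + length l) D"
    using append_take_drop_id[of n D] append_take_drop_id[of "length l" "drop n D"] assms(2)
    by (metis add.commute drop_drop)
qed

lemma deform_closed: "deform k D E \<Longrightarrow> is_diagram D \<Longrightarrow> is_diagram E \<and> delta_connected k D E"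
  unfolding deform_def is_diagram_def by (metis append.right_neutral append_Nil run.simps(1))

lemma deform_local_move:
  assumes "rule l r \<or> rule r l" "\<And>w v. run l w = Some v \<Longrightarrow> run r w = Some v"
    and "\<And>D E. local_move rule D E \<Longrightarrow> delta_connected k D E"
  shows "deform k l r"
  unfolding deform_def
proof (intro allI impI conjI)
  fix w v assume "run l w = Some v"
  then show "run r w = Some v" using assms by blast
next
  fix w v A B assume a: "run l w = Some v" "run A [] = Some w" "run B v = Some []"
  then have "run r w = Some v" using assms by blast
  then have "is_diagram (A @ l @ B)" "is_diagram (A @ r @ B)" using a by (auto simp: is_diagram_def run_append_Some)
  then show "delta_connected k (A @ l @ B) (A @ r @ B)"
    using assms(3) local_move.intros[of rule l r] assms(1) by blast
qed

text \<open>A slice sees only its own strands. Separating this local action from the position allows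
  all pairs of slices to be exchanged by one argument.\<close>

fun act_loc :: "slice \<Rightarrow> bool list \<Rightarrow> bool list option" where
  "act_loc (Cup i b) x = Some [b, \<not> b]"
| "act_loc (Cap i) x = (if x ! 0 \<noteq> x ! 1 then Some [] else None)"
| "act_loc (Cross i s) x = Some [x ! 1, x ! 0]"

lemma act_act_loc: "length p = pos g \<Longrightarrow> length x = ins g \<Longrightarrow>
    act g (p @ x @ z) = map_option (\<lambda>y. p @ y @ z) (act_loc g x)"
  by (cases g) (auto simp: nth_append numeral_2_eq_2 length_Suc_conv)

lemma act_loc_shift[simp]: "act_loc (shift k g) = act_loc g" by (cases g) auto
lemma ins_shift[simp]: "ins (shift k g) = ins g" by (cases g) auto
lemma outs_shift[simp]: "outs (shift k g) = outs g" by (cases g) auto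
lemma pos_shift[simp]: "pos (shift k g) = pos g + k" by (cases g) auto
lemma length_act_loc: "act_loc g x = Some y \<Longrightarrow> length y = outs g" by (cases g) (auto split: if_splits)
lemma act_eq_None: "length w < pos g + ins g \<Longrightarrow> act g w = None" by (cases g) auto
lemma length_act: "act g w = Some v \<Longrightarrow> length v + ins g = length w + outs g"
  by (cases g) (auto split: if_splits)

lemma split_ins2:
  assumes "pos g \<le> pos h" "pos h + ins g + ins h \<le> length w"
  obtains p x q y r where "w = p @ x @ q @ y @ r" "length p = pos g" "length x = ins g"
    "pos h = pos g + length q" "length y = ins h"
proof -
  define w1 where "w1 = drop (pos g) w"
  define w2 where "w2 = drop (ins g) w1"
  define w3 where "w3 = drop (pos h - pos g) w2"
  have "w = take (pos g) w @ take (ins g) w1 @ take (pos h - pos g) w2 @ take (ins h) w3 @ drop (ins h) w3"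
    by (simp add: w1_def w2_def w3_def del: drop_drop)
  then show thesis by (rule that) (use assms in \<open>auto simp: w1_def w2_def w3_def\<close>)
qed

text \<open>The two local actions concern disjoint strands. If the word is too short to hold both
  slices side by side, a comparison of lengths makes both sides undefined.\<close>

lemma run_exchange:
  assumes "pos g \<le> pos h"
  shows "run [g, shift (outs g) h] w = run [shift (ins g) h, g] w"
proof (cases "pos h + ins g + ins h \<le> length w")
  case True
  then obtain p x q y r where w: "w = p @ x @ q @ y @ r" "length p = pos g" "length x = ins g"
    "pos h = pos g + length q" "length y = ins h"
    using split_ins2 assms by blast
  have g: "act g (p @ x @ z) = map_option (\<lambda>y. p @ y @ z) (act_loc g x)" for z
    using w by (simp add: act_act_loc)
  have h: "act (shift k h) (p @ x' @ q @ y @ r) = map_option (\<lambda>y'. p @ x' @ q @ y' @ r) (act_loc h y)"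
    if "length x' = k" for x' k
    using w that act_act_loc[of "p @ x' @ q" "shift k h" y r] by simp
  show ?thesis
    using w(3) by (cases "act_loc g x"; cases "act_loc h y") (auto simp: w(1) g h length_act_loc)
next
  case False
  have "run [shift (ins g) h, g] w = None"
    using False by (simp add: act_eq_None)
  moreover have "act g w = None \<or> length (the (act g w)) < pos h + outs g + ins h"
    using False length_act[of g w] by (cases "act g w") auto
  then have "run [g, shift (outs g) h] w = None"
    by (cases "act g w") (auto simp: act_eq_None)
  ultimately show ?thesis by simp
qed

section \<open>Effect of the local rules on orientations\<close>

lemma run_pair: "run [g, h] w = Option.bind (act g w) (act h)"
proof -
  have "run [] = Some" by auto
  then show ?thesis by (cases "act g w"; simp)
qed

lemma run_zigzag_right: "run [Cup (i + 1) b, Cap i] w = Some v \<Longrightarrow> v = w"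
proof -
  assume a: "run [Cup (i + 1) b, Cap i] w = Some v"
  then have "i < length w" by (auto split: if_splits)
  then obtain p x q where "w = p @ x # q" "length p = i" by (rule split1)
  then show ?thesis using a act_Cup[of "p @ [x]" "i+1" b q] act_Cap[of p i x b "(\<not>b) # q"]
    by (auto simp: run_pair simp del: act.simps split: if_splits)
qed

lemma run_zigzag_left: "run [Cup i b, Cap (i + 1)] w = Some v \<Longrightarrow> v = w"
proof -
  assume a: "run [Cup i b, Cap (i + 1)] w = Some v"
  then have "i < length w" by (auto split: if_splits)
  then obtain p x q where "w = p @ x # q" "length p = i" by (rule split1)
  then show ?thesis using a act_Cup[of p i b "x # q"] act_Cap[of "p @ [b]" "i+1" "\<not>b" x q]
    by (auto simp: run_pair simp del: act.simps split: if_splits)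
qed

lemma run_slide_cap: "run [Cross i s, Cap (i + 1)] w = run [Cross (i + 1) (\<not> s), Cap i] w"
proof (cases "i + 2 < length w")
  case True
  then obtain p a b c q where w: "w = p @ a # b # c # q" "length p = i" by (rule split3)
  show ?thesis
    using act_Cross[of p i s a b "c # q"] act_Cap[of "p @ [b]" "i+1" a c q]
      act_Cross[of "p @ [a]" "i+1" "\<not> s" b c q] act_Cap[of p i a c "b # q"] w
    by (simp add: run_pair del: act.simps)
qed (auto simp: run_pair)

lemma run_slide_cup: "run [Cup (i + 1) b, Cross i s] w = run [Cup i b, Cross (i + 1) (\<not> s)] w"
proof (cases "i < length w")
  case True
  then obtain p x q where w: "w = p @ x # q" "length p = i" by (rule split1)
  show ?thesis
    using act_Cup[of "p @ [x]" "i+1" b q] act_Cross[of p i s x b "(\<not>b) # q"] w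
      act_Cup[of p i b "x # q"] act_Cross[of "p @ [b]" "i+1" "\<not> s" "\<not> b" x q]
    by (simp add: run_pair del: act.simps)
qed (auto simp: run_pair)

lemma run_R1_cap: "run [Cross i s, Cap i] w = run [Cap i] w"
proof (cases "i + 1 < length w")
  case True
  then obtain p a b q where w: "w = p @ a # b # q" "length p = i" by (rule split2)
  then show ?thesis
    using act_Cross[of p i s a b q] act_Cap[of p i b a q] act_Cap[of p i a b q]
    by (auto simp: run_pair simp del: act.simps)
qed (auto simp: run_pair)

lemma run_R1_cup: "run [Cup i b, Cross i s] w = run [Cup i (\<not> b)] w"
  by (auto simp: run_pair nth_append)

lemma run_R2: "run [Cross i s, Cross i (\<not> s)] w = (if i + 1 < length w then Some w else None)"
proof (cases "i + 1 < length w")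
  case True
  then obtain p a b q where w: "w = p @ a # b # q" "length p = i" by (rule split2)
  then show ?thesis
    using act_Cross[of p i s a b q] act_Cross[of p i "\<not> s" b a q]
    by (auto simp: run_pair simp del: act.simps)
qed (auto simp: run_pair)

text \<open>Orientations follow the permutation alone, so the over/under data of the two sides are
  left unrelated; this serves the \<Delta>-move as well as \<open>R3\<close>.\<close>

lemma run_R3: "run [Cross i s, Cross (i + 1) t, Cross i u] w = run [Cross (i + 1) u', Cross i t', Cross (i + 1) s'] w"
proof (cases "i + 2 < length w")
  case True
  then obtain p a b c q where w: "w = p @ a # b # c # q" "length p = i" by (rule split3)
  then show ?thesis
    using act_Cross[of p i s a b "c # q"] act_Cross[of "p @ [b]" "i + 1" t a c q] act_Cross[of p i u b c "a # q"]
     act_Cross[of "p @ [a]" "i + 1" u' b c q] act_Cross[of p i t' a c "b # q"] act_Cross[of "p @ [c]" "i + 1" s' a b q]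
    by (auto simp: run_pair simp del: act.simps)
qed (auto split: bind_splits)

lemma isotopy_rule_run: "isotopy_rule l r \<Longrightarrow> run l w = Some v \<Longrightarrow> run r w = Some v"
proof (induction rule: isotopy_rule.cases)
  case (exchange g h)
  then show ?case using run_exchange by simp
next
  case (zigzag_right i b)
  then show ?case using run_zigzag_right by (metis run.simps(1))
next
  case (zigzag_left i b)
  then show ?case using run_zigzag_left by (metis run.simps(1))
next
  case (slide_cap i s)
  then show ?case using run_slide_cap by metis
next
  case (slide_cup i b s)
  then show ?case using run_slide_cup by metis
next
  case (R1_cap i s)
  then show ?case using run_R1_cap by metis
next
  case (R1_cup i b s)
  then show ?case using run_R1_cup by metis
next
  case (R2 i s)
  then show ?case using run_R2[of i s w] by (simp split: if_splits del: run.simps(2))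
next
  case (R3 s u t i)
  then show ?case using run_R3 by metis
qed

section \<open>The local rules as deformations\<close>

lemma deform_iso: "isotopy_rule l r \<Longrightarrow> deform 0 l r"
  by (rule deform_local_move[of isotopy_rule]) (auto simp: isotopic_def dest: isotopy_rule_run)

lemma deform_zigzag_right: "deform 0 [Cup (Suc i) b, Cap i] []"
  using deform_iso[OF zigzag_right] by simp
lemma deform_zigzag_left: "deform 0 [Cup i b, Cap (Suc i)] []"
  using deform_iso[OF zigzag_left] by simp
lemma deform_slide_cap: "t = (\<not> s) \<Longrightarrow> deform 0 [Cross i s, Cap (Suc i)] [Cross (Suc i) t, Cap i]"
  using deform_iso[OF slide_cap, of i s] by simp
lemma deform_slide_cap': "t = (\<not> s) \<Longrightarrow> deform 0 [Cross (Suc i) t, Cap i] [Cross i s, Cap (Suc i)]"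
  by (rule deform_sym[OF deform_slide_cap]) (use run_slide_cap[of i s] in \<open>auto simp del: run.simps\<close>)
lemma deform_slide_cup: "t = (\<not> s) \<Longrightarrow> deform 0 [Cup (Suc i) b, Cross i s] [Cup i b, Cross (Suc i) t]"
  using deform_iso[OF slide_cup, of i b s] by simp
lemma deform_slide_cup': "t = (\<not> s) \<Longrightarrow> deform 0 [Cup i b, Cross (Suc i) t] [Cup (Suc i) b, Cross i s]"
  by (rule deform_sym[OF deform_slide_cup]) (use run_slide_cup[of i b s] in \<open>auto simp del: run.simps\<close>)
lemma deform_R1_cap: "deform 0 [Cross i s, Cap i] [Cap i]"
  using deform_iso[OF R1_cap] by simp
lemma deform_R1_cap': "deform 0 [Cap i] [Cross i s, Cap i]"
  by (rule deform_sym[OF deform_R1_cap]) (simp add: run_R1_cap del: run.simps)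
lemma deform_R1_cup: "b' = (\<not> b) \<Longrightarrow> deform 0 [Cup i b, Cross i s] [Cup i b']"
  using deform_iso[OF R1_cup] by simp
lemma deform_R1_cup': "b' = (\<not> b) \<Longrightarrow> deform 0 [Cup i b'] [Cup i b, Cross i s]"
  by (rule deform_sym[OF deform_R1_cup]) (simp_all add: run_R1_cup del: run.simps)
lemma deform_R2: "t = (\<not> s) \<Longrightarrow> deform 0 [Cross i s, Cross i t] []"
  using deform_iso[OF R2] by simp
lemma deform_R3: "\<not> (s = u \<and> t \<noteq> s) \<Longrightarrow>
    deform 0 [Cross i s, Cross (Suc i) t, Cross i u] [Cross (Suc i) u, Cross i t, Cross (Suc i) s]"
  using deform_iso[OF R3, of s u t i] by simp
lemma deform_R3': "\<not> (s = u \<and> t \<noteq> s) \<Longrightarrow>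
    deform 0 [Cross (Suc i) u, Cross i t, Cross (Suc i) s] [Cross i s, Cross (Suc i) t, Cross i u]"
  by (rule deform_sym[OF deform_R3]) (use run_R3[of i s t u] in \<open>auto simp del: run.simps\<close>)
lemma deform_delta: "t = (\<not> s) \<Longrightarrow> deform 1 [Cross i s, Cross (Suc i) t, Cross i s] [Cross (Suc i) s, Cross i t, Cross (Suc i) s]"
proof (rule deform_local_move[of delta_rule])
  show "t = (\<not> s) \<Longrightarrow> run [Cross i s, Cross (Suc i) t, Cross i s] w = Some v \<Longrightarrow>
    run [Cross (Suc i) s, Cross i t, Cross (Suc i) s] w = Some v" for w v
    using run_R3[of i s t s w s t s] by simp
qed (use delta_connected_1 delta_rule.intros[of i s] in auto)

section \<open>Exchange of heights for whole tangles\<close>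

lemma deform_exchange: "pos g \<le> pos h \<Longrightarrow> deform 0 [g, shift (outs g) h] [shift (ins g) h, g]"
  by (rule deform_iso) (rule exchange)
lemma deform_exchange': "pos g \<le> pos h \<Longrightarrow> deform 0 [shift (ins g) h, g] [g, shift (outs g) h]"
  by (rule deform_sym[OF deform_exchange]) (simp_all add: run_exchange del: run.simps)

text \<open>Orientations are forgotten; the numbers of strands at the bottom and at the top are all
  that an exchange of heights depends on.\<close>

inductive tangle :: "nat \<Rightarrow> diagram \<Rightarrow> nat \<Rightarrow> bool" where
  tangle_Nil: "tangle m [] m"
| tangle_Cons: "pos g + ins g \<le> m \<Longrightarrow> tangle (m - ins g + outs g) D k \<Longrightarrow> tangle m (g # D) k"

lemma tangle_Nil_iff[simp]: "tangle m [] n \<longleftrightarrow> m = n"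
  by (auto elim: tangle.cases intro: tangle.intros)

lemma tangle_Cons_iff[simp]: "tangle m (g # D) n \<longleftrightarrow> pos g + ins g \<le> m \<and> tangle (m - ins g + outs g) D n"
  by (auto elim: tangle.cases intro: tangle.intros)

lemma tangle_append: "tangle m D n \<Longrightarrow> tangle n E k \<Longrightarrow> tangle m (D @ E) k"
  by (induction rule: tangle.induct) (auto intro: tangle.intros)

lemma deform_exchange_slice:
  assumes "pos g + ins g \<le> m"
  shows "deform 0 (g # map (shift (m - ins g + outs g)) E) (map (shift m) E @ [g])"
    "deform 0 (map (shift m) E @ [g]) (g # map (shift (m - ins g + outs g)) E)"
proof -
  have sh: "shift (m - ins g + outs g) h = shift (outs g) (shift (m - ins g) h)" "shift m h = shift (ins g) (shift (m - ins g) h)" for h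
    using assms by (cases h; simp)+
  have p: "pos g \<le> pos (shift (m - ins g) h)" for h using assms by simp
  show "deform 0 (g # map (shift (m - ins g + outs g)) E) (map (shift m) E @ [g])"
  proof (induction E)
    case (Cons h E)
    have "deform 0 (g # map (shift (m - ins g + outs g)) (h # E)) (shift m h # g # map (shift (m - ins g + outs g)) E)"
      by (rule deform_in[OF deform_exchange[OF p[of h]], of _ "[]"]) (auto simp: sh)
    moreover have "deform 0 (shift m h # g # map (shift (m - ins g + outs g)) E) (map (shift m) (h # E) @ [g])"
      by (rule deform_in[OF Cons.IH, of _ "[shift m h]" "[]"]) auto
    ultimately show ?case by (rule deform_trans0)
  qed simp
  show "deform 0 (map (shift m) E @ [g]) (g # map (shift (m - ins g + outs g)) E)"
  proof (induction E)
    case (Cons h E)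
    have "deform 0 (shift m h # g # map (shift (m - ins g + outs g)) E) (g # map (shift (m - ins g + outs g)) (h # E))"
      by (rule deform_in[OF deform_exchange'[OF p[of h]], of _ "[]"]) (auto simp: sh)
    moreover have "deform 0 (map (shift m) (h # E) @ [g]) (shift m h # g # map (shift (m - ins g + outs g)) E)"
      by (rule deform_in[OF Cons.IH, of _ "[shift m h]" "[]"]) auto
    ultimately show ?case by (rule deform_trans0(1)[rotated])
  qed simp
qed

lemma deform_exchange_tangle: "tangle m D n \<Longrightarrow> deform 0 (D @ map (shift n) E) (map (shift m) E @ D)"
proof (induction rule: tangle.induct)
  case (tangle_Cons g m D k)
  have "deform 0 ((g # D) @ map (shift k) E) (g # map (shift (m - ins g + outs g)) E @ D)"
    by (rule deform_in[OF tangle_Cons.IH, of _ "[g]" "[]"]) auto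
  moreover have "deform 0 (g # map (shift (m - ins g + outs g)) E @ D) (map (shift m) E @ g # D)"
    by (rule deform_in[OF deform_exchange_slice(1)[OF tangle_Cons(1), of E], of _ "[]" D]) auto
  ultimately show ?case by (rule deform_trans0)
qed simp

lemma deform_exchange_tangle': "tangle m D n \<Longrightarrow> deform 0 (map (shift m) E @ D) (D @ map (shift n) E)"
proof (induction rule: tangle.induct)
  case (tangle_Cons g m D k)
  have "deform 0 (g # map (shift (m - ins g + outs g)) E @ D) ((g # D) @ map (shift k) E)"
    by (rule deform_in[OF tangle_Cons.IH, of _ "[g]" "[]"]) auto
  moreover have "deform 0 (map (shift m) E @ g # D) (g # map (shift (m - ins g + outs g)) E @ D)"
    by (rule deform_in[OF deform_exchange_slice(2)[OF tangle_Cons(1), of E], of _ "[]" D]) auto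
  ultimately show ?case by (rule deform_trans0(2)[rotated])
qed simp

lemma deform_delta': "t = (\<not> s) \<Longrightarrow> deform 1 [Cross (Suc i) s, Cross i t, Cross (Suc i) s] [Cross i s, Cross (Suc i) t, Cross i s]"
  by (rule deform_sym[OF deform_delta]) (use run_R3[of i s t s _ s t s] in \<open>auto simp del: run.simps\<close>)

text \<open>A cancelling pair can be created only on strands that exist; the word that follows bears
  witness to them.\<close>

lemma deform_R2_insert:
  assumes "\<And>w v. run D w = Some v \<Longrightarrow> Suc i < length w" "t = (\<not> s)"
  shows "deform 0 D ([Cross i s, Cross i t] @ D)"
proof (rule deform_sym)
  show "deform 0 ([Cross i s, Cross i t] @ D) D"
    by (rule deform_in[OF deform_R2[OF assms(2)], where X = "[]" and Y = D]) auto
  fix w v assume "run D w = Some v"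
  then show "run ([Cross i s, Cross i t] @ D) w \<noteq> None"
    using assms run_R2[of i s w] run_append[of "[Cross i s, Cross i t]" D w] by (auto simp del: run.simps append.simps)
qed

lemma deform_R2_before: "t = (\<not> s) \<Longrightarrow> i \<le> j \<Longrightarrow> deform 0 [Cross j u] [Cross i s, Cross i t, Cross j u]"
  by (rule deform_R2_insert[where D = "[Cross j u]", simplified]) (auto split: if_splits)

lemma deform_R2_cap: "t = (\<not> s) \<Longrightarrow> i \<le> j \<Longrightarrow> deform 0 [Cap j] [Cross i s, Cross i t, Cap j]"
  by (rule deform_R2_insert[where D = "[Cap j]", simplified]) (auto split: if_splits)

lemma deform_R2_after: assumes "t = (\<not> s)" "i \<le> j" shows "deform 0 [Cross j u] [Cross j u, Cross i s, Cross i t]"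
proof (rule deform_sym)
  show "deform 0 [Cross j u, Cross i s, Cross i t] [Cross j u]"
    by (rule deform_in[OF deform_R2[OF assms(1)], where X = "[Cross j u]" and Y = "[]"]) auto
  fix w v assume "run [Cross j u] w = Some v"
  then show "run [Cross j u, Cross i s, Cross i t] w \<noteq> None"
    using assms by (auto split: if_splits)
qed

lemma unshift: "(\<And>g. g \<in> set E \<Longrightarrow> m \<le> pos g) \<Longrightarrow> \<exists>E'. E = map (shift m) E'"
proof (induction E)
  case (Cons g E)
  then obtain E' where "E = map (shift m) E'" by auto
  moreover obtain g' where "g = shift m g'"
  proof (cases g)
    case (Cup i b)
    then show ?thesis using that[of "Cup (i - m) b"] Cons.prems[of g] by simp
  next
    case (Cap i)
    then show ?thesis using that[of "Cap (i - m)"] Cons.prems[of g] by simp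
  next
    case (Cross i s)
    then show ?thesis using that[of "Cross (i - m) s"] Cons.prems[of g] by simp
  qed
  ultimately have "g # E = map (shift m) (g' # E')" by simp
  then show ?case by (rule exI)
qed simp

text \<open>With equally many strands at both ends nothing has to be renumbered, so columns can be
  moved past a hook on their right without shifts.\<close>

lemma deform_commute:
  assumes "tangle m D m" "\<And>g. g \<in> set E \<Longrightarrow> m \<le> pos g"
  shows "deform 0 (D @ E) (E @ D)" "deform 0 (E @ D) (D @ E)"
  using unshift[of E m] assms(2) deform_exchange_tangle[OF assms(1)] deform_exchange_tangle'[OF assms(1)] by auto

lemma deform_R2_after2: assumes "t = (\<not> s)"
  shows "deform 0 [Cross (Suc i) u, Cross i v] [Cross (Suc i) u, Cross i v, Cross (Suc i) s, Cross (Suc i) t]"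
proof (rule deform_sym)
  show "deform 0 [Cross (Suc i) u, Cross i v, Cross (Suc i) s, Cross (Suc i) t] [Cross (Suc i) u, Cross i v]"
    by (rule deform_in[OF deform_R2[OF assms], where X = "[Cross (Suc i) u, Cross i v]" and Y = "[]"]) auto
  fix w y assume "run [Cross (Suc i) u, Cross i v] w = Some y"
  then show "run [Cross (Suc i) u, Cross i v, Cross (Suc i) s, Cross (Suc i) t] w \<noteq> None"
    using assms by (auto split: if_splits)
qed

lemma deform_R2_before2: "t = (\<not> s) \<Longrightarrow>
    deform 0 [Cross i v, Cross (Suc i) u] [Cross (Suc i) s, Cross (Suc i) t, Cross i v, Cross (Suc i) u]"
  by (rule deform_R2_insert[where D = "[Cross i v, Cross (Suc i) u]", simplified]) (auto split: if_splits)

section \<open>Sliding a hook along a strand\<close>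

text \<open>
  \<open>P i\<close> and \<open>N i\<close> are the braid generator \<open>\<sigma>\<^sub>i\<close> and its inverse.  A hook of a strand round another one is
  \<open>\<sigma>\<^sub>i\<^sup>2\<close> or \<open>\<sigma>\<^sub>i\<^sup>-\<^sup>2\<close>, conjugated by the crossings that lead the hooking strand over all strands in between.
\<close>

abbreviation (input) P :: "nat \<Rightarrow> slice" where "P i \<equiv> Cross i True"
abbreviation (input) N :: "nat \<Rightarrow> slice" where "N i \<equiv> Cross i False"
context
  notes numeral_eq_Suc [simp]
begin

section \<open>A hook at a minimum, a maximum and a crossing\<close>

text \<open>The hook made by strand \<open>j + 2\<close> slides through the minimum from its right
  leg to its left leg. The direction along the hooked strand turns round there, which replaces
  \<open>P\<close> by \<open>N\<close>.\<close>

lemma deform_cup_hook: "deform 0 [Cup j b, P (Suc j), P (Suc j)] [Cup j b, N (Suc j), N j, N j, P (Suc j)]"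
proof -
  have "deform 0 [Cup j b, P (Suc j), P (Suc j)] [Cup (Suc j) b, N j, P (Suc j)]"
    by (rule deform_at[OF deform_slide_cup'[of True False j b], of 0]) simp_all
  also have "deform 0 \<dots> [Cup (Suc j) b, P j, N j, N j, P (Suc j)]"
    by (rule deform_at[OF deform_R2_before[of False True j j False], of 1]) simp_all
  also have "deform 0 \<dots> [Cup j b, N (Suc j), N j, N j, P (Suc j)]"
    by (rule deform_at[OF deform_slide_cup[of False True j b], of 0]) simp_all
  finally show ?thesis by simp
qed

lemma deform_cap_hook: "deform 0 [N (Suc j), N (Suc j), Cap j] [N (Suc j), P j, P j, P (Suc j), Cap j]"
proof -
  have "deform 0 [N (Suc j), N (Suc j), Cap j] [N (Suc j), P j, Cap (Suc j)]"
    by (rule deform_at[OF deform_slide_cap'[of False True j], of 1]) simp_all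
  also have "deform 0 \<dots> [N (Suc j), P j, P j, N j, Cap (Suc j)]"
    by (rule deform_at[OF deform_R2_cap[of False True j "Suc j"], of 2]) simp_all
  also have "deform 0 \<dots> [N (Suc j), P j, P j, P (Suc j), Cap j]"
    by (rule deform_at[OF deform_slide_cap[of True False j], of 3]) simp_all
  finally show ?thesis by simp
qed

text \<open>Here the maximum does the hooking: its left leg hands the clasp with strand
  \<open>j\<close> over to its right leg, which reaches strand \<open>j\<close> by passing over the
  left one. The two curls supply the missing crossings.\<close>

lemma deform_cap_hook_left: "deform 0 [P j, P j, Cap (Suc j)] [N (Suc j), N j, N j, P (Suc j), Cap (Suc j)]"
proof -
  have "deform 0 [P j, P j, Cap (Suc j)] [P j, N (Suc j), Cap j]"
    by (rule deform_at[OF deform_slide_cap[of False True j], of 1]) simp_all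
  also have "deform 0 \<dots> [P j, N (Suc j), N j, Cap j]"
    by (rule deform_at[OF deform_R1_cap'[of j False], of 2]) simp_all
  also have "deform 0 \<dots> [N (Suc j), N j, P (Suc j), Cap j]"
    by (rule deform_at[OF deform_R3[of True False False j], of 0]) simp_all
  also have "deform 0 \<dots> [N (Suc j), N j, N j, Cap (Suc j)]"
    by (rule deform_at[OF deform_slide_cap'[of True False j], of 2]) simp_all
  also have "deform 0 \<dots> [N (Suc j), N j, N j, P (Suc j), Cap (Suc j)]"
    by (rule deform_at[OF deform_R1_cap'[of "Suc j" True], of 3]) simp_all
  finally show ?thesis by simp
qed

text \<open>
  A hook passes a crossing by an isotopy if the hooked strand is the overcrossing one.  Otherwise it
  costs one \<open>\<Delta>\<close>-move, which in braid terms lets \<open>\<sigma>\<^sub>i\<^sup>2\<close> and \<open>\<sigma>\<^sub>i\<^sub>+\<^sub>1\<^sup>2\<close> commute.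
\<close>

lemma deform_up_odd: "deform 1 [N (Suc j), N (Suc j), P j] [P j, N (Suc j), N j, N j, P (Suc j)]"
proof -
  have "deform 0 [N (Suc j), N (Suc j), P j] [N (Suc j), N (Suc j), P j, N (Suc j), P (Suc j)]"
    by (rule deform_at[OF deform_R2_after2[of True False j False True], of 1]) simp_all
  also have "deform 1 \<dots> [N (Suc j), N j, P (Suc j), N j, P (Suc j)]"
    by (rule deform_at[OF deform_delta'[of True False j], of 1]) simp_all
  also have "deform 0 \<dots> [P j, N (Suc j), N j, N j, P (Suc j)]"
    by (rule deform_at[OF deform_R3'[of True False False j], of 0]) simp_all
  finally show ?thesis by simp
qed

lemma deform_up_even: "deform 0 [N (Suc j), N j, N j, P (Suc j), P j] [P j, N (Suc j), N (Suc j)]"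
proof -
  have "deform 0 [N (Suc j), N j, N j, P (Suc j), P j] [N (Suc j), N j, P (Suc j), P j, N (Suc j)]"
    by (rule deform_at[OF deform_R3[of False True True j], of 2]) simp_all
  also have "deform 0 \<dots> [N (Suc j), P (Suc j), P j, N (Suc j), N (Suc j)]"
    by (rule deform_at[OF deform_R3[of False True True j], of 1]) simp_all
  also have "deform 0 \<dots> [P j, N (Suc j), N (Suc j)]"
    by (rule deform_at[OF deform_R2[of True False "Suc j"], of 0]) simp_all
  finally show ?thesis by simp
qed

lemma deform_down_odd: "deform 0 [P j, P (Suc j), P (Suc j)] [N (Suc j), P j, P j, P (Suc j), P j]"
proof -
  have "deform 0 [P j, P (Suc j), P (Suc j)] [N (Suc j), P (Suc j), P j, P (Suc j), P (Suc j)]"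
    by (rule deform_at[OF deform_R2_before2[of True False j True True], of 0]) simp_all
  also have "deform 0 \<dots> [N (Suc j), P j, P (Suc j), P j, P (Suc j)]"
    by (rule deform_at[OF deform_R3'[of True True True j], of 1]) simp_all
  also have "deform 0 \<dots> [N (Suc j), P j, P j, P (Suc j), P j]"
    by (rule deform_at[OF deform_R3'[of True True True j], of 2]) simp_all
  finally show ?thesis by simp
qed

lemma deform_down_even: "deform 1 [P j, N (Suc j), P j, P j, P (Suc j)] [P (Suc j), P (Suc j), P j]"
proof -
  have "deform 1 [P j, N (Suc j), P j, P j, P (Suc j)] [P (Suc j), N j, P (Suc j), P j, P (Suc j)]"
    by (rule deform_at[OF deform_delta[of False True j], of 0]) simp_all
  also have "deform 0 \<dots> [P (Suc j), N j, P j, P (Suc j), P j]"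
    by (rule deform_at[OF deform_R3'[of True True True j], of 2]) simp_all
  also have "deform 0 \<dots> [P (Suc j), P (Suc j), P j]"
    by (rule deform_at[OF deform_R2[of True False j], of 1]) simp_all
  finally show ?thesis by simp
qed

text \<open>On the way up the hooked strand is under at the first crossing and then alternates, so
  \<open>k + 1\<close> of the \<open>2 * k + 1\<close> crossings cost a move.\<close>

lemma deform_up: "deform (Suc k) ([N (Suc j), N (Suc j)] @ replicate (2 * k + 1) (P j))
    (replicate (2 * k + 1) (P j) @ [N (Suc j), N j, N j, P (Suc j)])"
proof (induction k)
  case 0
  then show ?case using deform_up_odd by simp
next
  case (Suc k)
  let ?C = "replicate (2 * k + 1) (P j)"
  have "deform 1 ([N (Suc j), N (Suc j)] @ replicate (2 * Suc k + 1) (P j)) ([P j, N (Suc j), N j, N j, P (Suc j), P j] @ ?C)"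
    by (rule deform_in[OF deform_up_odd[of j], where X = "[]" and Y = "P j # ?C"]) simp_all
  also have "deform 0 \<dots> ([P j, P j, N (Suc j), N (Suc j)] @ ?C)"
    by (rule deform_in[OF deform_up_even[of j], where X = "[P j]"]) simp_all
  also have "deform (Suc k) \<dots> ([P j, P j] @ ?C @ [N (Suc j), N j, N j, P (Suc j)])"
    by (rule deform_in[OF Suc.IH, where X = "[P j, P j]" and Y = "[]"]) simp_all
  finally show ?case by simp
qed

text \<open>Coming from above, the hooked strand is over at the first crossing it meets and is under
  only \<open>k\<close> times.\<close>

lemma deform_down: "deform k (replicate (2 * k + 1) (P j) @ [P (Suc j), P (Suc j)])
    ([N (Suc j), P j, P j, P (Suc j)] @ replicate (2 * k + 1) (P j))"
proof (induction k)
  case 0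
  then show ?case using deform_down_odd by simp
next
  case (Suc k)
  let ?C = "replicate (2 * k + 1) (P j)"
  have "deform k (replicate (2 * Suc k + 1) (P j) @ [P (Suc j), P (Suc j)]) ([P j, P j, N (Suc j), P j, P j, P (Suc j)] @ ?C)"
    by (rule deform_in[OF Suc.IH, where X = "[P j, P j]" and Y = "[]"]) simp_all
  also have "deform 1 \<dots> ([P j, P (Suc j), P (Suc j), P j] @ ?C)"
    by (rule deform_in[OF deform_down_even[of j], where X = "[P j]"]) simp_all
  also have "deform 0 \<dots> ([N (Suc j), P j, P j, P (Suc j), P j, P j] @ ?C)"
    by (rule deform_in[OF deform_down_odd[of j], where X = "[]"]) simp_all
  finally show ?case by simp
qed

text \<open>The strand that travels from position \<open>j + 2\<close> to \<open>j\<close> runs over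
  everything, so the column slides beneath it by \<open>R3\<close>.\<close>

lemma deform_pass_left: "deform 0 (replicate k (P j) @ [N (Suc j), N j]) ([N (Suc j), N j] @ replicate k (P (Suc j)))"
proof (induction k)
  case (Suc k)
  have "deform 0 (replicate (Suc k) (P j) @ [N (Suc j), N j]) ([P j, N (Suc j), N j] @ replicate k (P (Suc j)))"
    by (rule deform_in[OF Suc.IH, where X = "[P j]" and Y = "[]"]) simp_all
  also have "deform 0 \<dots> ([N (Suc j), N j] @ replicate (Suc k) (P (Suc j)))"
    by (rule deform_in[OF deform_R3[of True False False j], where X = "[]"]) simp_all
  finally show ?case by simp
qed simp

lemma deform_pass_right: "deform 0 (replicate k (P (Suc j)) @ [P j, P (Suc j)]) ([P j, P (Suc j)] @ replicate k (P j))"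
proof (induction k)
  case (Suc k)
  have "deform 0 (replicate (Suc k) (P (Suc j)) @ [P j, P (Suc j)]) ([P (Suc j), P j, P (Suc j)] @ replicate k (P j))"
    by (rule deform_in[OF Suc.IH, where X = "[P (Suc j)]" and Y = "[]"]) simp_all
  also have "deform 0 \<dots> ([P j, P (Suc j)] @ replicate (Suc k) (P j))"
    by (rule deform_in[OF deform_R3'[of True True True j], where X = "[]"]) simp_all
  finally show ?case by simp
qed simp

lemma deform_far: "i + 1 < j \<Longrightarrow> deform 0 (replicate k (P j) @ [P i, P i]) ([P i, P i] @ replicate k (P j))"
  by (rule deform_commute(2)[of "i + 2"]) (auto intro!: tangle.intros)

text \<open>The hooking strand lies over both legs of the minimum and can be drawn off across it,
  which lowers its position by two.\<close>

lemma deform_hook_cup: "deform 0 [Cup 1 b, N 3, N 2, N 1, P 0, P 0, P 1, P 2, P 3] [N 1, P 0, P 0, P 1, Cup 1 b]"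
proof -
  have "deform 0 [Cup 1 b, N 3, N 2, N 1, P 0, P 0, P 1, P 2, P 3] [N 1, Cup 1 b, N 2, N 1, P 0, P 0, P 1, P 2, P 3]"
    by (rule deform_at[OF deform_exchange[of "Cup 1 b" "N 1"], of 0]) simp_all
  also have "deform 0 \<dots> [N 1, Cup 2 b, P 1, N 1, P 0, P 0, P 1, P 2, P 3]"
    by (rule deform_at[OF deform_slide_cup'[of False True 1 b], of 1]) simp_all
  also have "deform 0 \<dots> [N 1, Cup 2 b, P 0, P 0, P 1, P 2, P 3]"
    by (rule deform_at[OF deform_R2[of False True 1], of 2]) simp_all
  also have "deform 0 \<dots> [N 1, P 0, Cup 2 b, P 0, P 1, P 2, P 3]"
    by (rule deform_at[OF deform_commute(2)[of 2 "[P 0]" "[Cup 2 b]"], of 1]) auto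
  also have "deform 0 \<dots> [N 1, P 0, P 0, Cup 2 b, P 1, P 2, P 3]"
    by (rule deform_at[OF deform_commute(2)[of 2 "[P 0]" "[Cup 2 b]"], of 2]) auto
  also have "deform 0 \<dots> [N 1, P 0, P 0, Cup 1 b, N 2, P 2, P 3]"
    by (rule deform_at[OF deform_slide_cup[of False True 1 b], of 3]) simp_all
  also have "deform 0 \<dots> [N 1, P 0, P 0, Cup 1 b, P 3]"
    by (rule deform_at[OF deform_R2[of True False 2], of 4]) simp_all
  also have "deform 0 \<dots> [N 1, P 0, P 0, P 1, Cup 1 b]"
    by (rule deform_at[OF deform_exchange[of "Cup 1 b" "P 1"], of 3]) simp_all
  finally show ?thesis by simp
qed

text \<open>The hook enters at the top of the new column, runs down it at the cost \<open>k\<close>,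
  turns at the minimum between the column and \<open>T\<close>, and reaches the bottom of
  \<open>T\<close> on its right strand, where \<open>E\<close> takes over.\<close>

lemma deform_hook_down_column:
  assumes T: "tangle 2 T 2" and E: "deform n ([N 1, N 1] @ T) ([N 1, P 0, P 0, P 1] @ T)"
  shows "deform (k + n) ([Cup 1 b] @ T @ replicate (2 * k + 1) (P 2) @ [Cap 1, P 1, P 1]) ([N 1, P 0, P 0, P 1, Cup 1 b] @ T @ replicate (2 * k + 1) (P 2) @ [Cap 1])"
proof -
  let ?R = "replicate (2 * k + 1) (P 2)"
  have "deform 0 ([Cup 1 b] @ T @ ?R @ [Cap 1, P 1, P 1]) ([Cup 1 b] @ T @ ?R @ [P 3, Cap 1, P 1])"
    by (rule deform_in[OF deform_exchange[of "Cap 1" "P 1"], where X = "[Cup 1 b] @ T @ ?R"]) simp_all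
  also have "deform 0 \<dots> ([Cup 1 b] @ T @ ?R @ [P 3, P 3, Cap 1])"
    by (rule deform_in[OF deform_exchange[of "Cap 1" "P 1"], where X = "[Cup 1 b] @ T @ ?R @ [P 3]"]) simp_all
  also have "deform k \<dots> ([Cup 1 b] @ T @ [N 3, P 2, P 2, P 3] @ ?R @ [Cap 1])"
    by (rule deform_in[OF deform_down[of k 2], where X = "[Cup 1 b] @ T"]) simp_all
  also have "deform 0 \<dots> ([Cup 1 b, N 3, P 2, P 2, P 3] @ T @ ?R @ [Cap 1])"
    by (rule deform_at[OF deform_commute(1)[OF T, of "[N 3, P 2, P 2, P 3]"], of 1]) auto
  also have "deform 0 \<dots> ([N 1, Cup 1 b, P 2, P 2, P 3] @ T @ ?R @ [Cap 1])"
    by (rule deform_at[OF deform_exchange[of "Cup 1 b" "N 1"], of 0]) simp_all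
  also have "deform 0 \<dots> ([N 1, Cup 1 b, N 2, N 1, N 1, P 2, P 3] @ T @ ?R @ [Cap 1])"
    by (rule deform_at[OF deform_cup_hook[where j = 1 and b = b], of 1]) simp_all
  also have "deform 0 \<dots> ([N 1, Cup 1 b, N 2, N 1, N 1] @ T @ [P 2, P 3] @ ?R @ [Cap 1])"
    by (rule deform_at[OF deform_commute(2)[OF T, of "[P 2, P 3]"], of 5]) auto
  also have "deform n \<dots> ([N 1, Cup 1 b, N 2, N 1, P 0, P 0, P 1] @ T @ [P 2, P 3] @ ?R @ [Cap 1])"
    by (rule deform_at[OF E, of 3]) simp_all
  also have "deform 0 \<dots> ([N 1, Cup 1 b, N 2, N 1, P 0, P 0, P 1, P 2, P 3] @ T @ ?R @ [Cap 1])"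
    by (rule deform_at[OF deform_commute(1)[OF T, of "[P 2, P 3]"], of 7]) auto
  also have "deform 0 \<dots> ([Cup 1 b, N 3, N 2, N 1, P 0, P 0, P 1, P 2, P 3] @ T @ ?R @ [Cap 1])"
    by (rule deform_at[OF deform_exchange'[of "Cup 1 b" "N 1"], of 0]) simp_all
  also have "deform 0 \<dots> ([N 1, P 0, P 0, P 1, Cup 1 b] @ T @ ?R @ [Cap 1])"
    by (rule deform_at[OF deform_hook_cup[where b = b], of 0]) simp_all
  finally show ?thesis by simp
qed

text \<open>Now the hook runs up the column at the cost \<open>k + 1\<close>, turns at the maximum
  and enters \<open>T\<close> from above. Its hooking strand then lies over the top of the column,
  and the column has to be pulled through beneath it before the hook can be drawn off at the
  bottom.\<close>

lemma deform_hook_up_column: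
  assumes T: "tangle 2 T 2" and D: "deform n (T @ [P 1, P 1]) ([N 1, P 0, P 0, P 1] @ T)"
  shows "deform (Suc k + n) ([N 1, N 1, Cup 1 b] @ T @ replicate (2 * k + 1) (P 2) @ [Cap 1]) ([N 1, P 0, P 0, P 1, Cup 1 b] @ T @ replicate (2 * k + 1) (P 2) @ [Cap 1])"
proof -
  let ?R = "replicate (2 * k + 1) (P 2)"
  have "deform 0 ([N 1, N 1, Cup 1 b] @ T @ ?R @ [Cap 1]) ([N 1, Cup 1 b, N 3] @ T @ ?R @ [Cap 1])"
    by (rule deform_at[OF deform_exchange'[of "Cup 1 b" "N 1"], of 1]) simp_all
  also have "deform 0 \<dots> ([Cup 1 b, N 3, N 3] @ T @ ?R @ [Cap 1])"
    by (rule deform_at[OF deform_exchange'[of "Cup 1 b" "N 1"], of 0]) simp_all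
  also have "deform 0 \<dots> ([Cup 1 b] @ T @ [N 3, N 3] @ ?R @ [Cap 1])"
    by (rule deform_at[OF deform_commute(2)[OF T, of "[N 3, N 3]"], of 1]) auto
  also have "deform (Suc k) \<dots> ([Cup 1 b] @ T @ ?R @ [N 3, N 2, N 2, P 3, Cap 1])"
    by (rule deform_in[OF deform_up[of k 2], where X = "[Cup 1 b] @ T"]) simp_all
  also have "deform 0 \<dots> ([Cup 1 b] @ T @ ?R @ [N 3, N 2, N 2, Cap 1, P 1])"
    by (rule deform_in[OF deform_exchange'[of "Cap 1" "P 1"], where X = "[Cup 1 b] @ T @ ?R @ [N 3, N 2, N 2]"]) simp_all
  also have "deform 0 \<dots> ([Cup 1 b] @ T @ ?R @ [N 3, N 2, P 1, P 1, P 2, Cap 1, P 1])"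
    by (rule deform_in[OF deform_cap_hook[of 1], where X = "[Cup 1 b] @ T @ ?R @ [N 3]"]) simp_all
  also have "deform 0 \<dots> ([Cup 1 b] @ T @ ?R @ [N 3, N 2, P 1, P 1, P 2, P 3, Cap 1])"
    by (rule deform_in[OF deform_exchange[of "Cap 1" "P 1"], where X = "[Cup 1 b] @ T @ ?R @ [N 3, N 2, P 1, P 1, P 2]"]) simp_all
  also have "deform 0 \<dots> ([Cup 1 b] @ T @ [N 3, N 2] @ replicate (2 * k + 1) (P 3) @ [P 1, P 1, P 2, P 3, Cap 1])"
    by (rule deform_in[OF deform_pass_left[of "2 * k + 1" 2], where X = "[Cup 1 b] @ T"]) simp_all
  also have "deform 0 \<dots> ([Cup 1 b] @ T @ [N 3, N 2, P 1, P 1] @ replicate (2 * k + 1) (P 3) @ [P 2, P 3, Cap 1])"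
    by (rule deform_in[OF deform_far[of 1 3 "2 * k + 1"], where X = "[Cup 1 b] @ T @ [N 3, N 2]"]) simp_all
  also have "deform 0 \<dots> ([Cup 1 b, N 3, N 2] @ T @ [P 1, P 1] @ replicate (2 * k + 1) (P 3) @ [P 2, P 3, Cap 1])"
    by (rule deform_at[OF deform_commute(1)[OF T, of "[N 3, N 2]"], of 1]) auto
  also have "deform n \<dots> ([Cup 1 b, N 3, N 2, N 1, P 0, P 0, P 1] @ T @ replicate (2 * k + 1) (P 3) @ [P 2, P 3, Cap 1])"
    by (rule deform_at[OF D, of 3]) simp_all
  also have "deform 0 \<dots> ([Cup 1 b, N 3, N 2, N 1, P 0, P 0, P 1] @ T @ [P 2, P 3] @ ?R @ [Cap 1])"
    by (rule deform_in[OF deform_pass_right[of "2 * k + 1" 2], where X = "[Cup 1 b, N 3, N 2, N 1, P 0, P 0, P 1] @ T"]) simp_all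
  also have "deform 0 \<dots> ([Cup 1 b, N 3, N 2, N 1, P 0, P 0, P 1, P 2, P 3] @ T @ ?R @ [Cap 1])"
    by (rule deform_at[OF deform_commute(1)[OF T, of "[P 2, P 3]"], of 7]) auto
  also have "deform 0 \<dots> ([N 1, P 0, P 0, P 1, Cup 1 b] @ T @ ?R @ [Cap 1])"
    by (rule deform_at[OF deform_hook_cup[where b = b], of 0]) simp_all
  finally show ?thesis by simp
qed

text \<open>The clasp is a hook of strand 3 round strand 2. After its journey it is a hook round
  strand 0, the other leg of the outer minimum to which strand 3 belongs. Drawn off the inner
  minimum it becomes two curls, which \<open>R1\<close> removes.\<close>

lemma deform_last_column:
  assumes T: "tangle 2 T 2" and E: "deform n ([N 1, N 1] @ T) ([N 1, P 0, P 0, P 1] @ T)"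
  shows "deform n ([Cup 0 (\<not> c), Cup 1 c] @ T @ [P 2, P 2] @ D) ([Cup 0 (\<not> c), Cup 1 c] @ T @ D)"
proof -
  have "deform 0 ([Cup 0 (\<not> c), Cup 1 c] @ T @ [P 2, P 2] @ D) ([Cup 0 (\<not> c), Cup 1 c, P 2, P 2] @ T @ D)"
    by (rule deform_at[OF deform_commute(1)[OF T, of "[P 2, P 2]"], of 2]) auto
  also have "deform 0 \<dots> ([Cup 0 (\<not> c), Cup 1 c, N 2, N 1, N 1, P 2] @ T @ D)"
    by (rule deform_at[OF deform_cup_hook[where j = 1 and b = c], of 1]) simp_all
  also have "deform 0 \<dots> ([Cup 0 (\<not> c), Cup 1 c, N 2, N 1, N 1] @ T @ [P 2] @ D)"
    by (rule deform_at[OF deform_commute(2)[OF T, of "[P 2]"], of 5]) auto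
  also have "deform n \<dots> ([Cup 0 (\<not> c), Cup 1 c, N 2, N 1, P 0, P 0, P 1] @ T @ [P 2] @ D)"
    by (rule deform_at[OF E, of 3]) simp_all
  also have "deform 0 \<dots> ([Cup 0 (\<not> c), Cup 1 c, N 2, N 1, P 0, P 0, P 1, P 2] @ T @ D)"
    by (rule deform_at[OF deform_commute(1)[OF T, of "[P 2]"], of 7]) auto
  also have "deform 0 \<dots> ([Cup 0 (\<not> c), Cup 2 c, P 1, N 1, P 0, P 0, P 1, P 2] @ T @ D)"
    by (rule deform_at[OF deform_slide_cup'[of False True 1 c], of 1]) simp_all
  also have "deform 0 \<dots> ([Cup 0 (\<not> c), Cup 2 c, P 0, P 0, P 1, P 2] @ T @ D)"
    by (rule deform_at[OF deform_R2[of False True 1], of 2]) simp_all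
  also have "deform 0 \<dots> ([Cup 0 (\<not> c), P 0, Cup 2 c, P 0, P 1, P 2] @ T @ D)"
    by (rule deform_at[OF deform_commute(2)[of 2 "[P 0]" "[Cup 2 c]"], of 1]) auto
  also have "deform 0 \<dots> ([Cup 0 (\<not> c), P 0, P 0, Cup 2 c, P 1, P 2] @ T @ D)"
    by (rule deform_at[OF deform_commute(2)[of 2 "[P 0]" "[Cup 2 c]"], of 2]) auto
  also have "deform 0 \<dots> ([Cup 0 c, P 0, Cup 2 c, P 1, P 2] @ T @ D)"
    by (rule deform_at[OF deform_R1_cup[of c "\<not> c" 0 True], of 0]) simp_all
  also have "deform 0 \<dots> ([Cup 0 (\<not> c), Cup 2 c, P 1, P 2] @ T @ D)"
    by (rule deform_at[OF deform_R1_cup[of "\<not> c" c 0 True], of 0]) simp_all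
  also have "deform 0 \<dots> ([Cup 0 (\<not> c), Cup 1 c, N 2, P 2] @ T @ D)"
    by (rule deform_at[OF deform_slide_cup[of False True 1 c], of 1]) simp_all
  also have "deform 0 \<dots> ([Cup 0 (\<not> c), Cup 1 c] @ T @ D)"
    by (rule deform_at[OF deform_R2[of True False 2], of 2]) simp_all
  finally show ?thesis by simp
qed

section \<open>Undoing the clasp formed by two columns\<close>

text \<open>Both sides are the same pure braid, two strands hooked across a third one: either of the
  outer strands may be the one that makes its way over the middle one.\<close>

lemma deform_conj_left: "deform 0 [N (Suc j), P j, P j, P (Suc j)] [P j, P (Suc j), P (Suc j), N j]"
proof -
  have "deform 0 [N (Suc j), P j, P j, P (Suc j)] [N (Suc j), P j, P j, P (Suc j), P j, N j]"
    by (rule deform_at[OF deform_R2_after[of False True j "Suc j" True], of 3]) simp_all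
  also have "deform 0 \<dots> [N (Suc j), P j, P (Suc j), P j, P (Suc j), N j]"
    by (rule deform_at[OF deform_R3[of True True True j], of 2]) simp_all
  also have "deform 0 \<dots> [N (Suc j), P (Suc j), P j, P (Suc j), P (Suc j), N j]"
    by (rule deform_at[OF deform_R3[of True True True j], of 1]) simp_all
  also have "deform 0 \<dots> [P j, P (Suc j), P (Suc j), N j]"
    by (rule deform_at[OF deform_R2[of True False "Suc j"], of 0]) simp_all
  finally show ?thesis by simp
qed

lemma deform_conj_right: "deform 0 [P j, N (Suc j), N (Suc j), N j] [N (Suc j), N j, N j, P (Suc j)]"
proof -
  have "deform 0 [P j, N (Suc j), N (Suc j), N j] [P j, N (Suc j), N (Suc j), N j, N (Suc j), P (Suc j)]"
    by (rule deform_at[OF deform_R2_after2[of True False j False False], of 2]) simp_all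
  also have "deform 0 \<dots> [P j, N (Suc j), N j, N (Suc j), N j, P (Suc j)]"
    by (rule deform_at[OF deform_R3'[of False False False j], of 2]) simp_all
  also have "deform 0 \<dots> [N (Suc j), N j, P (Suc j), N (Suc j), N j, P (Suc j)]"
    by (rule deform_at[OF deform_R3[of True False False j], of 0]) simp_all
  also have "deform 0 \<dots> [N (Suc j), N j, N j, P (Suc j)]"
    by (rule deform_at[OF deform_R2[of False True "Suc j"], of 2]) simp_all
  finally show ?thesis by simp
qed

text \<open>
  A hook of one leg of a maximum is a hook of the other leg, which can then be pulled down over all
  strands in between.
\<close>

lemma deform_cap_hook_swap: "deform 0 [N 3, N 2, N 1, P 0, P 0, P 1, P 2, P 3, Cap 4] [N 4, N 3, N 2, N 1, N 0, N 0, P 1, P 2, P 3, P 4, Cap 4]"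
proof -
  have "deform 0 [N 3, N 2, N 1, P 0, P 0, P 1, P 2, P 3, Cap 4] [N 3, N 2, P 0, P 1, P 1, N 0, P 2, P 3, Cap 4]"
    by (rule deform_at[OF deform_conj_left[of 0], of 2]) simp_all
  also have "deform 0 \<dots> [P 0, N 3, N 2, P 1, P 1, N 0, P 2, P 3, Cap 4]"
    by (rule deform_at[OF deform_commute(2)[of 2 "[P 0]" "[N 3, N 2]"], of 0]) auto
  also have "deform 0 \<dots> [P 0, N 3, N 2, P 1, P 1, P 2, P 3, N 0, Cap 4]"
    by (rule deform_at[OF deform_commute(1)[of 2 "[N 0]" "[P 2, P 3]"], of 5]) auto
  also have "deform 0 \<dots> [P 0, N 3, P 1, P 2, P 2, N 1, P 3, N 0, Cap 4]"
    by (rule deform_at[OF deform_conj_left[of 1], of 2]) simp_all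
  also have "deform 0 \<dots> [P 0, P 1, N 3, P 2, P 2, N 1, P 3, N 0, Cap 4]"
    by (rule deform_at[OF deform_commute(2)[of 3 "[P 1]" "[N 3]"], of 1]) auto
  also have "deform 0 \<dots> [P 0, P 1, N 3, P 2, P 2, P 3, N 1, N 0, Cap 4]"
    by (rule deform_at[OF deform_commute(1)[of 3 "[N 1]" "[P 3]"], of 5]) auto
  also have "deform 0 \<dots> [P 0, P 1, P 2, P 3, P 3, N 2, N 1, N 0, Cap 4]"
    by (rule deform_at[OF deform_conj_left[of 2], of 2]) simp_all
  also have "deform 0 \<dots> [P 0, P 1, P 2, P 3, P 3, Cap 4, N 2, N 1, N 0]"
    by (rule deform_at[OF deform_commute(1)[of 4 "[N 2, N 1, N 0]" "[Cap 4]"], of 5]) auto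
  also have "deform 0 \<dots> [P 0, P 1, P 2, N 4, N 3, N 3, P 4, Cap 4, N 2, N 1, N 0]"
    by (rule deform_at[OF deform_cap_hook_left[of 3], of 3]) simp_all
  also have "deform 0 \<dots> [P 0, P 1, P 2, N 4, N 3, N 3, N 2, N 1, N 0, P 4, Cap 4]"
    by (rule deform_at[OF deform_commute(2)[of 4 "[N 2, N 1, N 0]" "[P 4, Cap 4]"], of 6]) auto
  also have "deform 0 \<dots> [N 4, P 0, P 1, P 2, N 3, N 3, N 2, N 1, N 0, P 4, Cap 4]"
    by (rule deform_at[OF deform_commute(1)[of 4 "[P 0, P 1, P 2]" "[N 4]"], of 0]) auto
  also have "deform 0 \<dots> [N 4, P 0, P 1, N 3, N 2, N 2, P 3, N 1, N 0, P 4, Cap 4]"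
    by (rule deform_at[OF deform_conj_right[of 2], of 3]) simp_all
  also have "deform 0 \<dots> [N 4, N 3, P 0, P 1, N 2, N 2, P 3, N 1, N 0, P 4, Cap 4]"
    by (rule deform_at[OF deform_commute(1)[of 3 "[P 0, P 1]" "[N 3]"], of 1]) auto
  also have "deform 0 \<dots> [N 4, N 3, P 0, P 1, N 2, N 2, N 1, N 0, P 3, P 4, Cap 4]"
    by (rule deform_at[OF deform_commute(2)[of 3 "[N 1, N 0]" "[P 3]"], of 6]) auto
  also have "deform 0 \<dots> [N 4, N 3, P 0, N 2, N 1, N 1, P 2, N 0, P 3, P 4, Cap 4]"
    by (rule deform_at[OF deform_conj_right[of 1], of 3]) simp_all
  also have "deform 0 \<dots> [N 4, N 3, N 2, P 0, N 1, N 1, P 2, N 0, P 3, P 4, Cap 4]"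
    by (rule deform_at[OF deform_commute(1)[of 2 "[P 0]" "[N 2]"], of 2]) auto
  also have "deform 0 \<dots> [N 4, N 3, N 2, P 0, N 1, N 1, N 0, P 2, P 3, P 4, Cap 4]"
    by (rule deform_at[OF deform_commute(2)[of 2 "[N 0]" "[P 2]"], of 6]) auto
  also have "deform 0 \<dots> [N 4, N 3, N 2, N 1, N 0, N 0, P 1, P 2, P 3, P 4, Cap 4]"
    by (rule deform_at[OF deform_conj_right[of 0], of 3]) simp_all
  finally show ?thesis by simp
qed

text \<open>Strand 5 passes over the strands in between on its way out and back, so a crossing among
  them slides beneath it twice by \<open>R3\<close>.\<close>

lemma deform_over_hook_3: "deform 0 [P 3, N 4, N 3, N 2, N 1, N 0, N 0, P 1, P 2, P 3, P 4] [N 4, N 3, N 2, N 1, N 0, N 0, P 1, P 2, P 3, P 4, P 3]"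
proof -
  have "deform 0 [P 3, N 4, N 3, N 2, N 1, N 0, N 0, P 1, P 2, P 3, P 4] [N 4, N 3, P 4, N 2, N 1, N 0, N 0, P 1, P 2, P 3, P 4]"
    by (rule deform_at[OF deform_R3[of True False False 3], of 0]) simp_all
  also have "deform 0 \<dots> [N 4, N 3, N 2, N 1, N 0, N 0, P 1, P 2, P 4, P 3, P 4]"
    by (rule deform_at[OF deform_commute(2)[of 4 "[N 2, N 1, N 0, N 0, P 1, P 2]" "[P 4]"], of 2]) auto
  also have "deform 0 \<dots> [N 4, N 3, N 2, N 1, N 0, N 0, P 1, P 2, P 3, P 4, P 3]"
    by (rule deform_at[OF deform_R3'[of True True True 3], of 8]) simp_all
  finally show ?thesis by simp
qed

lemma deform_over_hook_2: "deform 0 [N 2, N 4, N 3, N 2, N 1, N 0, N 0, P 1, P 2, P 3, P 4] [N 4, N 3, N 2, N 1, N 0, N 0, P 1, P 2, P 3, P 4, N 2]"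
proof -
  have "deform 0 [N 2, N 4, N 3, N 2, N 1, N 0, N 0, P 1, P 2, P 3, P 4] [N 4, N 2, N 3, N 2, N 1, N 0, N 0, P 1, P 2, P 3, P 4]"
    by (rule deform_at[OF deform_commute(1)[of 4 "[N 2]" "[N 4]"], of 0]) auto
  also have "deform 0 \<dots> [N 4, N 3, N 2, N 3, N 1, N 0, N 0, P 1, P 2, P 3, P 4]"
    by (rule deform_at[OF deform_R3[of False False False 2], of 1]) simp_all
  also have "deform 0 \<dots> [N 4, N 3, N 2, N 1, N 0, N 0, P 1, N 3, P 2, P 3, P 4]"
    by (rule deform_at[OF deform_commute(2)[of 3 "[N 1, N 0, N 0, P 1]" "[N 3]"], of 3]) auto
  also have "deform 0 \<dots> [N 4, N 3, N 2, N 1, N 0, N 0, P 1, P 2, P 3, N 2, P 4]"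
    by (rule deform_at[OF deform_R3'[of True False True 2], of 7]) simp_all
  also have "deform 0 \<dots> [N 4, N 3, N 2, N 1, N 0, N 0, P 1, P 2, P 3, P 4, N 2]"
    by (rule deform_at[OF deform_commute(1)[of 4 "[N 2]" "[P 4]"], of 9]) auto
  finally show ?thesis by simp
qed

lemma deform_over_hook_3_power: "deform 0 (replicate k (P 3) @ [N 4, N 3, N 2, N 1, N 0, N 0, P 1, P 2, P 3, P 4])
    ([N 4, N 3, N 2, N 1, N 0, N 0, P 1, P 2, P 3, P 4] @ replicate k (P 3))"
proof (induction k)
  case (Suc k)
  have "deform 0 (replicate (Suc k) (P 3) @ [N 4, N 3, N 2, N 1, N 0, N 0, P 1, P 2, P 3, P 4])
      ([P 3, N 4, N 3, N 2, N 1, N 0, N 0, P 1, P 2, P 3, P 4] @ replicate k (P 3))"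
    by (rule deform_in[OF Suc.IH, where X = "[P 3]" and Y = "[]"]) simp_all
  also have "deform 0 \<dots> ([N 4, N 3, N 2, N 1, N 0, N 0, P 1, P 2, P 3, P 4] @ replicate (Suc k) (P 3))"
    by (rule deform_in[OF deform_over_hook_3, where X = "[]"]) simp_all
  finally show ?case by simp
qed simp

text \<open>The counterpart of \<open>deform_pass_left\<close> in which the travelling strand lies
  underneath.\<close>

lemma deform_pass_left': "deform 0 (replicate k (P j) @ [P (Suc j), P j]) ([P (Suc j), P j] @ replicate k (P (Suc j)))"
proof (induction k)
  case (Suc k)
  have "deform 0 (replicate (Suc k) (P j) @ [P (Suc j), P j]) ([P j, P (Suc j), P j] @ replicate k (P (Suc j)))"
    by (rule deform_in[OF Suc.IH, where X = "[P j]" and Y = "[]"]) simp_all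
  also have "deform 0 \<dots> ([P (Suc j), P j] @ replicate (Suc k) (P (Suc j)))"
    by (rule deform_in[OF deform_R3[of True True True j], where X = "[]"]) simp_all
  finally show ?case by simp
qed simp

lemma deform_R2_insert_below_cap: "deform 0 [N 2, Cap 4] [P 3, N 3, N 2, Cap 4]"
proof -
  have "deform 0 [N 2, Cap 4] ([P 3, N 3] @ [N 2, Cap 4])"
    by (rule deform_R2_insert) (auto split: if_splits)
  then show ?thesis by simp
qed

lemma deform_over_hook_cup_2: "deform 0 [Cup 2 b, N 4, N 3, N 2, N 1, N 0, N 0, P 1, P 2, P 3, P 4] [N 2, N 1, N 0, N 0, P 1, P 2, Cup 2 b]"
proof -
  have "deform 0 [Cup 2 b, N 4, N 3, N 2, N 1, N 0, N 0, P 1, P 2, P 3, P 4] [N 2, Cup 2 b, N 3, N 2, N 1, N 0, N 0, P 1, P 2, P 3, P 4]"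
    by (rule deform_at[OF deform_exchange[of "Cup 2 b" "N 2"], of 0]) simp_all
  also have "deform 0 \<dots> [N 2, Cup 3 b, P 2, N 2, N 1, N 0, N 0, P 1, P 2, P 3, P 4]"
    by (rule deform_at[OF deform_slide_cup'[of False True 2 b], of 1]) simp_all
  also have "deform 0 \<dots> [N 2, Cup 3 b, N 1, N 0, N 0, P 1, P 2, P 3, P 4]"
    by (rule deform_at[OF deform_R2[of False True 2], of 2]) simp_all
  also have "deform 0 \<dots> [N 2, N 1, Cup 3 b, N 0, N 0, P 1, P 2, P 3, P 4]"
    by (rule deform_at[OF deform_commute(2)[of 3 "[N 1]" "[Cup 3 b]"], of 1]) auto
  also have "deform 0 \<dots> [N 2, N 1, N 0, Cup 3 b, N 0, P 1, P 2, P 3, P 4]"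
    by (rule deform_at[OF deform_commute(2)[of 2 "[N 0]" "[Cup 3 b]"], of 2]) auto
  also have "deform 0 \<dots> [N 2, N 1, N 0, N 0, Cup 3 b, P 1, P 2, P 3, P 4]"
    by (rule deform_at[OF deform_commute(2)[of 2 "[N 0]" "[Cup 3 b]"], of 3]) auto
  also have "deform 0 \<dots> [N 2, N 1, N 0, N 0, P 1, Cup 3 b, P 2, P 3, P 4]"
    by (rule deform_at[OF deform_commute(2)[of 3 "[P 1]" "[Cup 3 b]"], of 4]) auto
  also have "deform 0 \<dots> [N 2, N 1, N 0, N 0, P 1, Cup 2 b, N 3, P 3, P 4]"
    by (rule deform_at[OF deform_slide_cup[of False True 2 b], of 5]) simp_all
  also have "deform 0 \<dots> [N 2, N 1, N 0, N 0, P 1, Cup 2 b, P 4]"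
    by (rule deform_at[OF deform_R2[of True False 3], of 6]) simp_all
  also have "deform 0 \<dots> [N 2, N 1, N 0, N 0, P 1, P 2, Cup 2 b]"
    by (rule deform_at[OF deform_exchange[of "Cup 2 b" "P 2"], of 5]) simp_all
  finally show ?thesis by simp
qed

lemma deform_over_hook_cup_1: "deform 0 [Cup 1 b, N 2, N 1, N 0, N 0, P 1, P 2] [N 0, N 0, Cup 1 b]"
proof -
  have "deform 0 [Cup 1 b, N 2, N 1, N 0, N 0, P 1, P 2] [Cup 2 b, P 1, N 1, N 0, N 0, P 1, P 2]"
    by (rule deform_at[OF deform_slide_cup'[of False True 1 b], of 0]) simp_all
  also have "deform 0 \<dots> [Cup 2 b, N 0, N 0, P 1, P 2]"
    by (rule deform_at[OF deform_R2[of False True 1], of 1]) simp_all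
  also have "deform 0 \<dots> [N 0, Cup 2 b, N 0, P 1, P 2]"
    by (rule deform_at[OF deform_commute(2)[of 2 "[N 0]" "[Cup 2 b]"], of 0]) auto
  also have "deform 0 \<dots> [N 0, N 0, Cup 2 b, P 1, P 2]"
    by (rule deform_at[OF deform_commute(2)[of 2 "[N 0]" "[Cup 2 b]"], of 1]) auto
  also have "deform 0 \<dots> [N 0, N 0, Cup 1 b, N 2, P 2]"
    by (rule deform_at[OF deform_slide_cup[of False True 1 b], of 2]) simp_all
  also have "deform 0 \<dots> [N 0, N 0, Cup 1 b]"
    by (rule deform_at[OF deform_R2[of True False 2], of 3]) simp_all
  finally show ?thesis by simp
qed

text \<open>The negative crossing slides round the maximum between the two columns, and the lowest
  crossing of the other column round the minimum between them. The remaining \<open>k\<close>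
  crossings are passed along a strand, after which the two cancel. What is left is a minimum clasped
  with the strand to its right.\<close>

lemma deform_merge_columns:
  assumes T: "tangle 2 T 2"
  shows "deform 0 ([Cup 1 c, Cup 1 c] @ T @ [P 2] @ replicate k (P 2) @ [Cap 1, N 2, Cap 1]) ([Cup 1 c] @ T @ [Cup 2 (\<not> c)] @ replicate k (P 3) @ [N 2, Cap 4, Cap 1])"
proof -
  let ?R = "replicate k (P 2)"
  have "deform 0 ([Cup 1 c, Cup 1 c] @ T @ [P 2] @ ?R @ [Cap 1, N 2, Cap 1]) ([Cup 1 c, Cup 1 c] @ T @ [P 2] @ ?R @ [N 4, Cap 1, Cap 1])"
    by (rule deform_in[OF deform_exchange[of "Cap 1" "N 2"], where X = "[Cup 1 c, Cup 1 c] @ T @ [P 2] @ ?R"]) simp_all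
  also have "deform 0 \<dots> ([Cup 1 c, Cup 1 c] @ T @ [P 2] @ ?R @ [N 4, Cap 3, Cap 1])"
    by (rule deform_in[OF deform_exchange[of "Cap 1" "Cap 1"], where X = "[Cup 1 c, Cup 1 c] @ T @ [P 2] @ ?R @ [N 4]"]) simp_all
  also have "deform 0 \<dots> ([Cup 1 c, Cup 1 c] @ T @ [P 2] @ ?R @ [P 3, Cap 4, Cap 1])"
    by (rule deform_in[OF deform_slide_cap'[of False True 3], where X = "[Cup 1 c, Cup 1 c] @ T @ [P 2] @ ?R"]) simp_all
  also have "deform 0 \<dots> ([Cup 1 c, Cup 3 c] @ T @ [P 2] @ ?R @ [P 3, Cap 4, Cap 1])"
    by (rule deform_at[OF deform_exchange'[of "Cup 1 c" "Cup 1 c"], of 0]) simp_all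
  also have "deform 0 \<dots> ([Cup 1 c] @ T @ [Cup 3 c, P 2] @ ?R @ [P 3, Cap 4, Cap 1])"
    by (rule deform_at[OF deform_commute(2)[OF T, of "[Cup 3 c]"], of 1]) auto
  also have "deform 0 \<dots> ([Cup 1 c] @ T @ [Cup 2 c, N 3] @ ?R @ [P 3, Cap 4, Cap 1])"
    by (rule deform_in[OF deform_slide_cup[of False True 2 c], where X = "[Cup 1 c] @ T"]) simp_all
  also have "deform 0 \<dots> ([Cup 1 c] @ T @ [Cup 2 c, N 3] @ ?R @ [P 3, P 2, N 2, Cap 4, Cap 1])"
    by (rule deform_in[OF deform_R2_cap[of False True 2 4], where X = "[Cup 1 c] @ T @ [Cup 2 c, N 3] @ ?R @ [P 3]"]) simp_all
  also have "deform 0 \<dots> ([Cup 1 c] @ T @ [Cup 2 c, N 3, P 3, P 2] @ replicate k (P 3) @ [N 2, Cap 4, Cap 1])"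
    by (rule deform_in[OF deform_pass_left'[of k 2], where X = "[Cup 1 c] @ T @ [Cup 2 c, N 3]"]) simp_all
  also have "deform 0 \<dots> ([Cup 1 c] @ T @ [Cup 2 c, P 2] @ replicate k (P 3) @ [N 2, Cap 4, Cap 1])"
    by (rule deform_in[OF deform_R2[of True False 3], where X = "[Cup 1 c] @ T @ [Cup 2 c]"]) simp_all
  also have "deform 0 \<dots> ([Cup 1 c] @ T @ [Cup 2 (\<not> c)] @ replicate k (P 3) @ [N 2, Cap 4, Cap 1])"
    by (rule deform_in[OF deform_R1_cup[of "\<not> c" c 2 True], where X = "[Cup 1 c] @ T"]) simp_all
  finally show ?thesis by simp
qed

lemma deform_cancel_columns:
  assumes T: "tangle 2 T 2"
  shows "deform 0 ([Cup 1 c] @ T @ [Cup 2 (\<not> c), N 2, Cap 4, Cap 1]) T"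
proof -
  have "deform 0 ([Cup 1 c] @ T @ [Cup 2 (\<not> c), N 2, Cap 4, Cap 1]) ([Cup 1 c] @ T @ [Cup 2 c, Cap 4, Cap 1])"
    by (rule deform_in[OF deform_R1_cup[of c "\<not> c" 2 False], where X = "[Cup 1 c] @ T"]) simp_all
  also have "deform 0 \<dots> ([Cup 1 c] @ T @ [Cap 2, Cup 2 c, Cap 1])"
    by (rule deform_in[OF deform_exchange[of "Cup 2 c" "Cap 2"], where X = "[Cup 1 c] @ T"]) simp_all
  also have "deform 0 \<dots> ([Cup 1 c, Cap 2] @ T @ [Cup 2 c, Cap 1])"
    by (rule deform_at[OF deform_commute(1)[OF T, of "[Cap 2]"], of 1]) auto
  also have "deform 0 \<dots> (T @ [Cup 2 c, Cap 1])"
    by (rule deform_at[OF deform_zigzag_left[of 1 c], of 0]) simp_all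
  also have "deform 0 \<dots> T"
    by (rule deform_in[OF deform_zigzag_right[of 1 c], where X = "T"]) simp_all
  finally show ?thesis by simp
qed

text \<open>Two crossings are created together with their inverses. The inverse pair travels through
  the maximum \<open>Cap 1\<close> and becomes a hook round strand 1, which belongs to the remaining
  columns.\<close>

lemma deform_clasp_hook: "deform 0 [N 2, Cap 4, Cap 1] [P 3, P 3, N 2, N 3, N 2, P 1, P 1, P 2, P 3, Cap 4, Cap 1]"
proof -
  have "deform 0 [N 2, Cap 4, Cap 1] [P 3, N 3, N 2, Cap 4, Cap 1]"
    by (rule deform_at[OF deform_R2_insert_below_cap, of 0]) simp_all
  also have "deform 0 \<dots> [P 3, P 3, N 3, N 3, N 2, Cap 4, Cap 1]"
    by (rule deform_at[OF deform_R2_before[of False True 3 3 False], of 1]) simp_all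
  also have "deform 0 \<dots> [P 3, P 3, N 3, N 3, N 2, N 3, P 3, Cap 4, Cap 1]"
    by (rule deform_at[OF deform_R2_cap[of True False 3 4], of 5]) simp_all
  also have "deform 0 \<dots> [P 3, P 3, N 3, N 2, N 3, N 2, P 3, Cap 4, Cap 1]"
    by (rule deform_at[OF deform_R3'[of False False False 2], of 3]) simp_all
  also have "deform 0 \<dots> [P 3, P 3, N 2, N 3, N 2, N 2, P 3, Cap 4, Cap 1]"
    by (rule deform_at[OF deform_R3'[of False False False 2], of 2]) simp_all
  also have "deform 0 \<dots> [P 3, P 3, N 2, N 3, N 2, N 2, P 3, Cap 1, Cap 2]"
    by (rule deform_at[OF deform_exchange'[of "Cap 1" "Cap 2"], of 7]) simp_all
  also have "deform 0 \<dots> [P 3, P 3, N 2, N 3, N 2, N 2, Cap 1, P 1, Cap 2]"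
    by (rule deform_at[OF deform_exchange'[of "Cap 1" "P 1"], of 6]) simp_all
  also have "deform 0 \<dots> [P 3, P 3, N 2, N 3, N 2, P 1, P 1, P 2, Cap 1, P 1, Cap 2]"
    by (rule deform_at[OF deform_cap_hook[of 1], of 4]) simp_all
  also have "deform 0 \<dots> [P 3, P 3, N 2, N 3, N 2, P 1, P 1, P 2, P 3, Cap 1, Cap 2]"
    by (rule deform_at[OF deform_exchange[of "Cap 1" "P 1"], of 8]) simp_all
  also have "deform 0 \<dots> [P 3, P 3, N 2, N 3, N 2, P 1, P 1, P 2, P 3, Cap 4, Cap 1]"
    by (rule deform_at[OF deform_exchange[of "Cap 1" "Cap 2"], of 9]) simp_all
  finally show ?thesis by simp
qed

text \<open>The direction is that of adding two crossings, since their inverses form a hook of just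
  the sign that \<open>D\<close> takes in from above; reversing the deformation later costs nothing.
  Behind \<open>T\<close> the hook is handed to strand 5, the right leg of the outer minimum, whose
  left leg is the hooked strand 0; drawn down over all minima in between, it ends in two
  curls.\<close>

lemma deform_unclasp:
  assumes T: "tangle 2 T 2" and D: "deform n (T @ [P 1, P 1]) ([N 1, P 0, P 0, P 1] @ T)"
  shows "deform n ([Cup 0 (\<not> c), Cup 1 c] @ T @ [Cup 2 (\<not> c)] @ replicate k (P 3) @ [N 2, Cap 4, Cap 1]) ([Cup 0 (\<not> c), Cup 1 c] @ T @ [Cup 2 (\<not> c)] @ replicate k (P 3) @ [P 3, P 3, N 2, Cap 4, Cap 1])"
proof -
  let ?V = "[Cup 0 (\<not> c), Cup 1 c, Cup 2 (\<not> c)]"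
    and ?U = "[Cup 0 (\<not> c), Cup 1 c]"
    and ?C = "[Cup 2 (\<not> c)]"
    and ?R = "replicate k (P 3)"
  have "deform 0 (?U @ T @ ?C @ ?R @ [N 2, Cap 4, Cap 1]) (?U @ T @ ?C @ ?R @ [P 3, P 3, N 2, N 3, N 2, P 1, P 1, P 2, P 3, Cap 4, Cap 1])"
    by (rule deform_in[OF deform_clasp_hook, where X = "?U @ T @ ?C @ ?R"]) simp_all
  also have "deform 0 \<dots> (?V @ ?R @ [P 3, P 3, N 2, N 3, N 2] @ T @ [P 1, P 1, P 2, P 3, Cap 4, Cap 1])"
    by (rule deform_at[OF deform_commute(1)[OF T, of "?C @ ?R @ [P 3, P 3, N 2, N 3, N 2]"], of 2]) auto
  also have "deform n \<dots> (?V @ ?R @ [P 3, P 3, N 2, N 3, N 2, N 1, P 0, P 0, P 1] @ T @ [P 2, P 3, Cap 4, Cap 1])"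
    by (rule deform_in[OF D, where X = "?V @ ?R @ [P 3, P 3, N 2, N 3, N 2]"]) simp_all
  also have "deform 0 \<dots> (?V @ ?R @ [P 3, P 3, N 2, N 3, N 2, N 1, P 0, P 0, P 1, P 2, P 3, Cap 4] @ T @ [Cap 1])"
    by (rule deform_in[OF deform_commute(1)[OF T, of "[P 2, P 3, Cap 4]"], where X = "?V @ ?R @ [P 3, P 3, N 2, N 3, N 2, N 1, P 0, P 0, P 1]"]) auto
  also have "deform 0 \<dots> (?V @ ?R @ [P 3, P 3, N 2, N 4, N 3, N 2, N 1, N 0, N 0, P 1, P 2, P 3, P 4, Cap 4] @ T @ [Cap 1])"
    by (rule deform_in[OF deform_cap_hook_swap, where X = "?V @ ?R @ [P 3, P 3, N 2]"]) simp_all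
  also have "deform 0 \<dots> (?V @ ?R @ [P 3, P 3, N 4, N 3, N 2, N 1, N 0, N 0, P 1, P 2, P 3, P 4, N 2, Cap 4] @ T @ [Cap 1])"
    by (rule deform_in[OF deform_over_hook_2, where X = "?V @ ?R @ [P 3, P 3]"]) simp_all
  also have "deform 0 \<dots> (?V @ ?R @ [P 3, N 4, N 3, N 2, N 1, N 0, N 0, P 1, P 2, P 3, P 4, P 3, N 2, Cap 4] @ T @ [Cap 1])"
    by (rule deform_in[OF deform_over_hook_3, where X = "?V @ ?R @ [P 3]"]) simp_all
  also have "deform 0 \<dots> (?V @ ?R @ [N 4, N 3, N 2, N 1, N 0, N 0, P 1, P 2, P 3, P 4, P 3, P 3, N 2, Cap 4] @ T @ [Cap 1])"
    by (rule deform_in[OF deform_over_hook_3, where X = "?V @ ?R"]) simp_all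
  also have "deform 0 \<dots> ([Cup 0 (\<not> c), Cup 1 c, Cup 2 (\<not> c), N 4, N 3, N 2, N 1, N 0, N 0, P 1, P 2, P 3, P 4] @ ?R @ [P 3, P 3, N 2, Cap 4] @ T @ [Cap 1])"
    by (rule deform_at[OF deform_over_hook_3_power[of k], of 3]) simp_all
  also have "deform 0 \<dots> ([Cup 0 (\<not> c), Cup 1 c, N 2, N 1, N 0, N 0, P 1, P 2, Cup 2 (\<not> c)] @ ?R @ [P 3, P 3, N 2, Cap 4] @ T @ [Cap 1])"
    by (rule deform_at[OF deform_over_hook_cup_2[where b = "\<not> c"], of 2]) simp_all
  also have "deform 0 \<dots> ([Cup 0 (\<not> c), N 0, N 0, Cup 1 c, Cup 2 (\<not> c)] @ ?R @ [P 3, P 3, N 2, Cap 4] @ T @ [Cap 1])"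
    by (rule deform_at[OF deform_over_hook_cup_1[where b = c], of 1]) simp_all
  also have "deform 0 \<dots> ([Cup 0 c, N 0, Cup 1 c, Cup 2 (\<not> c)] @ ?R @ [P 3, P 3, N 2, Cap 4] @ T @ [Cap 1])"
    by (rule deform_at[OF deform_R1_cup[of c "\<not> c" 0 False], of 0]) simp_all
  also have "deform 0 \<dots> (?V @ ?R @ [P 3, P 3, N 2, Cap 4] @ T @ [Cap 1])"
    by (rule deform_at[OF deform_R1_cup[of "\<not> c" c 0 False], of 0]) simp_all
  also have "deform 0 \<dots> (?U @ T @ ?C @ ?R @ [P 3, P 3, N 2, Cap 4, Cap 1])"
    by (rule deform_at[OF deform_commute(2)[OF T, of "?C @ ?R @ [P 3, P 3, N 2, Cap 4]"], of 2]) auto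
  finally show ?thesis by simp
qed

end

section \<open>Pretzel knots with odd columns\<close>

definition twists :: "nat \<Rightarrow> int \<Rightarrow> diagram" where
  "twists i p = replicate (nat \<bar>p\<bar>) (Cross i (p > 0))"

text \<open>
  The columns are listed from right to left.  Without columns the tangle is a maximum below a minimum,
  so that \<open>odd_pretzel c []\<close> is the unlink of two components.
\<close>

fun columns :: "bool \<Rightarrow> int list \<Rightarrow> diagram" where
  "columns c [] = [Cap 0, Cup 0 c]"
| "columns c (p # L) = [Cup 1 c] @ columns c L @ twists 2 p @ [Cap 1]"

definition odd_pretzel :: "bool \<Rightarrow> int list \<Rightarrow> diagram" where
  "odd_pretzel c L = [Cup 0 (\<not> c)] @ columns c L @ [Cap 0]"

lemma run_twists: "length u = i \<Longrightarrow> run (twists i p) (u @ [x, y] @ v) = Some (u @ (if odd p then [y, x] else [x, y]) @ v)"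
proof -
  assume i: "length u = i"
  have "run (replicate k (Cross i s)) (u @ [x, y] @ v) = Some (u @ (if odd k then [y, x] else [x, y]) @ v)" for k s
    by (induction k arbitrary: x y) (use i in \<open>auto simp: nth_append\<close>)
  then show ?thesis by (simp add: twists_def even_nat_iff)
qed

lemma run_columns: "(\<And>p. p \<in> set L \<Longrightarrow> odd p) \<Longrightarrow> run (columns c L) ([\<not> c, c] @ v) = Some ([c, \<not> c] @ v)"
proof (induction L arbitrary: v)
  case (Cons p L)
  have "run (columns c L) ((\<not> c) # c # (\<not> c) # c # v) = Some ([c, \<not> c] @ [\<not> c, c] @ v)"
    using Cons.IH[of "(\<not> c) # c # v"] Cons.prems by simp
  then show ?case using run_twists[of "[c, \<not> c]" 2 p "\<not> c" c v] Cons.prems[of p] by (simp add: run_append)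
qed simp

lemma is_diagram_odd_pretzel: "(\<And>p. p \<in> set L \<Longrightarrow> odd p) \<Longrightarrow> is_diagram (odd_pretzel c L)"
  using run_columns[of L c "[]"] by (simp add: is_diagram_def odd_pretzel_def run_append)

lemma tangle_replicate: "i + 2 \<le> m \<Longrightarrow> tangle m (replicate k (Cross i s)) m"
proof -
  assume "i + 2 \<le> m"
  then have "m - 2 + 2 = m" by simp
  then show ?thesis using \<open>i + 2 \<le> m\<close> by (induction k) simp_all
qed

lemma tangle_shift: "tangle m D n \<Longrightarrow> tangle (m + k) D (n + k)"
proof (induction rule: tangle.induct)
  case (tangle_Cons g m D j)
  then show ?case by (intro tangle.intros) (auto simp: add.commute add.left_commute)
qed (auto intro: tangle.intros)

lemma tangle_columns: "tangle 2 (columns c L) 2"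
proof (induction L)
  case Nil
  then show ?case by simp
next
  case (Cons p L)
  have "tangle 2 [Cup 1 c] 4" "tangle 4 [Cap 1] 2" by simp_all
  moreover have "tangle 4 (columns c L) 4" using tangle_shift[OF Cons, of 2] by simp
  moreover have "tangle 4 (twists 2 p) 4" by (simp add: twists_def tangle_replicate)
  ultimately show ?case by (auto intro!: tangle_append simp del: append.simps)
qed

lemma twists_odd: "p = 2 * int k + 1 \<Longrightarrow> twists i p = replicate (2 * k + 1) (P i)"
  by (simp add: twists_def nat_add_distrib nat_mult_distrib)

lemma odd_pos_int: assumes "odd p" "p > 0" shows "\<exists>k. p = 2 * int k + 1"
proof -
  obtain j where "p = 2 * j + 1" using assms by (auto elim: oddE)
  then show ?thesis using assms by (intro exI[of _ "nat j"]) simp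
qed

text \<open>The hook reverses its direction in every column and has to leave at the bottom of the
  leftmost strand; hence it starts below an even and above an odd number of columns. Without columns
  it merely turns at the maximum. A column passed downwards costs \<open>(p - 1) / 2\<close>, one
  passed upwards \<open>(p + 1) / 2\<close>; for an odd number of columns there is one more of the
  former, whence the rounding.\<close>

lemma deform_hook_columns:
  assumes "\<And>p. p \<in> set L \<Longrightarrow> odd p \<and> p > 0"
  shows "(even (length L) \<longrightarrow> deform (nat (sum_list L div 2)) ([N 1, N 1] @ columns c L) ([N 1, P 0, P 0, P 1] @ columns c L)) \<and>
    (odd (length L) \<longrightarrow> deform (nat (sum_list L div 2)) (columns c L @ [P 1, P 1]) ([N 1, P 0, P 0, P 1] @ columns c L)) \<and>
    sum_list L \<ge> 0 \<and> (even (sum_list L) \<longleftrightarrow> even (length L))"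
  using assms
proof (induction L)
  case Nil
  have "deform 0 [N 1, N 1, Cap 0, Cup 0 c] [N 1, P 0, P 0, P 1, Cap 0, Cup 0 c]"
    by (rule deform_in[OF deform_cap_hook[of 0], where X = "[]"]) simp_all
  then show ?case by simp
next
  case (Cons p L)
  obtain k where k: "p = 2 * int k + 1"
    using odd_pos_int Cons.prems[of p] by auto
  note T = tangle_columns[of c L]
  have IH: "sum_list L \<ge> 0" "even (sum_list L) \<longleftrightarrow> even (length L)"
     "even (length L) \<Longrightarrow> deform (nat (sum_list L div 2)) ([N 1, N 1] @ columns c L) ([N 1, P 0, P 0, P 1] @ columns c L)"
     "odd (length L) \<Longrightarrow> deform (nat (sum_list L div 2)) (columns c L @ [P 1, P 1]) ([N 1, P 0, P 0, P 1] @ columns c L)"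
    using Cons by auto
  have pos: "sum_list (p # L) \<ge> 0" "even (sum_list (p # L)) \<longleftrightarrow> even (length (p # L))"
    using IH k by auto
  show ?case
  proof (cases "even (length L)")
    case True
    then have "nat (sum_list (p # L) div 2) = k + nat (sum_list L div 2)"
      using k IH(1,2) by (auto elim!: evenE)
    then show ?thesis using deform_hook_down_column[OF T IH(3), where k = k and b = c] True pos twists_odd[OF k] by simp
  next
    case False
    then have "nat (sum_list (p # L) div 2) = Suc k + nat (sum_list L div 2)"
      using k IH(1,2) by (auto elim!: oddE)
    then show ?thesis using deform_hook_up_column[OF T IH(4), where k = k and b = c] False pos twists_odd[OF k] by simp
  qed
qed

lemma deform_odd_pretzel_last_column:
  assumes "\<And>p. p \<in> set L \<Longrightarrow> odd p \<and> p > 0" "even (length L)" "odd p" "p > 0"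
  shows "deform (nat (sum_list L div 2)) (odd_pretzel c (p # L)) (odd_pretzel c ((p - 2) # L))"
proof -
  \<comment> \<open>For \<open>p = 1\<close> the second \<open>P 2\<close> is created together with
    an \<open>N 2\<close>, which is the column \<open>p - 2 = - 1\<close>.\<close>
  have 1: "deform 0 (twists 2 p) ([P 2, P 2] @ twists 2 (p - 2))"
  proof (cases "p = 1")
    case True
    then show ?thesis using deform_R2_after[of False True 2 2 True] by (simp add: twists_def)
  next
    case False
    then have "p \<ge> 3" using assms(3,4) by presburger
    then have "nat \<bar>p\<bar> = Suc (Suc (nat \<bar>p - 2\<bar>))" by simp
    then show ?thesis using \<open>p \<ge> 3\<close> by (simp add: twists_def)
  qed
  have "deform 0 (odd_pretzel c (p # L)) ([Cup 0 (\<not> c), Cup 1 c] @ columns c L @ [P 2, P 2] @ twists 2 (p - 2) @ [Cap 1, Cap 0])"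
    by (rule deform_in[OF 1, where X = "[Cup 0 (\<not> c), Cup 1 c] @ columns c L"]) (simp_all add: odd_pretzel_def)
  also have "deform (nat (sum_list L div 2)) \<dots> (odd_pretzel c ((p - 2) # L))"
    by (rule deform_in[OF deform_last_column[OF tangle_columns[of c L], where D = "[]"], where X = "[]"])
      (use deform_hook_columns[OF assms(1), where c = c] assms in \<open>auto simp: odd_pretzel_def\<close>)
  finally show ?thesis by simp
qed

text \<open>
  The outermost columns \<open>-1\<close> and \<open>k + 1\<close> merge into a clasp of \<open>k\<close> crossings.
\<close>

definition clasped :: "bool \<Rightarrow> int list \<Rightarrow> nat \<Rightarrow> diagram" where
  "clasped c L k = [Cup 0 (\<not> c), Cup 1 c] @ columns c L @ [Cup 2 (\<not> c)] @ replicate k (P 3) @ [N 2, Cap 4, Cap 1, Cap 0]"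

lemma deform_odd_pretzel_clasped: "deform 0 (odd_pretzel c (- 1 # (2 * int k + 1) # L)) (clasped c L (2 * k))"
proof -
  have c: "twists 2 (2 * int k + 1) = P 2 # replicate (2 * k) (P 2)" using twists_odd[of "2 * int k + 1" k 2] by simp
  have n: "twists 2 (- 1) = [N 2]" by (simp add: twists_def)
  show ?thesis
    by (rule deform_in[OF deform_merge_columns[OF tangle_columns[of c L], where k = "2 * k"], where X = "[Cup 0 (\<not> c)]"])
      (simp_all add: odd_pretzel_def clasped_def c n)
qed

lemma deform_clasped_0: "deform 0 (clasped c L 0) (odd_pretzel c L)"
  by (rule deform_in[OF deform_cancel_columns[OF tangle_columns[of c L]], where X = "[Cup 0 (\<not> c)]"])
      (simp_all add: odd_pretzel_def clasped_def)

lemma deform_clasped_step: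
  assumes "\<And>p. p \<in> set L \<Longrightarrow> odd p \<and> p > 0" "odd (length L)"
  shows "deform (nat (sum_list L div 2)) (clasped c L k) (clasped c L (Suc (Suc k)))"
proof -
  have r: "replicate (Suc (Suc k)) (P 3) = replicate k (P 3) @ [P 3, P 3]"
    by (induction k) auto
  show ?thesis
    unfolding clasped_def r
    by (rule deform_in[OF deform_unclasp[OF tangle_columns[of c L], where k = k], where X = "[]"])
      (use deform_hook_columns[OF assms(1), where c = c] assms in auto)
qed

lemma is_diagram_clasped: "(\<And>p. p \<in> set L \<Longrightarrow> odd p) \<Longrightarrow> is_diagram (clasped c L (2 * k))"
  by (rule deform_closed[OF deform_odd_pretzel_clasped, THEN conjunct1], rule is_diagram_odd_pretzel) auto

section \<open>Counting the \<Delta>-moves\<close>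

lemma delta_connected_clasped:
  assumes "\<And>p. p \<in> set L \<Longrightarrow> odd p \<and> p > 0" "odd (length L)"
  shows "delta_connected (k * nat (sum_list L div 2)) (clasped c L (2 * k)) (odd_pretzel c L)"
proof (induction k)
  case 0
  then show ?case using deform_closed[OF deform_clasped_0] is_diagram_clasped[of L c 0] assms(1) by auto
next
  case (Suc k)
  have "delta_connected (nat (sum_list L div 2)) (clasped c L (2 * Suc k)) (clasped c L (2 * k))"
    using deform_closed[OF deform_clasped_step[OF assms, of c "2 * k"]] is_diagram_clasped[of L c k] assms(1)
    by (auto intro: delta_connected_sym)
  from delta_connected_trans[OF this Suc] show ?case by simp
qed

text \<open>Lowering does not stop at the column 1 but one step further, at \<open>- 1\<close>,
  where the column can merge with its neighbour; this accounts for \<open>Suc k\<close>.\<close>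

lemma delta_connected_odd_pretzel_last_column:
  assumes "\<And>p. p \<in> set L \<Longrightarrow> odd p \<and> p > 0" "even (length L)"
  shows "delta_connected (Suc k * nat (sum_list L div 2)) (odd_pretzel c ((2 * int k + 1) # L)) (odd_pretzel c (- 1 # L))"
proof (induction k)
  case 0
  have "is_diagram (odd_pretzel c (1 # L))" by (rule is_diagram_odd_pretzel) (use assms(1) in auto)
  then show ?case using deform_closed[OF deform_odd_pretzel_last_column[of L 1 c]] assms by auto
next
  case (Suc k)
  have "is_diagram (odd_pretzel c ((2 * int (Suc k) + 1) # L))" by (rule is_diagram_odd_pretzel) (use assms(1) in auto)
  then have "delta_connected (nat (sum_list L div 2)) (odd_pretzel c ((2 * int (Suc k) + 1) # L)) (odd_pretzel c ((2 * int (Suc k) + 1 - 2) # L))"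
    using deform_closed[OF deform_odd_pretzel_last_column[of L "2 * int (Suc k) + 1" c]] assms by auto
  moreover have "2 * int (Suc k) + 1 - 2 = 2 * int k + 1" by simp
  ultimately show ?case using delta_connected_trans[OF _ Suc] by (metis mult_Suc)
qed

text \<open>The maximum and the minimum at the end of the recursion are pulled straight against the
  arcs that join them to the column, one zigzag on each side.\<close>

lemma deform_single_column: "deform 0 (columns c [p]) (twists 0 p)"
proof -
  have t: "tangle 0 [Cup 0 c] 2" by simp
  have "deform 0 (columns c [p]) ([Cup 0 c] @ twists 2 p @ [Cap 1])"
    by (rule deform_in[OF deform_zigzag_right[of 0 c], where X = "[]"]) simp_all
  also have "deform 0 \<dots> (twists 0 p @ [Cup 0 c, Cap 1])"
    by (rule deform_in[OF deform_exchange_tangle[OF t, of "twists 0 p"], where X = "[]" and Y = "[Cap 1]"]) (simp_all add: twists_def)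
  also have "deform 0 \<dots> (twists 0 p)"
    by (rule deform_in[OF deform_zigzag_left[of 0 c], where X = "twists 0 p" and Y = "[]"]) simp_all
  finally show ?thesis by simp
qed

lemma deform_twisted_circle: "deform 0 ([Cup 0 b] @ twists 0 p @ [Cap 0]) [Cup 0 b, Cap 0]"
proof -
  have "deform 0 (replicate k (Cross 0 s) @ [Cap 0]) [Cap 0]" for k s
  proof (induction k)
    case (Suc k)
    have "deform 0 (replicate (Suc k) (Cross 0 s) @ [Cap 0]) [Cross 0 s, Cap 0]"
      by (rule deform_in[OF Suc, where X = "[Cross 0 s]" and Y = "[]"]) simp_all
    also have "deform 0 \<dots> [Cap 0]" by (rule deform_R1_cap)
    finally show ?case by simp
  qed simp
  from this[of "nat \<bar>p\<bar>" "p > 0"] show ?thesis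
    by (rule deform_in[where X = "[Cup 0 b]" and Y = "[]"]) (simp_all add: twists_def)
qed

text \<open>The orientation of a circle is reversed by a curl that is created at the minimum and
  removed at the maximum.\<close>

lemma deform_circle: "deform 0 [Cup 0 b, Cap 0] unknot"
proof (cases b)
  case False
  have "deform 0 [Cup 0 b, Cap 0] [Cup 0 (\<not> b), Cross 0 True, Cap 0]"
    by (rule deform_in[OF deform_R1_cup'[of b "\<not> b" 0 True], where X = "[]"]) simp_all
  also have "deform 0 \<dots> [Cup 0 (\<not> b), Cap 0]"
    by (rule deform_in[OF deform_R1_cap[of 0 True], where X = "[Cup 0 (\<not> b)]" and Y = "[]"]) simp_all
  finally show ?thesis using False by (simp add: unknot_def)
qed (simp add: unknot_def)

lemma deform_odd_pretzel_single: "deform 0 (odd_pretzel c [p]) unknot"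
proof -
  have "deform 0 (odd_pretzel c [p]) ([Cup 0 (\<not> c)] @ twists 0 p @ [Cap 0])"
    unfolding odd_pretzel_def by (rule deform_context[OF deform_single_column])
  also have "deform 0 \<dots> [Cup 0 (\<not> c), Cap 0]" by (rule deform_twisted_circle)
  also have "deform 0 \<dots> unknot" by (rule deform_circle)
  finally show ?thesis by simp
qed

fun esym2 :: "int list \<Rightarrow> int" where
  "esym2 [] = 0"
| "esym2 (p # L) = p * sum_list L + esym2 L"

text \<open>Columns disappear in pairs, so an odd number ends in a single column, which is a circle
  with curls. The first column of a pair costs \<open>i + 1\<close> journeys through
  \<open>q # M\<close>, the clasp left by the second one \<open>j\<close> journeys through
  \<open>M\<close>.\<close>

theorem delta_connected_odd_pretzel_unknot:
  assumes "\<And>p. p \<in> set L \<Longrightarrow> odd p \<and> p > 0" "odd (length L)"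
  shows "\<exists>k. delta_connected k (odd_pretzel c L) unknot \<and> 8 * int k = 2 * esym2 L + int (length L) - 1"
  using assms
proof (induction L rule: induct_list012)
  case (2 p)
  then have "delta_connected 0 (odd_pretzel c [p]) unknot" using deform_closed[OF deform_odd_pretzel_single] is_diagram_odd_pretzel[of "[p]" c] by auto
  then show ?case by (intro exI[of _ 0]) simp
next
  case (3 p q M)
  obtain k where k: "delta_connected k (odd_pretzel c M) unknot" "8 * int k = 2 * esym2 M + int (length M) - 1"
    using 3 by auto
  obtain i where i: "p = 2 * int i + 1" using odd_pos_int 3(3)[of p] by auto
  obtain j where j: "q = 2 * int j + 1" using odd_pos_int 3(3)[of q] by auto
  let ?n = "nat (sum_list (q # M) div 2)" and ?m = "nat (sum_list M div 2)"
  have M: "odd (length M)" "\<And>x. x \<in> set M \<Longrightarrow> odd x \<and> 0 < x" "\<And>x. x \<in> set (q # M) \<Longrightarrow> odd x \<and> 0 < x" using 3 by auto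
  have "delta_connected (Suc i * ?n) (odd_pretzel c (p # q # M)) (odd_pretzel c (- 1 # q # M))"
    unfolding i by (rule delta_connected_odd_pretzel_last_column) (use 3 in auto)
  moreover have "is_diagram (odd_pretzel c (- 1 # q # M))" by (rule is_diagram_odd_pretzel) (use 3 in auto)
  then have "delta_connected 0 (odd_pretzel c (- 1 # q # M)) (clasped c M (2 * j))"
    using deform_closed[OF deform_odd_pretzel_clasped] unfolding j by blast
  moreover have "delta_connected (j * ?m) (clasped c M (2 * j)) (odd_pretzel c M)"
    by (rule delta_connected_clasped) (use 3 in auto)
  ultimately have d: "delta_connected (Suc i * ?n + (0 + (j * ?m + k))) (odd_pretzel c (p # q # M)) unknot"
    using k(1) delta_connected_trans by blast
  have S: "sum_list M \<ge> 0" "odd (sum_list M)" "even (sum_list (q # M))"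
    using deform_hook_columns[OF M(2)] M j by auto
  \<comment> \<open>With this \<open>s\<close> the two rounded halves are \<open>j + s + 1\<close>
    and \<open>s\<close>.\<close>
  then obtain s where s: "sum_list M = 2 * s + 1" by (auto elim: oddE)
  have n: "int ?n = int j + s + 1" "int ?m = s" using s S j by auto
  have "8 * int (Suc i * ?n + (0 + (j * ?m + k))) = 8 * (int i + 1) * (int j + s + 1) + 8 * int j * s + 8 * int k"
    using n by (simp add: algebra_simps)
  also have "\<dots> = 2 * esym2 (p # q # M) + int (length (p # q # M)) - 1"
    using k(2) by (simp add: i j s algebra_simps)
  finally show ?case using d by blast
qed simp

section \<open>The standard diagram and its orientations\<close>

text \<open>\<open>columns\<close> adds an arc, a column and an arc at a time, whereas
  \<open>pretzel\<close> has all minima first and all maxima last; exchanges of heights mediate. The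
  list is reversed because \<open>columns\<close> reads it from right to left.\<close>

lemma deform_pretzel:
  assumes "ps \<noteq> []" "\<And>i. 0 < i \<Longrightarrow> i < length ps \<Longrightarrow> b i = c"
  shows "deform 0 (columns c (rev ps)) (map (\<lambda>i. Cup (2 * i - 1) (b i)) [1..<length ps]
     @ concat (map (\<lambda>i. twists (2 * i) (ps ! i)) [0..<length ps])
     @ map (\<lambda>i. Cap (2 * i - 1)) (rev [1..<length ps]))"
  using assms
proof (induction ps rule: rev_nonempty_induct)
  case (single p)
  then show ?case using deform_single_column by simp
next
  case (snoc p ps)
  define m where "m = length ps"
  define U where "U = map (\<lambda>i. Cup (2 * i - 1) (b i)) [1..<m]"
  define X where "X = concat (map (\<lambda>i. twists (2 * i) (ps ! i)) [0..<m])"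
  define K where "K = map (\<lambda>i. Cap (2 * i - 1)) (rev [1..<m])"
  have m: "m > 0" using snoc by (simp add: m_def)
  have IH: "deform 0 (columns c (rev ps)) (U @ X @ K)"
    using snoc by (simp add: U_def X_def K_def m_def)
  have U: "tangle 1 U (2 * m - 1)"
  proof -
    have "tangle 1 (map (\<lambda>i. Cup (2 * i - 1) (b i)) [1..<Suc n]) (2 * n + 1)" for n
    proof (induction n)
      case (Suc n)
      have "tangle (2 * n + 1) [Cup (2 * Suc n - 1) (b (Suc n))] (2 * Suc n + 1)" by simp
      then show ?case using tangle_append[OF Suc] by simp
    qed simp
    from this[of "m - 1"] show ?thesis using m by (cases m) (simp_all add: U_def)
  qed
  have K: "tangle (2 * m - 1) K 1"
  proof -
    have "tangle (2 * n + 1) (map (\<lambda>i. Cap (2 * i - 1)) (rev [1..<Suc n])) 1" for n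
      by (induction n) simp_all
    from this[of "m - 1"] show ?thesis using m by (cases m) (simp_all add: K_def)
  qed
  then have K2: "tangle (2 * m) K 2" using tangle_shift[OF K, of 1] m by (simp add: numeral_2_eq_2)
  have goal: "map (\<lambda>i. Cup (2 * i - 1) (b i)) [1..<length (ps @ [p])]
     @ concat (map (\<lambda>i. twists (2 * i) ((ps @ [p]) ! i)) [0..<length (ps @ [p])])
     @ map (\<lambda>i. Cap (2 * i - 1)) (rev [1..<length (ps @ [p])])
    = U @ [Cup (2 * m - 1) c] @ X @ twists (2 * m) p @ [Cap (2 * m - 1)] @ K"
  proof -
    have "map (\<lambda>i. twists (2 * i) ((ps @ [p]) ! i)) [0..<m] = map (\<lambda>i. twists (2 * i) (ps ! i)) [0..<m]"
      by (auto simp: nth_append m_def)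
    moreover have "[1..<length (ps @ [p])] = [1..<m] @ [m]" "[0..<length (ps @ [p])] = [0..<m] @ [m]"
      using m by (auto simp: m_def Suc_le_eq)
    moreover have "b m = c" "(ps @ [p]) ! m = p" using m snoc(3)[of m] by (auto simp: m_def)
    ultimately show ?thesis by (simp add: U_def X_def K_def del: upt_Suc map_eq_conv)
  qed
  have "deform 0 (columns c (rev (ps @ [p]))) ([Cup 1 c] @ (U @ X @ K) @ twists 2 p @ [Cap 1])"
    by (rule deform_in[OF IH, where X = "[Cup 1 c]"]) simp_all
  also have "deform 0 \<dots> (U @ [Cup (2 * m - 1) c] @ X @ K @ twists 2 p @ [Cap 1])"
    by (rule deform_in[OF deform_exchange_tangle'[OF U, of "[Cup 0 c]"], where X = "[]"]) simp_all
  also have "deform 0 \<dots> (U @ [Cup (2 * m - 1) c] @ X @ twists (2 * m) p @ K @ [Cap 1])"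
    by (rule deform_in[OF deform_exchange_tangle[OF K2, of "twists 0 p"], where X = "U @ [Cup (2 * m - 1) c] @ X" and Y = "[Cap 1]"])
      (simp_all add: twists_def)
  also have "deform 0 \<dots> (U @ [Cup (2 * m - 1) c] @ X @ twists (2 * m) p @ [Cap (2 * m - 1)] @ K)"
    by (rule deform_in[OF deform_exchange_tangle[OF K, of "[Cap 0]"], where X = "U @ [Cup (2 * m - 1) c] @ X @ twists (2 * m) p" and Y = "[]"]) simp_all
  finally show ?case unfolding goal by simp
qed

lemma isotopic_pretzel_odd_pretzel:
  assumes "ps \<noteq> []" "\<And>i. 0 < i \<Longrightarrow> i < length ps \<Longrightarrow> b i = (\<not> b 0)" "\<And>p. p \<in> set ps \<Longrightarrow> odd p"
  shows "isotopic (odd_pretzel (\<not> b 0) (rev ps)) (pretzel b ps)"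
proof -
  have "deform 0 (odd_pretzel (\<not> b 0) (rev ps)) (pretzel b ps)"
    by (rule deform_in[OF deform_pretzel[of ps b "\<not> b 0"], where X = "[Cup 0 (b 0)]" and Y = "[Cap 0]"])
      (use assms in \<open>simp_all add: odd_pretzel_def pretzel_def twists_def\<close>)
  moreover have "is_diagram (odd_pretzel (\<not> b 0) (rev ps))" by (rule is_diagram_odd_pretzel) (use assms in auto)
  ultimately show ?thesis using deform_closed by fastforce
qed

text \<open>A column with an odd number of crossings exchanges its two strands, so each inner
  maximum links the orientations of two bottom arcs that are two places apart. This gives one chain
  of even and one of odd indices; the outer maximum ties them together because the number of columns
  is odd.\<close>

lemma pretzel_orientation:
  assumes "is_diagram (pretzel b ps)" "odd (length ps)" "\<And>p. p \<in> set ps \<Longrightarrow> odd p" "0 < i" "i < length ps"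
  shows "b i = (\<not> b 0)"
proof -
  \<comment> \<open>This is the index of the last column, hence even.\<close>
  define n where "n = length ps - 1"
  have n: "length ps = Suc n" "even n" "n > 0" using assms by (auto simp: n_def)
  \<comment> \<open>\<open>l k\<close> and \<open>r k\<close> are the orientations of the left and
    the right strand at the bottom of column \<open>k\<close>; the outer arc makes the first and the
    last column exceptional.\<close>
  define l where "l k = (if k = 0 then b 0 else \<not> b k)" for k
  define r where "r k = (if k = n then \<not> b 0 else b (Suc k))" for k
  have len: "length (concat (map (\<lambda>k. [f k, g k]) [0..<m])) = 2 * m" for f g :: "nat \<Rightarrow> bool" and m
    by (induction m) auto
  have cups: "run (map (\<lambda>i. Cup (2 * i - 1) (b i)) [1..<Suc m]) [b 0, \<not> b 0] =
      Some (concat (map (\<lambda>k. [l k, b (Suc k)]) [0..<m]) @ [l m, \<not> b 0])" for m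
  proof (induction m)
    case (Suc m)
    then show ?case
      using act_Cup[of "concat (map (\<lambda>k. [l k, b (Suc k)]) [0..<m]) @ [l m]" "2 * m + 1" "b (Suc m)" "[\<not> b 0]"]
      by (simp add: run_append len l_def del: act.simps)
  qed (simp add: l_def)
  have cols: "m \<le> length ps \<Longrightarrow> run (concat (map (\<lambda>i. twists (2 * i) (ps ! i)) [0..<m]))
      (concat (map (\<lambda>k. [f k, g k]) [0..<m]) @ v) = Some (concat (map (\<lambda>k. [g k, f k]) [0..<m]) @ v)" for f g m v
  proof (induction m arbitrary: v)
    case (Suc m)
    then show ?case
      using run_twists[of "concat (map (\<lambda>k. [g k, f k]) [0..<m])" "2 * m" "ps ! m" "f m" "g m" v] assms(3)[of "ps ! m"]
      by (simp add: run_append len)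
  qed simp
  have caps: "run (map (\<lambda>i. Cap (2 * i - 1)) (rev [1..<Suc m])) (concat (map (\<lambda>k. [g k, f k]) [0..<m]) @ [g m, y]) = Some v
      \<Longrightarrow> (\<forall>k<m. f k \<noteq> g (Suc k)) \<and> v = [g 0, y]" for f g :: "nat \<Rightarrow> bool" and m y v
  proof (induction m)
    case (Suc m)
    have a: "act (Cap (2 * Suc m - 1)) (concat (map (\<lambda>k. [g k, f k]) [0..<Suc m]) @ [g (Suc m), y])
      = (if f m \<noteq> g (Suc m) then Some (concat (map (\<lambda>k. [g k, f k]) [0..<m]) @ [g m, y]) else None)"
      using act_Cap[of "concat (map (\<lambda>k. [g k, f k]) [0..<m]) @ [g m]" "2 * m + 1" "f m" "g (Suc m)" "[y]"]
      by (simp add: len del: act.simps)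
    have "map (\<lambda>i. Cap (2 * i - 1)) (rev [1..<Suc (Suc m)]) = Cap (2 * Suc m - 1) # map (\<lambda>i. Cap (2 * i - 1)) (rev [1..<Suc m])"
      by simp
    then have s: "f m \<noteq> g (Suc m)" "run (map (\<lambda>i. Cap (2 * i - 1)) (rev [1..<Suc m])) (concat (map (\<lambda>k. [g k, f k]) [0..<m]) @ [g m, y]) = Some v"
      using Suc.prems a by (auto simp del: act.simps upt_Suc split: if_splits)
    then show ?case using Suc.IH less_Suc_eq by auto
  qed simp
  have pr: "pretzel b ps = Cup 0 (b 0) # map (\<lambda>i. Cup (2 * i - 1) (b i)) [1..<Suc n]
     @ concat (map (\<lambda>i. twists (2 * i) (ps ! i)) [0..<Suc n]) @ map (\<lambda>i. Cap (2 * i - 1)) (rev [1..<Suc n]) @ [Cap 0]"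
    by (simp add: pretzel_def twists_def n del: upt_Suc)
  have e: "concat (map (\<lambda>k. [l k, b (Suc k)]) [0..<n]) @ [l n, \<not> b 0] = concat (map (\<lambda>k. [l k, r k]) [0..<Suc n])"
  proof -
    have "map (\<lambda>k. [l k, b (Suc k)]) [0..<n] = map (\<lambda>k. [l k, r k]) [0..<n]" by (auto simp: r_def)
    moreover have "r n = (\<not> b 0)" by (simp add: r_def)
    ultimately show ?thesis by (simp del: map_eq_conv)
  qed
  have "run (concat (map (\<lambda>i. twists (2 * i) (ps ! i)) [0..<Suc n])) (concat (map (\<lambda>k. [l k, r k]) [0..<Suc n])) =
      Some (concat (map (\<lambda>k. [r k, l k]) [0..<n]) @ [r n, l n])"
    using cols[of "Suc n" l r "[]"] n by simp
  then obtain v where v: "run (map (\<lambda>i. Cap (2 * i - 1)) (rev [1..<Suc n])) (concat (map (\<lambda>k. [r k, l k]) [0..<n]) @ [r n, l n]) = Some v"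
     "run [Cap 0] v = Some []"
    using assms(1) cups[of n] unfolding is_diagram_def pr by (auto simp: run_append e Option.bind_eq_Some_conv simp del: upt_Suc)
  then have k: "\<forall>k<n. l k \<noteq> r (Suc k)" "r 0 \<noteq> l n" using caps[OF v(1)] by (auto split: if_splits)
  have n2: "n \<ge> 2" using n by (metis even_iff_mod_2_eq_zero mod_less not_less not_gr_zero)
  have evens: "2 * j \<le> n \<Longrightarrow> 0 < j \<Longrightarrow> b (2 * j) = (\<not> b 0)" for j
  proof (induction j)
    case (Suc j)
    show ?case
    proof (cases "j = 0")
      case True
      then show ?thesis using k(1)[rule_format, of 0] n2 by (auto simp: l_def r_def numeral_2_eq_2)
    next
      case False
      then show ?thesis using k(1)[rule_format, of "2 * j"] Suc by (auto simp: l_def r_def)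
    qed
  qed simp
  have "b n = (\<not> b 0)" using evens[of "n div 2"] n n2 by auto
  then have b1: "b 1 = (\<not> b 0)" using k(2) n2 by (auto simp: l_def r_def)
  have odds: "2 * j + 1 \<le> n \<Longrightarrow> b (2 * j + 1) = (\<not> b 0)" for j
  proof (induction j)
    case (Suc j)
    then have "Suc (2 * j + 1) \<noteq> n" by simp
    then show ?case using k(1)[rule_format, of "2 * j + 1"] Suc by (auto simp: l_def r_def)
  qed (use b1 in simp)
  show ?thesis
    using evens[of "i div 2"] odds[of "i div 2"] assms(4,5) n by (cases "even i") (auto elim!: evenE oddE)
qed

section \<open>The second coefficient of the Conway polynomial\<close>

text \<open>
  The two strands of a column of an odd pretzel knot are antiparallel, so only crossings of
  antiparallel strands are needed.
\<close>

definition skein_triple :: "diagram \<Rightarrow> diagram \<Rightarrow> diagram \<Rightarrow> bool" where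
  "skein_triple Dn Dp D0 \<longleftrightarrow> (\<exists>A B i w. Dn = A @ [P i] @ B \<and> Dp = A @ [N i] @ B \<and> D0 = A @ smoothing i w @ B \<and>
     run A [] = Some w \<and> i + 1 < length w \<and> w ! i \<noteq> w ! (i + 1) \<and> is_diagram Dn \<and> is_diagram Dp \<and> is_diagram D0)"

lemma deform_twists_even: "deform 0 ([Cup i c] @ replicate (2 * k) (P i)) [Cup i c]"
proof (induction k)
  case (Suc k)
  have "deform 0 ([Cup i c] @ replicate (2 * Suc k) (P i)) ([Cup i (\<not> c), P i] @ replicate (2 * k) (P i))"
    by (rule deform_in[OF deform_R1_cup[of "\<not> c" c i True], where X = "[]"]) simp_all
  also have "deform 0 \<dots> ([Cup i c] @ replicate (2 * k) (P i))"
    by (rule deform_in[OF deform_R1_cup[of c "\<not> c" i True], where X = "[]"]) simp_all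
  also note Suc
  finally show ?case by simp
qed simp

text \<open>Changing a crossing cancels it against the next one. Smoothing cuts the column into a
  maximum and a minimum; the even number of remaining crossings become curls of the minimum, and
  zigzags then absorb both arcs, so the column is gone. The context \<open>A\<close>,
  \<open>B\<close> allows the column to be the last or the last but one.\<close>

lemma skein_columns:
  assumes "\<And>p. p \<in> set L \<Longrightarrow> odd p" "run A [] = Some ([\<not> c, c] @ v)" "run B ([c, \<not> c] @ v) = Some []" "odd p" "p > 0"
  shows "\<exists>Dp D0. skein_triple (A @ columns c (p # L) @ B) Dp D0 \<and> isotopic Dp (A @ columns c ((p - 2) # L) @ B) \<and>
     isotopic D0 (A @ columns c L @ B)"
proof -
  obtain k where k: "p = 2 * int k + 1" using odd_pos_int assms by blast
  define A' where "A' = A @ [Cup 1 c] @ columns c L"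
  define B' where "B' = replicate (2 * k) (P 2) @ [Cap 1] @ B"
  let ?w = "[c, \<not> c, \<not> c, c] @ v" and ?w' = "[c, \<not> c, c, \<not> c] @ v"
  have runA: "run A' [] = Some ?w"
    using assms(2) run_columns[of L c "[\<not> c, c] @ v"] assms(1) by (simp add: A'_def run_append)
  have runB: "run B' ?w' = Some []"
    using run_twists[of "[c, \<not> c]" 2 "2 * int k" c "\<not> c" v] assms(3)
    by (cases "k = 0") (simp_all add: B'_def run_append twists_def nat_mult_distrib)
  have c: "twists 2 p = P 2 # replicate (2 * k) (P 2)" using twists_odd[OF k, of 2] by simp
  have Dn: "A @ columns c (p # L) @ B = A' @ [P 2] @ B'" by (simp add: A'_def B'_def c)
  have cr: "run [Cross 2 s] ?w = Some ?w'" for s by (simp add: numeral_2_eq_2)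
  have sm1: "smoothing 2 ?w = [Cap 2, Cup 2 c]"
    by (simp add: smoothing_def)
  have "run [Cap 2, Cup 2 c] ?w = Some ?w'"
    by (simp add: numeral_2_eq_2)
  then have sm: "smoothing 2 ?w = [Cap 2, Cup 2 c]" "run (smoothing 2 ?w) ?w = Some ?w'"
    unfolding sm1 by simp_all
  have dn: "is_diagram (A' @ [P 2] @ B')" and dp: "is_diagram (A' @ [N 2] @ B')" and d0: "is_diagram (A' @ smoothing 2 ?w @ B')"
    unfolding is_diagram_def run_append runA using cr sm(2) runB by (simp_all del: run.simps(2) append.simps)
  have "skein_triple (A' @ [P 2] @ B') (A' @ [N 2] @ B') (A' @ smoothing 2 ?w @ B')"
    unfolding skein_triple_def
    by (intro exI[of _ A'] exI[of _ B'] exI[of _ 2] exI[of _ ?w]) (use runA dn dp d0 in \<open>simp add: numeral_2_eq_2\<close>)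
  moreover have "isotopic (A' @ [N 2] @ B') (A @ columns c ((p - 2) # L) @ B)"
  proof -
    have "deform 0 ([N 2] @ replicate (2 * k) (P 2)) (twists 2 (p - 2))"
    proof (cases k)
      case 0
      then show ?thesis by (simp add: k twists_def)
    next
      case (Suc j)
      then have "twists 2 (p - 2) = replicate (2 * j + 1) (P 2)" using twists_odd[of "p - 2" j] k by simp
      then show ?thesis by (intro deform_in[OF deform_R2[of True False 2], where X = "[]"]) (simp_all add: Suc)
    qed
    then have "deform 0 (A' @ [N 2] @ B') (A @ columns c ((p - 2) # L) @ B)"
      by (rule deform_in[where X = A' and Y = "[Cap 1] @ B"]) (simp_all add: A'_def B'_def)
    then show ?thesis using deform_closed dp by fastforce
  qed
  moreover have "isotopic (A' @ smoothing 2 ?w @ B') (A @ columns c L @ B)"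
  proof -
    note T = tangle_columns[of c L]
    have "deform 0 (A' @ smoothing 2 ?w @ B') (A' @ [Cap 2, Cup 2 c] @ [Cap 1] @ B)"
      by (rule deform_in[OF deform_twists_even[of 2 c k], where X = "A' @ [Cap 2]" and Y = "[Cap 1] @ B"])
        (simp_all add: smoothing_def B'_def)
    also have "deform 0 \<dots> (A' @ [Cap 2] @ B)"
      by (rule deform_in[OF deform_zigzag_right[of 1 c], where X = "A' @ [Cap 2]" and Y = B]) (simp_all add: numeral_2_eq_2)
    also have "deform 0 \<dots> (A @ [Cup 1 c, Cap 2] @ columns c L @ B)"
      by (rule deform_in[OF deform_commute(1)[OF T, of "[Cap 2]"], where X = "A @ [Cup 1 c]" and Y = B]) (auto simp: A'_def)
    also have "deform 0 \<dots> (A @ columns c L @ B)"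
      by (rule deform_in[OF deform_zigzag_left[of 1 c], where X = A]) (simp_all add: numeral_2_eq_2)
    finally show ?thesis using deform_closed d0 by fastforce
  qed
  ultimately show ?thesis unfolding Dn by blast
qed

lemma skein_odd_pretzel:
  assumes "\<And>x. x \<in> set (p # L) \<Longrightarrow> odd x" "p > 0"
  shows "\<exists>Dp D0. skein_triple (odd_pretzel c (p # L)) Dp D0 \<and> isotopic Dp (odd_pretzel c ((p - 2) # L)) \<and> isotopic D0 (odd_pretzel c L)"
  using skein_columns[of L "[Cup 0 (\<not> c)]" c "[]" "[Cap 0]" p] assms by (simp add: odd_pretzel_def)

lemma skein_odd_pretzel2:
  assumes "\<And>x. x \<in> set (p # q # L) \<Longrightarrow> odd x" "q > 0"
  shows "\<exists>Dp D0. skein_triple (odd_pretzel c (p # q # L)) Dp D0 \<and> isotopic Dp (odd_pretzel c (p # (q - 2) # L)) \<and> isotopic D0 (odd_pretzel c (p # L))"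
proof -
  have "run (twists 2 p @ [Cap 1, Cap 0]) ([c, \<not> c] @ [\<not> c, c]) = Some []"
    using run_twists[of "[c, \<not> c]" 2 p "\<not> c" c "[]"] assms(1) by (simp add: run_append)
  then show ?thesis
    using skein_columns[of L "[Cup 0 (\<not> c), Cup 1 c]" c "[\<not> c, c]" "twists 2 p @ [Cap 1, Cap 0]" q] assms by (simp add: odd_pretzel_def)
qed

lemma isotopic_odd_pretzel_cancel: "(\<And>x. x \<in> set L \<Longrightarrow> odd x) \<Longrightarrow> isotopic (odd_pretzel c (- 1 # 1 # L)) (odd_pretzel c L)"
proof -
  assume L: "\<And>x. x \<in> set L \<Longrightarrow> odd x"
  have "deform 0 (odd_pretzel c (- 1 # 1 # L)) (odd_pretzel c L)"
    using deform_trans[OF deform_odd_pretzel_clasped[of c 0 L]] deform_clasped_0 by fastforce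
  moreover have "is_diagram (odd_pretzel c (- 1 # 1 # L))" by (rule is_diagram_odd_pretzel) (use L in auto)
  ultimately show ?thesis using deform_closed by fastforce
qed

section \<open>Recursion over the columns\<close>

text \<open>The first column goes from \<open>2 * i + 1\<close> to \<open>- 1\<close> in
  \<open>i + 1\<close> steps; the second one goes from \<open>2 * j + 1\<close> to 1 in only
  \<open>j\<close> steps, since there it cancels against \<open>- 1\<close>. Each step contributes
  the value \<open>g\<close> of the diagram from which the lowered column is deleted.\<close>

lemma column_recursion:
  fixes f g :: "int list \<Rightarrow> real"
  assumes 1: "\<And>i. f ((2 * int i + 1) # q # M) = f ((2 * int i + 1 - 2) # q # M) + g (q # M)"
    and 2: "\<And>i. f (- 1 # (2 * int i + 1) # M) = f (- 1 # (2 * int i + 1 - 2) # M) + g (- 1 # M)"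
    and 3: "f (- 1 # 1 # M) = f M" and "p = 2 * int i + 1" "q = 2 * int j + 1"
  shows "f (p # q # M) = f M + (real i + 1) * g (q # M) + real j * g (- 1 # M)"
proof -
  have A: "f ((2 * int i + 1) # q # M) = f (- 1 # q # M) + (real i + 1) * g (q # M)" for i
  proof (induction i)
    case 0
    then show ?case using 1[of 0] by simp
  next
    case (Suc i)
    then show ?case using 1[of "Suc i"] by (simp add: algebra_simps)
  qed
  have B: "f (- 1 # (2 * int j + 1) # M) = f M + real j * g (- 1 # M)" for j
  proof (induction j)
    case 0
    then show ?case using 3 by simp
  next
    case (Suc j)
    then show ?case using 2[of "Suc j"] by (simp add: algebra_simps)
  qed
  show ?thesis using A[of i] B[of j] by (simp add: assms(4,5)[symmetric])
qed

text \<open>Besides positive columns, \<open>- 1\<close> must be allowed as the value at which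
  lowering ends.\<close>

definition odds :: "int list \<Rightarrow> bool" where "odds L \<longleftrightarrow> (\<forall>p\<in>set L. odd p \<and> p \<ge> - 1)"

lemma odds_simps[simp]: "odds []" "odds (p # L) \<longleftrightarrow> odd p \<and> p \<ge> - 1 \<and> odds L"
  by (auto simp: odds_def)

lemma oddsI: "(\<And>p. p \<in> set L \<Longrightarrow> odd p \<and> p > 0) \<Longrightarrow> odds L"
  by (force simp: odds_def)

lemma oddsD: "odds L \<Longrightarrow> x \<in> set L \<Longrightarrow> odd x"
  unfolding odds_def by blast

text \<open>Lowering steps and cancellations connect all lists whose lengths have the same parity
  \<open>e\<close>, so a function that ignores them is determined by its value on the shortest
  list.\<close>

lemma parity_invariant:
  fixes f :: "int list \<Rightarrow> real"
  assumes 1: "\<And>p M. odds (p # M) \<Longrightarrow> p > 0 \<Longrightarrow> even (length (p # M)) = e \<Longrightarrow> f (p # M) = f ((p - 2) # M)"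
    and 2: "\<And>q M. odds (q # M) \<Longrightarrow> q > 0 \<Longrightarrow> even (length M) = e \<Longrightarrow> f (- 1 # q # M) = f (- 1 # (q - 2) # M)"
    and 3: "\<And>M. odds M \<Longrightarrow> even (length M) = e \<Longrightarrow> f (- 1 # 1 # M) = f M"
    and L: "odds L" "even (length L) = e"
  shows "f L = (if e then f [] else f [- 1])"
proof -
  have red1: "f ((2 * int i + 1) # M) = f (- 1 # M)" if "odds M" "odd (length M) = e" for i M
  proof (induction i)
    case 0
    then show ?case using 1[of 1 M] that by simp
  next
    case (Suc i)
    then show ?case using 1[of "2 * int (Suc i) + 1" M] that by (simp add: add.commute)
  qed
  have red2: "f (- 1 # (2 * int i + 1) # M) = f (- 1 # - 1 # M)" if "odds M" "even (length M) = e" for i M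
  proof (induction i)
    case 0
    then show ?case using 2[of 1 M] that by simp
  next
    case (Suc i)
    then show ?case using 2[of "2 * int (Suc i) + 1" M] that by (simp add: add.commute)
  qed
  have cases: "x = - 1 \<or> (\<exists>i. x = 2 * int i + 1)" if "odd x" "x \<ge> - 1" for x
  proof (cases "x > 0")
    case True
    then show ?thesis using odd_pos_int that by blast
  next
    case False
    then show ?thesis using that by (cases "x = 0") auto
  qed
  show ?thesis
    using L
  proof (induction L rule: induct_list012)
    case (2 p)
    then show ?case using red1[of "[]"] cases[of p] by auto
  next
    case (3 p q M)
    have h: "odds (q # M)" "odds M" "odd (length (q # M)) = e" "even (length M) = e" using 3(3,4) by auto
    have "f (p # q # M) = f (- 1 # q # M)" using red1[OF h(1,3)] cases[of p] 3(3) by auto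
    also have "\<dots> = f (- 1 # - 1 # M)" using red2[OF h(2,4)] cases[of q] 3(3) by auto
    \<comment> \<open>The second \<open>- 1\<close> is raised to 1, after which the two columns
      cancel.\<close>
    also have "\<dots> = f M" using red2[OF h(2,4), of 0] 3(1)[OF h(2,4)] assms(3)[OF h(2,4)] by simp
    finally show ?case using 3(1)[OF h(2,4)] by simp
  qed auto
qed

context
  fixes l :: "int list \<Rightarrow> real"
  assumes l1: "\<And>p q M. odds (p # q # M) \<Longrightarrow> p > 0 \<Longrightarrow> even (length M) \<Longrightarrow> l (p # q # M) = l ((p - 2) # q # M) + 1"
    and l2: "\<And>q M. odds (q # M) \<Longrightarrow> q > 0 \<Longrightarrow> even (length M) \<Longrightarrow> l (- 1 # q # M) = l (- 1 # (q - 2) # M) + 1"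
    and l3: "\<And>M. odds M \<Longrightarrow> even (length M) \<Longrightarrow> l (- 1 # 1 # M) = l M" and l4: "l [] = 0"
begin

text \<open>The \<open>l\<close> of the context stands for the linking number of a two-component
  pretzel link, up to sign. It is given by its recursion because it has two incarnations: minus the
  coefficient of z in the Conway polynomial, and the coefficient of h in \<open>V\<close> divided by
  24.\<close>

lemma linking_formula:
  assumes "\<And>p. p \<in> set L \<Longrightarrow> odd p \<and> p > 0" "even (length L)"
  shows "l L = real_of_int (sum_list L) / 2"
  using assms
proof (induction L rule: induct_list012)
  case (3 p q M)
  obtain i where i: "p = 2 * int i + 1" using odd_pos_int 3(3)[of p] by auto
  obtain j where j: "q = 2 * int j + 1" using odd_pos_int 3(3)[of q] by auto
  have "l (p # q # M) = l M + (real i + 1) * 1 + real j * 1"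
  proof (rule column_recursion[where g = "\<lambda>_. 1"])
    have "odds M" using 3(3) by (intro oddsI) auto
    then show "l ((2 * int i + 1) # q # M) = l ((2 * int i + 1 - 2) # q # M) + 1"
      "l (- 1 # (2 * int i + 1) # M) = l (- 1 # (2 * int i + 1 - 2) # M) + 1" "l (- 1 # 1 # M) = l M" for i
      using l1[of "2 * int i + 1" q M] l2[of "2 * int i + 1" M] l3[of M] 3(4) j by auto
  qed (use i j in auto)
  then show ?case using 3 i j by (simp add: field_simps)
qed (use l4 in auto)

text \<open>A column \<open>- 1\<close> lies outside the range of \<open>linking_formula\<close> and
  is reached from the column 1 by one step of the recursion.\<close>

lemma linking_formula':
  assumes "\<And>p. p \<in> set M \<Longrightarrow> odd p \<and> p > 0" "odd (length M)"
  shows "l (- 1 # M) = (real_of_int (sum_list M) - 1) / 2"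
proof -
  obtain q N where M: "M = q # N" using assms(2) by (cases M) auto
  have "l (1 # M) = real_of_int (sum_list (1 # M)) / 2"
    by (rule linking_formula) (use assms in auto)
  moreover have "l (1 # M) = l (- 1 # M) + 1"
    using l1[of 1 q N] assms oddsI[of M] by (auto simp: M)
  ultimately show ?thesis by simp
qed

text \<open>The hypotheses on \<open>a\<close> are the skein relation in degree two, where the
  smoothed link enters through its linking number; a single column is an unknot.\<close>

lemma a2_formula:
  fixes a :: "int list \<Rightarrow> real"
  assumes a1: "\<And>p q M. odds (p # q # M) \<Longrightarrow> p > 0 \<Longrightarrow> odd (length M) \<Longrightarrow> a (p # q # M) = a ((p - 2) # q # M) + l (q # M)"
    and a2: "\<And>q M. odds (q # M) \<Longrightarrow> q > 0 \<Longrightarrow> odd (length M) \<Longrightarrow> a (- 1 # q # M) = a (- 1 # (q - 2) # M) + l (- 1 # M)"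
    and a3: "\<And>M. odds M \<Longrightarrow> odd (length M) \<Longrightarrow> a (- 1 # 1 # M) = a M" and a4: "\<And>p. odd p \<Longrightarrow> a [p] = 0"
    and "\<And>p. p \<in> set L \<Longrightarrow> odd p \<and> p > 0" "odd (length L)"
  shows "8 * a L = 2 * real_of_int (esym2 L) + real (length L) - 1"
  using assms(5,6)
proof (induction L rule: induct_list012)
  case (3 p q M)
  obtain i where i: "p = 2 * int i + 1" using odd_pos_int 3(3)[of p] by auto
  obtain j where j: "q = 2 * int j + 1" using odd_pos_int 3(3)[of q] by auto
  define S where "S = real_of_int (sum_list M)"
  have "l (q # M) = real_of_int (sum_list (q # M)) / 2"
    by (rule linking_formula) (use 3 in auto)
  then have lq: "l (q # M) = (2 * real j + 1 + S) / 2" by (simp add: j S_def)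
  have lm: "l (- 1 # M) = (S - 1) / 2"
    unfolding S_def by (rule linking_formula') (use 3 in auto)
  have "a (p # q # M) = a M + (real i + 1) * l (q # M) + real j * l (- 1 # M)"
  proof (rule column_recursion)
    have "odds M" using 3(3) by (intro oddsI) auto
    then show "a ((2 * int i + 1) # q # M) = a ((2 * int i + 1 - 2) # q # M) + l (q # M)"
      "a (- 1 # (2 * int i + 1) # M) = a (- 1 # (2 * int i + 1 - 2) # M) + l (- 1 # M)" "a (- 1 # 1 # M) = a M" for i
      using a1[of "2 * int i + 1" q M] a2[of "2 * int i + 1" M] a3[of M] 3(4) j by auto
  qed (use i j in auto)
  then have a: "8 * a (p # q # M) = 8 * a M + 4 * (real i + 1) * (2 * real j + 1 + S) + 4 * real j * (S - 1)"
    unfolding lq lm by (simp add: field_simps)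
  have aM: "8 * a M = 2 * real_of_int (esym2 M) + real (length M) - 1" using 3 by auto
  have e: "real_of_int (esym2 (p # q # M)) =
      (2 * real i + 1) * (2 * real j + 1 + S) + (2 * real j + 1) * S + real_of_int (esym2 M)"
    by (simp add: i j S_def)
  have len: "real (length (p # q # M)) = real (length M) + 2" by simp
  show ?case unfolding a e len aM by algebra
qed (use a4 in auto)

end

section \<open>Evaluation of an arbitrary Conway polynomial\<close>

lemma conway_skein:
  assumes "conway_polynomial nabla" "skein_triple Dn Dp D0"
  shows "nabla Dp - nabla Dn = [:0, 1:] * nabla D0"
proof -
  obtain A B i w where s: "Dn = A @ [P i] @ B" "Dp = A @ [N i] @ B" "D0 = A @ smoothing i w @ B"
     "run A [] = Some w" "w ! i \<noteq> w ! (i + 1)" "is_diagram Dp" using assms(2) unfolding skein_triple_def by blast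
  have "nabla (A @ [Cross i False] @ B) - nabla (A @ [Cross i (\<not> False)] @ B) = [:0, 1:] * nabla (A @ smoothing i w @ B)"
    using assms(1) s unfolding conway_polynomial_def by blast
  then show ?thesis using s by simp
qed

text \<open>A circle with a curl of either sign is an unknot, so z times the value on the unlink is
  a difference of equal polynomials.\<close>

lemma conway_unlink:
  assumes "conway_polynomial nabla"
  shows "nabla (odd_pretzel c []) = 0"
proof -
  have t: "skein_triple [Cup 0 (\<not> c), P 0, Cap 0] [Cup 0 (\<not> c), N 0, Cap 0] (odd_pretzel c [])"
    unfolding skein_triple_def
    by (intro exI[of _ "[Cup 0 (\<not> c)]"] exI[of _ "[Cap 0]"] exI[of _ 0] exI[of _ "[\<not> c, c]"])
      (auto simp: odd_pretzel_def smoothing_def is_diagram_def)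
  have "nabla [Cup 0 (\<not> c), Cross 0 s, Cap 0] = nabla unknot" for s
  proof -
    have "deform 0 [Cup 0 (\<not> c), Cross 0 s, Cap 0] [Cup 0 (\<not> c), Cap 0]"
      by (rule deform_in[OF deform_R1_cap[of 0 s], where X = "[Cup 0 (\<not> c)]" and Y = "[]"]) simp_all
    also have "deform 0 \<dots> unknot" by (rule deform_circle)
    finally have "isotopic [Cup 0 (\<not> c), Cross 0 s, Cap 0] unknot"
      using deform_closed by (fastforce simp: is_diagram_def)
    moreover have "is_diagram [Cup 0 (\<not> c), Cross 0 s, Cap 0]" by (simp add: is_diagram_def)
    ultimately show ?thesis using assms unfolding conway_polynomial_def by blast
  qed
  then show ?thesis using conway_skein[OF assms t] by simp
qed

lemma skein_coeff:
  fixes f g h :: "int poly" assumes "f - g = [:0, 1:] * h"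
  shows "coeff g 0 = coeff f 0" "coeff g (Suc n) = coeff f (Suc n) - coeff h n"
proof -
  have "g = f - pCons 0 h" using assms by (simp add: algebra_simps)
  then show "coeff g 0 = coeff f 0" "coeff g (Suc n) = coeff f (Suc n) - coeff h n" by simp_all
qed

lemma conway_coeff_odd_pretzel:
  assumes nabla: "conway_polynomial nabla"
    and L: "\<And>p. p \<in> set L \<Longrightarrow> odd p \<and> p > 0" "odd (length L)"
  shows "8 * real_of_int (coeff (nabla (odd_pretzel c L)) 2) = 2 * real_of_int (esym2 L) + real (length L) - 1"
proof -
  define C where "C n M = real_of_int (coeff (nabla (odd_pretzel c M)) n)" for n M
  have iso: "nabla D = nabla E" if "is_diagram D" "isotopic D E" for D E
    using nabla that unfolding conway_polynomial_def by blast
  have st: "C 0 X = C 0 X'" "C (Suc n) X = C (Suc n) X' - C n Y"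
    if "skein_triple (odd_pretzel c X) Dp D0" "isotopic Dp (odd_pretzel c X')" "isotopic D0 (odd_pretzel c Y)" for X X' Y Dp D0 n
  proof -
    have "is_diagram Dp" "is_diagram D0" using that(1) unfolding skein_triple_def by blast+
    then have "nabla Dp = nabla (odd_pretzel c X')" "nabla D0 = nabla (odd_pretzel c Y)" using iso that(2,3) by blast+
    then have "nabla (odd_pretzel c X') - nabla (odd_pretzel c X) = [:0, 1:] * nabla (odd_pretzel c Y)"
      using conway_skein[OF nabla that(1)] by simp
    from skein_coeff[OF this] show "C 0 X = C 0 X'" "C (Suc n) X = C (Suc n) X' - C n Y"
      by (simp_all add: C_def)
  qed
  have C1: "C 0 (p # M) = C 0 ((p - 2) # M)" "C (Suc n) (p # M) = C (Suc n) ((p - 2) # M) - C n M"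
    if "odds (p # M)" "p > 0" for p M n
    using skein_odd_pretzel[OF oddsD[OF that(1)] that(2), where c = c] st by blast+
  have C2: "C 0 (- 1 # q # M) = C 0 (- 1 # (q - 2) # M)" "C (Suc n) (- 1 # q # M) = C (Suc n) (- 1 # (q - 2) # M) - C n (- 1 # M)"
    if "odds (q # M)" "q > 0" for q M n
  proof -
    have "odds (- 1 # q # M)" using that(1) by simp
    from skein_odd_pretzel2[OF oddsD[OF this] that(2), where c = c]
    show "C 0 (- 1 # q # M) = C 0 (- 1 # (q - 2) # M)" "C (Suc n) (- 1 # q # M) = C (Suc n) (- 1 # (q - 2) # M) - C n (- 1 # M)"
      using st by blast+
  qed
  have C3: "C n (- 1 # 1 # M) = C n M" if "odds M" for n M
  proof -
    have "odds (- 1 # 1 # M)" using that by simp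
    from is_diagram_odd_pretzel[OF oddsD[OF this]] isotopic_odd_pretzel_cancel[OF oddsD[OF that]]
    have "nabla (odd_pretzel c (- 1 # 1 # M)) = nabla (odd_pretzel c M)" by (rule iso)
    then show ?thesis unfolding C_def by simp
  qed
  have C4: "C n [] = 0" for n using conway_unlink[OF nabla] by (simp add: C_def)
  have single: "nabla (odd_pretzel c [p]) = 1" if "odd p" for p
  proof -
    have "is_diagram (odd_pretzel c [p])" by (rule is_diagram_odd_pretzel) (use that in auto)
    moreover from this have "isotopic (odd_pretzel c [p]) unknot" using deform_closed[OF deform_odd_pretzel_single] by fastforce
    ultimately have "nabla (odd_pretzel c [p]) = nabla unknot" by (rule iso)
    then show ?thesis using nabla unfolding conway_polynomial_def by simp
  qed
  have C0: "C 0 M = (if odd (length M) then 1 else 0)" if "odds M" for M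
  proof -
    have "C 0 M = (if even (length M) then C 0 [] else C 0 [- 1])"
      by (rule parity_invariant) (use C1(1) C2(1) C3 that in auto)
    moreover have "C 0 [- 1] = 1" using single[of "- 1"] by (simp add: C_def)
    ultimately show ?thesis using C4 by simp
  qed
  have "8 * C 2 L = 2 * real_of_int (esym2 L) + real (length L) - 1"
  \<comment> \<open>A crossing \<open>P\<close> of antiparallel strands is negative, so the given
    diagram is the subtracted term of the skein relation; hence the minus sign in
    \<open>l\<close>.\<close>
  proof (rule a2_formula[where l = "\<lambda>L. - C 1 L" and a = "C 2"])
    show "- C 1 (p # q # M) = - C 1 ((p - 2) # q # M) + 1"
      if "odds (p # q # M)" "p > 0" "even (length M)" for p q M
      using C1(2)[of p "q # M" 0] C0[of "q # M"] that by simp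
    show "- C 1 (- 1 # q # M) = - C 1 (- 1 # (q - 2) # M) + 1"
      if "odds (q # M)" "q > 0" "even (length M)" for q M
      using C2(2)[of q M 0] C0[of "- 1 # M"] that by simp
    show "C 2 (p # q # M) = C 2 ((p - 2) # q # M) + - C 1 (q # M)"
      if "odds (p # q # M)" "p > 0" "odd (length M)" for p q M
      using C1(2)[of p "q # M" 1] that by (simp add: numeral_2_eq_2)
    show "C 2 (- 1 # q # M) = C 2 (- 1 # (q - 2) # M) + - C 1 (- 1 # M)"
      if "odds (q # M)" "q > 0" "odd (length M)" for q M
      using C2(2)[of q M 1] that by (simp add: numeral_2_eq_2)
    show "C 2 [p] = 0" if "odd p" for p using single[OF that] by (simp add: C_def)
  qed (use C3 C4 L in auto)
  then show ?thesis by (simp add: C_def)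
qed

section \<open>The Kauffman bracket\<close>

text \<open>
  States are words of two colours.  The variable \<open>b\<close> is the inverse of \<open>a\<close>, and the weights of minima and
  maxima are chosen such that a zigzag is the identity and a circle has the value \<open>- a\<^sup>2 - b\<^sup>2\<close>; the
  orientation of a minimum plays no role.
\<close>

definition cup :: "'a::idom \<Rightarrow> nat \<Rightarrow> (bool list \<Rightarrow> 'a) \<Rightarrow> bool list \<Rightarrow> 'a" where
  "cup b i k u = k (take i u @ [False, True] @ drop i u) - b\<^sup>2 * k (take i u @ [True, False] @ drop i u)"

definition cap :: "'a::idom \<Rightarrow> nat \<Rightarrow> (bool list \<Rightarrow> 'a) \<Rightarrow> bool list \<Rightarrow> 'a" where
  "cap a i k u = (if u ! i = u ! (i + 1) then 0 else (if u ! i then 1 else - a\<^sup>2) * k (take i u @ drop (i + 2) u))"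

text \<open>Continuations replace matrices: \<open>k\<close> is the weight of everything above, as a
  function of the state, and a slice turns it into the weight from its own bottom upwards. The
  clause for a crossing is the Kauffman relation.\<close>

fun bracket1 :: "'a::idom \<Rightarrow> 'a \<Rightarrow> slice \<Rightarrow> (bool list \<Rightarrow> 'a) \<Rightarrow> bool list \<Rightarrow> 'a" where
  "bracket1 a b (Cup i o') k = cup b i k"
| "bracket1 a b (Cap i) k = cap a i k"
| "bracket1 a b (Cross i s) k = (\<lambda>u. (if s then a else b) * k u + (if s then b else a) * cap a i (cup b i k) u)"

definition bracket :: "'a::idom \<Rightarrow> 'a \<Rightarrow> diagram \<Rightarrow> (bool list \<Rightarrow> 'a) \<Rightarrow> bool list \<Rightarrow> 'a" where
  "bracket a b D k = foldr (bracket1 a b) D k"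

lemma bracket_simps[simp]: "bracket a b [] k = k" "bracket a b (g # D) k = bracket1 a b g (bracket a b D k)" "bracket a b (D @ E) k = bracket a b D (bracket a b E k)"
  by (simp_all add: bracket_def)

lemma cup_at: "length p = i \<Longrightarrow> cup b i k (p @ q) = k (p @ False # True # q) - b\<^sup>2 * k (p @ True # False # q)"
  by (simp add: cup_def)

lemma cap_at: "length p = i \<Longrightarrow> cap a i k (p @ x # y # q) = (if x = y then 0 else (if x then 1 else - a\<^sup>2) * k (p @ q))"
  by (auto simp: cap_def nth_append)

lemma inverse_simps: assumes "a * b = (1::'a::idom)" shows "a * b = 1" "b * a = 1" "a * (b * c) = c" "b * (a * c) = c"
  using assms by (simp_all add: mult.commute mult.assoc[symmetric])

lemmas power_algebra_simps = algebra_simps power2_eq_square power3_eq_cube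

lemma cross_True_at: assumes "a * b = 1" "length p = i" shows
  "bracket1 a b (Cross i True) k (p @ x # y # q) = (if x = y then a * k (p @ x # y # q)
     else if x then b * k (p @ False # True # q) + (a - b ^ 3) * k (p @ True # False # q) else b * k (p @ True # False # q))"
  using assms(2) by (cases x; cases y; simp add: cap_at cup_at power_algebra_simps inverse_simps[OF assms(1)])

lemma cross_False_at: assumes "a * b = 1" "length p = i" shows
  "bracket1 a b (Cross i False) k (p @ x # y # q) = (if x = y then b * k (p @ x # y # q)
     else if x then a * k (p @ False # True # q) else a * k (p @ True # False # q) + (b - a ^ 3) * k (p @ False # True # q))"
  using assms(2) by (cases x; cases y; simp add: cap_at cup_at power_algebra_simps inverse_simps[OF assms(1)])

fun bracket_loc :: "'a::idom \<Rightarrow> 'a \<Rightarrow> slice \<Rightarrow> bool list \<Rightarrow> (bool list \<Rightarrow> 'a) \<Rightarrow> 'a" where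
  "bracket_loc a b (Cup i o') x K = K [False, True] - b\<^sup>2 * K [True, False]"
| "bracket_loc a b (Cap i) x K = (if x ! 0 = x ! 1 then 0 else (if x ! 0 then 1 else - a\<^sup>2) * K [])"
| "bracket_loc a b (Cross i s) x K = (if s then a else b) * K x +
     (if s then b else a) * (if x ! 0 = x ! 1 then 0 else (if x ! 0 then 1 else - a\<^sup>2) * (K [False, True] - b\<^sup>2 * K [True, False]))"

lemma bracket1_bracket_loc: "length p = pos g \<Longrightarrow> length x = ins g \<Longrightarrow> bracket1 a b g k (p @ x @ z) = bracket_loc a b g x (\<lambda>y. k (p @ y @ z))"
  by (cases g) (auto simp: numeral_2_eq_2 length_Suc_conv cup_at cap_at)

lemma bracket_loc_shift[simp]: "bracket_loc a b (shift n g) = bracket_loc a b g"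
  by (cases g) (auto simp: fun_eq_iff)

lemma bracket_loc_commute: "bracket_loc a b g x (\<lambda>x'. bracket_loc a b h y (\<lambda>y'. K x' y')) = bracket_loc a b h y (\<lambda>y'. bracket_loc a b g x (\<lambda>x'. K x' y'))"
  by (cases g; cases h) (auto simp: algebra_simps)

lemma bracket_loc_cong: "length x = ins g \<Longrightarrow> (\<And>y. length y = outs g \<Longrightarrow> K y = K' y) \<Longrightarrow> bracket_loc a b g x K = bracket_loc a b g x K'"
  by (cases g) auto

lemma bracket1_cong:
  assumes "act g w = Some v" "length u = length w" "\<And>u'. length u' = length v \<Longrightarrow> k u' = k' u'"
  shows "bracket1 a b g k u = bracket1 a b g k' u"
proof -
  have "pos g + ins g \<le> length u" using act_defined assms by simp
  then obtain p x q where u: "u = p @ x @ q" "length p = pos g" "length x = ins g" by (rule split_ins)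
  have "length v + ins g = length w + outs g" using length_act assms by blast
  then show ?thesis unfolding u bracket1_bracket_loc[OF u(2,3)]
    by (intro bracket_loc_cong) (use u assms in auto)
qed

lemma bracket_cong:
  assumes "run D w = Some v" "length u = length w" "\<And>u'. length u' = length v \<Longrightarrow> k u' = k' u'"
  shows "bracket a b D k u = bracket a b D k' u"
  using assms
proof (induction D arbitrary: w u)
  case (Cons g D)
  then obtain x where x: "act g w = Some x" "run D x = Some v" by (auto simp: Option.bind_eq_Some_conv)
  show ?case unfolding bracket_simps
    by (rule bracket1_cong[OF x(1) Cons.prems(2)]) (use Cons x in blast)
qed simp

lemma bracket1_scale: "bracket1 a b g (\<lambda>y. c * k y) u = c * bracket1 a b g k u"
  by (cases g) (auto simp: algebra_simps cup_def cap_def)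

lemma bracket1_add: "bracket1 a b g (\<lambda>y. k y + k' y) u = bracket1 a b g k u + bracket1 a b g k' u"
  by (cases g) (auto simp: algebra_simps cup_def cap_def)

lemma bracket_scale: "bracket a b D (\<lambda>y. c * k y) u = c * bracket a b D k u"
proof (induction D arbitrary: u)
  case (Cons g D)
  then have "bracket a b D (\<lambda>y. c * k y) = (\<lambda>y. c * bracket a b D k y)" by auto
  then show ?case by (simp add: bracket1_scale)
qed simp

lemma bracket_add: "bracket a b D (\<lambda>y. k y + k' y) u = bracket a b D k u + bracket a b D k' u"
proof (induction D arbitrary: u)
  case (Cons g D)
  then have "bracket a b D (\<lambda>y. k y + k' y) = (\<lambda>y. bracket a b D k y + bracket a b D k' y)" by auto
  then show ?case by (simp add: bracket1_add)
qed simp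

text \<open>
  The product of these factors is \<open>(- a\<^sup>3)\<close> to the power of minus the writhe.
\<close>

fun framing1 :: "'a::idom \<Rightarrow> 'a \<Rightarrow> slice \<Rightarrow> bool list \<Rightarrow> 'a" where
  "framing1 a b (Cross i s) w = (if s = (w ! i = w ! (i + 1)) then - (b ^ 3) else - (a ^ 3))"
| "framing1 a b g w = 1"

fun framing :: "'a::idom \<Rightarrow> 'a \<Rightarrow> diagram \<Rightarrow> bool list \<Rightarrow> 'a" where
  "framing a b [] w = 1"
| "framing a b (g # D) w = framing1 a b g w * framing a b D (the (act g w))"

lemma framing_append: "run D w = Some v \<Longrightarrow> framing a b (D @ E) w = framing a b D w * framing a b E v"
  by (induction D arbitrary: w) (auto simp: Option.bind_eq_Some_conv)

fun framing_loc :: "'a::idom \<Rightarrow> 'a \<Rightarrow> slice \<Rightarrow> bool list \<Rightarrow> 'a" where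
  "framing_loc a b (Cross i s) x = (if s = (x ! 0 = x ! 1) then - (b ^ 3) else - (a ^ 3))"
| "framing_loc a b g w = 1"

lemma framing1_framing_loc: "length p = pos g \<Longrightarrow> length x = ins g \<Longrightarrow> framing1 a b g (p @ x @ z) = framing_loc a b g x"
  by (cases g) (auto simp: numeral_2_eq_2 length_Suc_conv nth_append)

lemma framing_loc_shift[simp]: "framing_loc a b (shift n g) = framing_loc a b g"
  by (cases g) (auto simp: fun_eq_iff)

text \<open>The framing belongs to the equation because a curl multiplies the bracket by
  \<open>- (a ^ 3)\<close> or its inverse. Quantifying over all continuations and states makes the
  equation usable inside any diagram.\<close>

definition sound :: "'a::idom \<Rightarrow> 'a \<Rightarrow> diagram \<Rightarrow> diagram \<Rightarrow> bool" where
  "sound a b l r \<longleftrightarrow> (\<forall>w v k u. run l w = Some v \<longrightarrow> length u = length w \<longrightarrow>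
     framing a b l w * bracket a b l k u = framing a b r w * bracket a b r k u)"

section \<open>Invariance under the local rules\<close>

lemma sound_exchange:
  assumes "pos g \<le> pos h" shows "sound a b [g, shift (outs g) h] [shift (ins g) h, g]"
  unfolding sound_def
proof (intro allI impI)
  fix w v and k :: "bool list \<Rightarrow> 'a" and u :: "bool list"
  assume r: "run [g, shift (outs g) h] w = Some v" and u: "length u = length w"
  have le: "pos h + ins g + ins h \<le> length w"
  proof -
    have "run [shift (ins g) h, g] w = Some v" using r run_exchange[OF assms] by simp
    then obtain x where "act (shift (ins g) h) w = Some x" by (auto simp: Option.bind_eq_Some_conv)
    then show ?thesis using act_defined by fastforce
  qed
  obtain p x q y z where w: "w = p @ x @ q @ y @ z" "length p = pos g" "length x = ins g"
    "pos h = pos g + length q" "length y = ins h"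
    using split_ins2[OF assms le] .
  obtain p' x' q' y' z' where u': "u = p' @ x' @ q' @ y' @ z'" "length p' = pos g" "length x' = ins g"
    "pos h = pos g + length q'" "length y' = ins h"
    using split_ins2[OF assms, of u] le u by metis
  have ag: "act g (p @ x @ s) = map_option (\<lambda>y. p @ y @ s) (act_loc g x)" for s
    using w by (simp add: act_act_loc)
  have ah: "act (shift n h) (p @ x' @ q @ y @ z) = map_option (\<lambda>y'. p @ x' @ q @ y' @ z) (act_loc h y)"
    if "length x' = n" for x' n
    using w that act_act_loc[of "p @ x' @ q" "shift n h" y z] by simp
  obtain x1 where x1: "act_loc g x = Some x1" "length x1 = outs g"
    using r length_act_loc by (auto simp: w(1) ag Option.bind_eq_Some_conv)
  obtain y1 where y1: "act_loc h y = Some y1"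
    using r ah[OF x1(2)] by (auto simp: w(1) ag x1 Option.bind_eq_Some_conv)
  have fg: "framing1 a b g (p @ x @ s) = framing_loc a b g x" for s using w by (simp add: framing1_framing_loc)
  have fh: "framing1 a b (shift n h) (p @ x' @ q @ y @ z) = framing_loc a b h y" if "length x' = n" for x' n
    using w that framing1_framing_loc[of "p @ x' @ q" "shift n h" y a b z] by simp
  have f: "framing a b [g, shift (outs g) h] w = framing a b [shift (ins g) h, g] w"
    using w(3) x1 y1 by (simp add: w(1) fg fh ag ah)
  have eg: "bracket1 a b g K (p' @ x' @ s) = bracket_loc a b g x' (\<lambda>y. K (p' @ y @ s))" for s K
    using u' by (simp add: bracket1_bracket_loc)
  have eh: "bracket1 a b (shift n h) K (p' @ t @ q' @ y' @ z') = bracket_loc a b h y' (\<lambda>y. K (p' @ t @ q' @ y @ z'))" if "length t = n" for t n K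
    using u' that bracket1_bracket_loc[of "p' @ t @ q'" "shift n h" y' a b K z'] by simp
  have "bracket a b [g, shift (outs g) h] k u = bracket_loc a b g x' (\<lambda>s. bracket1 a b (shift (outs g) h) k (p' @ s @ q' @ y' @ z'))"
    by (simp add: u'(1) eg)
  also have "\<dots> = bracket_loc a b g x' (\<lambda>s. bracket_loc a b h y' (\<lambda>t. k (p' @ s @ q' @ t @ z')))"
    by (rule bracket_loc_cong) (use u' eh in auto)
  also have "\<dots> = bracket_loc a b h y' (\<lambda>t. bracket_loc a b g x' (\<lambda>s. k (p' @ s @ q' @ t @ z')))"
    by (rule bracket_loc_commute)
  also have "\<dots> = bracket a b [shift (ins g) h, g] k u"
    using u'(3) by (simp add: u'(1) eh eg)
  finally show "framing a b [g, shift (outs g) h] w * bracket a b [g, shift (outs g) h] k u = framing a b [shift (ins g) h, g] w * bracket a b [shift (ins g) h, g] k u"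
    using f by simp
qed

lemma sound_zigzag_right: assumes "a * b = 1" shows "sound a b [Cup (i + 1) c, Cap i] []"
  unfolding sound_def
proof (intro allI impI)
  fix w v and k :: "bool list \<Rightarrow> 'a" and u :: "bool list"
  assume "run [Cup (i + 1) c, Cap i] w = Some v" "length u = length w"
  then have "i < length u" by (auto split: if_splits)
  then obtain p x q where u: "u = p @ x # q" "length p = i" by (rule split1)
  have "cup b (i + 1) (cap a i k) u = k u"
    using cup_at[of "p @ [x]" "i + 1" b "cap a i k" q] u(2)
    unfolding u(1) by (cases x; simp add: cap_at power_algebra_simps inverse_simps[OF assms(1)])
  then show "framing a b [Cup (i + 1) c, Cap i] w * bracket a b [Cup (i + 1) c, Cap i] k u = framing a b [] w * bracket a b [] k u" by simp
qed

lemma sound_zigzag_left: assumes "a * b = 1" shows "sound a b [Cup i c, Cap (i + 1)] []"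
  unfolding sound_def
proof (intro allI impI)
  fix w v and k :: "bool list \<Rightarrow> 'a" and u :: "bool list"
  assume "run [Cup i c, Cap (i + 1)] w = Some v" "length u = length w"
  then have "i < length u" by (auto split: if_splits)
  then obtain p x q where u: "u = p @ x # q" "length p = i" by (rule split1)
  have "cup b i (cap a (i + 1) k) u = k u"
    using cup_at[of p i b "cap a (i + 1) k" "x # q"] cap_at[of "p @ [True]" "i + 1" a k False x q]
      cap_at[of "p @ [False]" "i + 1" a k True x q] u(2)
    unfolding u(1) by (cases x; simp add: power_algebra_simps inverse_simps[OF assms(1)])
  then show "framing a b [Cup i c, Cap (i + 1)] w * bracket a b [Cup i c, Cap (i + 1)] k u = framing a b [] w * bracket a b [] k u" by simp
qed

lemma cross_at3:
  assumes "a * b = 1" "length p = i"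
  shows "bracket1 a b (Cross (i + 1) True) k (p @ e # x # y # q) = (if x = y then a * k (p @ e # x # y # q)
     else if x then b * k (p @ e # False # True # q) + (a - b ^ 3) * k (p @ e # True # False # q) else b * k (p @ e # True # False # q))"
   "bracket1 a b (Cross (i + 1) False) k (p @ e # x # y # q) = (if x = y then b * k (p @ e # x # y # q)
     else if x then a * k (p @ e # False # True # q) else a * k (p @ e # True # False # q) + (b - a ^ 3) * k (p @ e # False # True # q))"
  using cross_True_at[OF assms(1), of "p @ [e]" "i + 1" k x y q] cross_False_at[OF assms(1), of "p @ [e]" "i + 1" k x y q] assms(2)
  by (simp_all del: bracket1.simps)

lemmas cross_simps = cross_True_at cross_False_at cross_at3[simplified Suc_eq_plus1[symmetric]]

lemma cap_at3: "length p = i \<Longrightarrow> cap a (i + 1) k (p @ e # x # y # q) = (if x = y then 0 else (if x then 1 else - a\<^sup>2) * k (p @ e # q))"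
  using cap_at[of "p @ [e]" "i + 1" a k x y q] by simp

lemma sound_slide_cap: assumes "a * b = 1" shows "sound a b [Cross i s, Cap (i + 1)] [Cross (i + 1) (\<not> s), Cap i]"
  unfolding sound_def
proof (intro allI impI)
  fix w v and k :: "bool list \<Rightarrow> 'a" and u :: "bool list"
  assume r: "run [Cross i s, Cap (i + 1)] w = Some v" and lu: "length u = length w"
  then have le: "i + 2 < length w" by (auto split: if_splits)
  obtain p x y z q where u: "u = p @ x # y # z # q" "length p = i" by (rule split3[of i u]) (use le lu in auto)
  obtain p' x' y' z' q' where w: "w = p' @ x' # y' # z' # q'" "length p' = i" by (rule split3[OF le])
  have "x' \<noteq> z'" using r act_Cross[OF w(2), of s x' y' "z' # q'"] act_Cap[of "p' @ [y']" "i + 1" x' z' q'] w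
    by (auto simp: run_pair simp del: act.simps split: if_splits)
  then have f: "framing a b [Cross i s, Cap (i + 1)] w = framing a b [Cross (i + 1) (\<not> s), Cap i] w"
    using w by (auto simp: nth_append)
  have "bracket a b [Cross i s, Cap (i + 1)] k u = bracket a b [Cross (i + 1) (\<not> s), Cap i] k u"
    using u(2) unfolding bracket_simps u(1)
    by (cases s; cases x; cases y; cases z;
        simp add: cross_simps[OF assms] cap_at cap_at3[simplified] power_algebra_simps inverse_simps[OF assms(1)] del: bracket1.simps(3))
  then show "framing a b [Cross i s, Cap (i + 1)] w * bracket a b [Cross i s, Cap (i + 1)] k u =
    framing a b [Cross (i + 1) (\<not> s), Cap i] w * bracket a b [Cross (i + 1) (\<not> s), Cap i] k u" using f by simp
qed

lemma framing1_Cross_at: "length p = i \<Longrightarrow> framing1 a b (Cross i s) (p @ x # y # q) = (if s = (x = y) then - (b ^ 3) else - (a ^ 3))"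
  "length p = i \<Longrightarrow> framing1 a b (Cross (Suc i) s) (p @ e # x # y # q) = (if s = (x = y) then - (b ^ 3) else - (a ^ 3))"
  by (auto simp: nth_append)

lemma act_Cross_at: "length p = i \<Longrightarrow> act (Cross i s) (p @ x # y # q) = Some (p @ y # x # q)"
  "length p = i \<Longrightarrow> act (Cross (Suc i) s) (p @ e # x # y # q) = Some (p @ e # y # x # q)"
  using act_Cross[of "p @ [e]" "Suc i" s x y q] by (auto simp: nth_append)

lemma cup_at1: "length p = i \<Longrightarrow> cup b (Suc i) k (p @ x # q) = k (p @ x # False # True # q) - b\<^sup>2 * k (p @ x # True # False # q)"
  using cup_at[of "p @ [x]" "Suc i" b k q] by simp

lemma sound_slide_cup: assumes "a * b = 1" shows "sound a b [Cup (i + 1) c, Cross i s] [Cup i c, Cross (i + 1) (\<not> s)]"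
  unfolding sound_def
proof (intro allI impI)
  fix w v and k :: "bool list \<Rightarrow> 'a" and u :: "bool list"
  assume r: "run [Cup (i + 1) c, Cross i s] w = Some v" and lu: "length u = length w"
  then have le: "i < length w" by (auto split: if_splits)
  obtain p x q where u: "u = p @ x # q" "length p = i" by (rule split1[of i u]) (use le lu in auto)
  obtain p' x' q' where w: "w = p' @ x' # q'" "length p' = i" by (rule split1[OF le])
  have "act (Cup (i + 1) c) w = Some (p' @ x' # c # (\<not> c) # q')" "act (Cup i c) w = Some (p' @ c # (\<not> c) # x' # q')"
    using w act_Cup[of "p' @ [x']" "i + 1" c q'] act_Cup[of p' i c "x' # q'"] by (simp_all del: act.simps)
  then have f: "framing a b [Cup (i + 1) c, Cross i s] w = framing a b [Cup i c, Cross (i + 1) (\<not> s)] w"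
    using w(2) by (auto simp: framing1_Cross_at simp del: act.simps framing1.simps(1))
  have "bracket a b [Cup (i + 1) c, Cross i s] k u = bracket a b [Cup i c, Cross (i + 1) (\<not> s)] k u"
    using u(2) unfolding bracket_simps u(1)
    by (cases s; cases x;
        simp add: cross_simps[OF assms] cup_at cup_at1 power_algebra_simps inverse_simps[OF assms(1)] del: bracket1.simps(3))
  then show "framing a b [Cup (i + 1) c, Cross i s] w * bracket a b [Cup (i + 1) c, Cross i s] k u =
    framing a b [Cup i c, Cross (i + 1) (\<not> s)] w * bracket a b [Cup i c, Cross (i + 1) (\<not> s)] k u" using f by simp
qed

lemma sound_R1_cap: assumes "a * b = 1" shows "sound a b [Cross i s, Cap i] [Cap i]"
  unfolding sound_def
proof (intro allI impI)
  fix w v and k :: "bool list \<Rightarrow> 'a" and u :: "bool list"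
  assume r: "run [Cross i s, Cap i] w = Some v" and lu: "length u = length w"
  then have le: "i + 1 < length w" by (auto split: if_splits)
  obtain p x y q where u: "u = p @ x # y # q" "length p = i" by (rule split2[of i u]) (use le lu in auto)
  obtain p' x' y' q' where w: "w = p' @ x' # y' # q'" "length p' = i" by (rule split2[OF le])
  have "x' \<noteq> y'" using r w by (auto simp: run_pair act_Cross_at act_Cap simp del: act.simps split: if_splits)
  then have f: "framing a b [Cross i s, Cap i] w = (if s then - (a ^ 3) else - (b ^ 3))"
    using w by (auto simp: framing1_Cross_at simp del: act.simps framing1.simps(1))
  show "framing a b [Cross i s, Cap i] w * bracket a b [Cross i s, Cap i] k u = framing a b [Cap i] w * bracket a b [Cap i] k u"
    using u(2) unfolding f bracket_simps u(1)
    by (cases s; cases x; cases y;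
        simp add: cross_simps[OF assms] cap_at power_algebra_simps inverse_simps[OF assms(1)] del: bracket1.simps(3))
qed

lemma sound_R1_cup: assumes "a * b = 1" shows "sound a b [Cup i c, Cross i s] [Cup i (\<not> c)]"
  unfolding sound_def
proof (intro allI impI)
  fix w v and k :: "bool list \<Rightarrow> 'a" and u :: "bool list"
  assume r: "run [Cup i c, Cross i s] w = Some v" and lu: "length u = length w"
  then have le: "i \<le> length w" by (auto split: if_splits)
  obtain p q where u: "u = p @ q" "length p = i" by (rule split0[of i u]) (use le lu in auto)
  obtain p' q' where w: "w = p' @ q'" "length p' = i" by (rule split0[OF le])
  have f: "framing a b [Cup i c, Cross i s] w = (if s then - (a ^ 3) else - (b ^ 3))"
    using w by (auto simp: framing1_Cross_at act_Cup simp del: act.simps framing1.simps(1))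
  show "framing a b [Cup i c, Cross i s] w * bracket a b [Cup i c, Cross i s] k u = framing a b [Cup i (\<not> c)] w * bracket a b [Cup i (\<not> c)] k u"
    using u(2) unfolding f bracket_simps u(1)
    by (cases s;
        simp add: cross_simps[OF assms] cup_at power_algebra_simps inverse_simps[OF assms(1)] del: bracket1.simps(3))
qed

lemma sound_R2: assumes "a * b = 1" shows "sound a b [Cross i s, Cross i (\<not> s)] []"
  unfolding sound_def
proof (intro allI impI)
  fix w v and k :: "bool list \<Rightarrow> 'a" and u :: "bool list"
  assume r: "run [Cross i s, Cross i (\<not> s)] w = Some v" and lu: "length u = length w"
  then have le: "i + 1 < length w" by (auto split: if_splits)
  obtain p x y q where u: "u = p @ x # y # q" "length p = i" by (rule split2[of i u]) (use le lu in auto)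
  obtain p' x' y' q' where w: "w = p' @ x' # y' # q'" "length p' = i" by (rule split2[OF le])
  have f: "framing a b [Cross i s, Cross i (\<not> s)] w = 1"
    using w by (auto simp: framing1_Cross_at act_Cross_at power_algebra_simps inverse_simps[OF assms(1)] simp del: act.simps framing1.simps(1))
  show "framing a b [Cross i s, Cross i (\<not> s)] w * bracket a b [Cross i s, Cross i (\<not> s)] k u = framing a b [] w * bracket a b [] k u"
    using u(2) unfolding f bracket_simps u(1)
    by (cases s; cases x; cases y;
        simp add: cross_simps[OF assms] power_algebra_simps inverse_simps[OF assms(1)] del: bracket1.simps(3))
qed

text \<open>In the excluded cyclic case the brackets differ in general, by the amount that
  \<open>delta_bracket\<close> computes.\<close>

lemma sound_R3: assumes "a * b = 1" "\<not> (s = u' \<and> t \<noteq> s)"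
  shows "sound a b [Cross i s, Cross (i + 1) t, Cross i u'] [Cross (i + 1) u', Cross i t, Cross (i + 1) s]"
  unfolding sound_def
proof (intro allI impI)
  fix w v and k :: "bool list \<Rightarrow> 'a" and u :: "bool list"
  assume r: "run [Cross i s, Cross (i + 1) t, Cross i u'] w = Some v" and lu: "length u = length w"
  then have le: "i + 2 < length w" by (auto split: if_splits bind_splits)
  obtain p x y z q where u: "u = p @ x # y # z # q" "length p = i" by (rule split3[of i u]) (use le lu in auto)
  obtain p' x' y' z' q' where w: "w = p' @ x' # y' # z' # q'" "length p' = i" by (rule split3[OF le])
  have f: "framing a b [Cross i s, Cross (i + 1) t, Cross i u'] w = framing a b [Cross (i + 1) u', Cross i t, Cross (i + 1) s] w"
    using w by (simp add: framing1_Cross_at act_Cross_at mult_ac del: act.simps framing1.simps(1))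
  have "bracket a b [Cross i s, Cross (i + 1) t, Cross i u'] k u = bracket a b [Cross (i + 1) u', Cross i t, Cross (i + 1) s] k u"
    using u(2) assms(2) unfolding bracket_simps u(1)
    by (cases s; cases t; cases u'; cases x; cases y; cases z;
        simp add: cross_simps[OF assms(1)] power_algebra_simps inverse_simps[OF assms(1)] del: bracket1.simps(3))
  then show "framing a b [Cross i s, Cross (i + 1) t, Cross i u'] w * bracket a b [Cross i s, Cross (i + 1) t, Cross i u'] k u =
    framing a b [Cross (i + 1) u', Cross i t, Cross (i + 1) s] w * bracket a b [Cross (i + 1) u', Cross i t, Cross (i + 1) s] k u" using f by simp
qed

lemma isotopy_rule_sound: "a * b = 1 \<Longrightarrow> isotopy_rule l r \<Longrightarrow> sound a b l r"
  by (erule isotopy_rule.cases)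
    (simp_all only: sound_exchange sound_zigzag_right sound_zigzag_left sound_slide_cap sound_slide_cup sound_R1_cap sound_R1_cup
      sound_R2 sound_R3 simp_thms)

section \<open>The Jones polynomial\<close>

definition jones :: "'a::idom \<Rightarrow> 'a \<Rightarrow> diagram \<Rightarrow> 'a" where
  "jones a b D = framing a b D [] * bracket a b D (\<lambda>_. 1) []"

lemma jones_split:
  assumes "run A [] = Some w" "run X w = Some v"
  shows "jones a b (A @ X @ B) = framing a b A [] * framing a b X w * framing a b B v * bracket a b A (bracket a b X (bracket a b B (\<lambda>_. 1))) []"
proof -
  have "run (A @ X) [] = Some v" using assms by (simp add: run_append)
  then have "framing a b ((A @ X) @ B) [] = framing a b A [] * framing a b X w * framing a b B v"
    using assms framing_append by metis
  then show ?thesis by (simp add: jones_def)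
qed

lemma sound_jones:
  assumes s: "sound a b l r" and run: "run A [] = Some w" "run l w = Some v" "run r w = Some v"
  shows "jones a b (A @ l @ B) = jones a b (A @ r @ B)"
proof -
  let ?K = "bracket a b B (\<lambda>_. 1)"
  have "framing a b l w * bracket a b A (bracket a b l ?K) [] = bracket a b A (\<lambda>u. framing a b l w * bracket a b l ?K u) []" by (simp add: bracket_scale)
  also have "\<dots> = bracket a b A (\<lambda>u. framing a b r w * bracket a b r ?K u) []"
    by (rule bracket_cong[OF run(1)]) (use s run in \<open>auto simp: sound_def\<close>)
  also have "\<dots> = framing a b r w * bracket a b A (bracket a b r ?K) []" by (simp add: bracket_scale)
  finally have *: "framing a b l w * bracket a b A (bracket a b l ?K) [] = framing a b r w * bracket a b A (bracket a b r ?K) []" .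
  have "jones a b (A @ l @ B) = framing a b A [] * framing a b B v * (framing a b l w * bracket a b A (bracket a b l ?K) [])"
    unfolding jones_split[OF run(1,2)] by (simp only: mult_ac)
  also have "\<dots> = jones a b (A @ r @ B)"
    unfolding * jones_split[OF run(1,3)] by (simp only: mult_ac)
  finally show ?thesis .
qed

lemma isotopic_jones: assumes "a * b = 1" "isotopic D E" shows "jones a b D = jones a b E"
proof -
  have "jones a b D = jones a b E" if "local_move isotopy_rule D E" for D E
    using that
  proof cases
    case (1 l r A B)
    obtain w v where l: "run A [] = Some w" "run l w = Some v"
      using 1(4) by (auto simp: is_diagram_def run_append_Some)
    obtain v' where r: "run r w = Some v'"
      using 1(5) l by (auto simp: is_diagram_def run_append_Some)
    show ?thesis
    proof (cases "isotopy_rule l r")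
      case True
      then have "v' = v" using isotopy_rule_run[of l r w v] l r by simp
      then show ?thesis using sound_jones[OF isotopy_rule_sound[OF assms(1) True] l] r 1 by simp
    next
      case False
      then have T: "isotopy_rule r l" using 1 by simp
      then have "v' = v" using isotopy_rule_run[of r l w v'] l r by simp
      then show ?thesis using sound_jones[OF isotopy_rule_sound[OF assms(1) T] l(1)] l r 1 by simp
    qed
  qed
  with assms(2) show ?thesis unfolding isotopic_def by (induction rule: rtranclp_induct) auto
qed

section \<open>Colourings of the components\<close>

text \<open>Expand the crossings in the identity and the Temperley-Lieb generators e_i. The identity
  and e_i e_(i+1) + e_(i+1) e_i occur equally on both sides of the \<Delta>-move and cancel, so only
  a multiple of e_i - e_(i+1) survives.\<close>

lemma delta_bracket:
  assumes "a * b = (1::'a::idom)" "i + 2 < length u" "d = (if s then b else a)"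
  shows "bracket a b [Cross i s, Cross (i + 1) (\<not> s), Cross i s] k u - bracket a b [Cross (i + 1) s, Cross i (\<not> s), Cross (i + 1) s] k u
    = - d * (a\<^sup>2 - b\<^sup>2)\<^sup>2 * (cap a i (cup b i k) u - cap a (i + 1) (cup b (i + 1) k) u)"
proof -
  obtain p x y z q where u: "u = p @ x # y # z # q" "length p = i" by (rule split3[OF assms(2)])
  show ?thesis
    using u(2) unfolding bracket_simps u(1) assms(3)
    by (cases s; cases x; cases y; cases z;
        simp add: cross_simps[OF assms(1)] cap_at cup_at cup_at1 cap_at3[simplified] power_algebra_simps inverse_simps[OF assms(1)] del: bracket1.simps(3))
qed

text \<open>
  For \<open>a = b = - 1\<close> a crossing acts as minus the transposition.  If the colours are read along the
  orientations, the bracket therefore becomes, up to sign, the number of colourings that are constant on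
  every component; \<open>gauge\<close> collects the signs that depend on the colours.
\<close>

fun colour1 :: "slice \<Rightarrow> (bool list \<Rightarrow> real) \<Rightarrow> bool list \<Rightarrow> real" where
  "colour1 (Cup i b) k u = k (take i u @ [False, False] @ drop i u) + k (take i u @ [True, True] @ drop i u)"
| "colour1 (Cap i) k u = (if u ! i = u ! (i + 1) then k (take i u @ drop (i + 2) u) else 0)"
| "colour1 (Cross i s) k u = k (take i u @ [u ! (i + 1), u ! i] @ drop (i + 2) u)"

definition colour :: "diagram \<Rightarrow> (bool list \<Rightarrow> real) \<Rightarrow> bool list \<Rightarrow> real" where
  "colour D k = foldr colour1 D k"

lemma colour_simps[simp]: "colour [] k = k" "colour (g # D) k = colour1 g (colour D k)" "colour (D @ E) k = colour D (colour E k)"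
  by (simp_all add: colour_def)

lemma colour1_Cup: "length p = i \<Longrightarrow> colour1 (Cup i b) k (p @ q) = k (p @ False # False # q) + k (p @ True # True # q)" by simp
lemma colour1_Cap: "length p = i \<Longrightarrow> colour1 (Cap i) k (p @ x # y # q) = (if x = y then k (p @ q) else 0)" by (auto simp: nth_append)
lemma colour1_Cross: "length p = i \<Longrightarrow> colour1 (Cross i s) k (p @ x # y # q) = k (p @ y # x # q)" by (auto simp: nth_append)

lemma colour1_cong:
  assumes "act g w = Some v" "length u = length w" "\<And>u'. length u' = length v \<Longrightarrow> k u' = k' u'"
  shows "colour1 g k u = colour1 g k' u"
  using assms by (cases g) (auto split: if_splits)

lemma colour_cong:
  assumes "run D w = Some v" "length u = length w" "\<And>u'. length u' = length v \<Longrightarrow> k u' = k' u'"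
  shows "colour D k u = colour D k' u"
  using assms
proof (induction D arbitrary: w u)
  case (Cons g D)
  then obtain x where x: "act g w = Some x" "run D x = Some v" by (auto simp: Option.bind_eq_Some_conv)
  show ?case unfolding colour_simps
    by (rule colour1_cong[OF x(1) Cons.prems(2)]) (use Cons x in blast)
qed simp

lemma colour_scale: "colour D (\<lambda>y. c * k y) u = c * colour D k u"
proof (induction D arbitrary: u)
  case (Cons g D)
  then have "colour D (\<lambda>y. c * k y) = (\<lambda>y. c * colour D k y)" by auto
  then show ?case by (cases g) (auto simp: algebra_simps)
qed simp

lemma colour_add: "colour D (\<lambda>y. k y + k' y) u = colour D k u + colour D k' u"
proof (induction D arbitrary: u)
  case (Cons g D)
  then have "colour D (\<lambda>y. k y + k' y) = (\<lambda>y. colour D k y + colour D k' y)" by auto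
  then show ?case by (cases g) (auto simp: algebra_simps)
qed simp

text \<open>The legs of a maximum or minimum have opposite orientations, so unequal spins there
  amount to equal colours.\<close>

definition spins :: "bool list \<Rightarrow> bool list \<Rightarrow> bool list" where
  "spins w u = map2 (=) w u"

definition gauge :: "bool list \<Rightarrow> bool list \<Rightarrow> real" where
  "gauge w u = prod_list (map2 (\<lambda>o' c. if \<not> o' \<and> c then - 1 else 1) w u)"

lemma spins_simps[simp]: "spins [] [] = []" "spins (x # w) (y # u) = (x = y) # spins w u"
  "length w = length u \<Longrightarrow> spins (w @ w') (u @ u') = spins w u @ spins w' u'" "length (spins w u) = min (length w) (length u)"
  by (simp_all add: spins_def)

lemma gauge_simps[simp]: "gauge [] [] = 1" "gauge (x # w) (y # u) = (if \<not> x \<and> y then - 1 else 1) * gauge w u"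
  "length w = length u \<Longrightarrow> gauge (w @ w') (u @ u') = gauge w u * gauge w' u'"
  by (simp_all add: gauge_def)

lemma gauge_square[simp]: "gauge w u * gauge w u = 1" "gauge w u * (gauge w u * c) = c"
proof -
  show "gauge w u * gauge w u = 1" unfolding gauge_def by (induction w u rule: list_induct2') auto
  then show "gauge w u * (gauge w u * c) = c" by (metis mult.assoc mult_1)
qed

lemma abs_gauge[simp]: "\<bar>gauge w u\<bar> = 1"
  using gauge_square(1)[of w u] by (metis abs_mult abs_one abs_square_eq_1 power2_eq_square)

fun sign1 :: "slice \<Rightarrow> bool list \<Rightarrow> real" where
  "sign1 (Cup i b) w = (if b then 1 else - 1)"
| "sign1 (Cap i) w = (if w ! i then - 1 else 1)"
| "sign1 (Cross i s) w = - 1"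

text \<open>Of the two legs of a maximum or minimum exactly one is oriented downwards and may
  contribute to \<open>gauge\<close>; its sign absorbs the relative sign of the two states. What
  remains depends on the orientations only and is \<open>sign1\<close>.\<close>

lemma bracket1_gauge:
  assumes "act g w = Some v" "length u = length w"
  shows "bracket1 (- 1) (- 1) g k (spins w u) = sign1 g w * gauge w u * colour1 g (\<lambda>u'. gauge v u' * k (spins v u')) u"
proof (cases g)
  case (Cup i b)
  then have "i \<le> length w" using assms by (auto split: if_splits)
  then obtain p q where w: "w = p @ q" "length p = i" by (rule split0)
  obtain p' q' where u: "u = p' @ q'" "length p' = i" by (rule split0[of i u]) (use assms w in auto)
  have l: "length p = length p'" "length q = length q'" using w u assms by auto
  have v: "v = p @ b # (\<not> b) # q" using assms(1) w Cup by simp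
  show ?thesis using l w(2) unfolding v Cup w(1) u(1)
    by (cases b) (simp_all add: cup_at colour1_Cup algebra_simps del: colour1.simps)
next
  case (Cap i)
  then have "i + 1 < length w" using assms by (auto split: if_splits)
  then obtain p x y q where w: "w = p @ x # y # q" "length p = i" by (rule split2)
  obtain p' x' y' q' where u: "u = p' @ x' # y' # q'" "length p' = i" by (rule split2[of i u]) (use assms w in auto)
  have l: "length p = length p'" "length q = length q'" using w u assms by auto
  have v: "v = p @ q" "y = (\<not> x)" using assms(1) w Cap by (auto simp: nth_append split: if_splits)
  show ?thesis using l w(2) unfolding v Cap w(1) u(1)
    by (cases x; cases x'; cases y'; simp add: cap_at colour1_Cap algebra_simps nth_append del: colour1.simps)
next
  case (Cross i s)
  then have "i + 1 < length w" using assms by (auto split: if_splits)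
  then obtain p x y q where w: "w = p @ x # y # q" "length p = i" by (rule split2)
  obtain p' x' y' q' where u: "u = p' @ x' # y' # q'" "length p' = i" by (rule split2[of i u]) (use assms w in auto)
  have l: "length p = length p'" "length q = length q'" using w u assms by auto
  have v: "v = p @ y # x # q" using assms(1) w Cross by (auto simp: nth_append split: if_splits)
  show ?thesis using l w(2) unfolding v Cross w(1) u(1)
    by (cases x; cases y; cases x'; cases y'; simp add: cap_at cup_at colour1_Cross algebra_simps nth_append del: colour1.simps)
qed

fun sign_run :: "diagram \<Rightarrow> bool list \<Rightarrow> real" where
  "sign_run [] w = 1"
| "sign_run (g # D) w = sign1 g w * sign_run D (the (act g w))"

lemma abs_sign_run[simp]: "\<bar>sign_run D w\<bar> = 1"
proof (induction D arbitrary: w)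
  case (Cons g D)
  then show ?case by (cases g) (auto simp: abs_mult)
qed simp

lemma bracket_gauge:
  assumes "run D w = Some v" "length u = length w"
  shows "bracket (- 1) (- 1) D k (spins w u) = sign_run D w * gauge w u * colour D (\<lambda>u'. gauge v u' * k (spins v u')) u"
  using assms
proof (induction D arbitrary: w u)
  case (Cons g D)
  then obtain x where x: "act g w = Some x" "run D x = Some v" by (auto simp: Option.bind_eq_Some_conv)
  have "bracket (- 1) (- 1) (g # D) k (spins w u) = sign1 g w * gauge w u * colour1 g (\<lambda>u'. gauge x u' * bracket (- 1) (- 1) D k (spins x u')) u"
    using bracket1_gauge[OF x(1) Cons.prems(2)] by simp
  also have "colour1 g (\<lambda>u'. gauge x u' * bracket (- 1) (- 1) D k (spins x u')) u =
      colour1 g (\<lambda>u'. sign_run D x * colour D (\<lambda>u'. gauge v u' * k (spins v u')) u') u"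
    by (rule colour1_cong[OF x(1) Cons.prems(2)]) (simp add: Cons.IH[OF x(2)] algebra_simps)
  also have "\<dots> = sign_run D x * colour1 g (colour D (\<lambda>u'. gauge v u' * k (spins v u'))) u"
    using colour_scale[of "[g]"] by simp
  finally show ?case using x by simp
qed simp

definition xors :: "bool list \<Rightarrow> bool list \<Rightarrow> bool list" where "xors u v = map2 (\<noteq>) u v"

lemma xors_simps[simp]: "xors [] [] = []" "xors (x # w) (y # u) = (x \<noteq> y) # xors w u"
  "length w = length u \<Longrightarrow> xors (w @ w') (u @ u') = xors w u @ xors w' u'" "length (xors w u) = min (length w) (length u)"
  by (simp_all add: xors_def)

text \<open>
  The colourings extending a given boundary colouring \<open>\<beta>\<close> and state \<open>u\<close> form a coset over the field with
  two elements, so their number is zero or does not depend on \<open>\<beta>\<close> and \<open>u\<close>.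
\<close>

definition affine :: "nat \<Rightarrow> nat \<Rightarrow> (bool list \<Rightarrow> bool list \<Rightarrow> real) \<Rightarrow> bool" where
  "affine m n k \<longleftrightarrow> (\<forall>\<beta> u. k \<beta> u \<ge> 0) \<and>
    (\<forall>\<beta> \<gamma> u v. length \<beta> = m \<longrightarrow> length \<gamma> = m \<longrightarrow> length u = n \<longrightarrow> length v = n \<longrightarrow> k \<gamma> v \<noteq> 0 \<longrightarrow> k (xors \<beta> \<gamma>) (xors u v) = k \<beta> u) \<and>
    (\<forall>\<beta> u. length \<beta> = m \<longrightarrow> length u = n \<longrightarrow> k (map Not \<beta>) (map Not u) = k \<beta> u)"

lemma affine_nonneg: "affine m n k \<Longrightarrow> k \<beta> u \<ge> 0" by (simp add: affine_def)

lemma affine_xors: "affine m n k \<Longrightarrow> length \<beta> = m \<Longrightarrow> length \<gamma> = m \<Longrightarrow> length u = n \<Longrightarrow> length v = n \<Longrightarrow>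
    k \<gamma> v \<noteq> 0 \<Longrightarrow> k (xors \<beta> \<gamma>) (xors u v) = k \<beta> u"
  by (simp add: affine_def)

lemma affine_Not: "affine m n k \<Longrightarrow> length \<beta> = m \<Longrightarrow> length u = n \<Longrightarrow> k (map Not \<beta>) (map Not u) = k \<beta> u"
  by (simp add: affine_def)

text \<open>Summing over the colour at a minimum, requiring equal colours at a maximum and permuting
  at a crossing are linear operations over the field with two elements, so they respect
  cosets.\<close>

lemma affine_colour1:
  assumes "act g w = Some x" "affine m (length x) k"
  shows "affine m (length w) (\<lambda>\<beta>. colour1 g (k \<beta>))"
proof -
  have pos: "k \<beta> u \<ge> 0" for \<beta> u using assms by (auto simp: affine_def)
  have xor: "k (xors \<beta> \<gamma>) (xors u v) = k \<beta> u" if "length \<beta> = m" "length \<gamma> = m" "length u = length x" "length v = length x" "k \<gamma> v \<noteq> 0" for \<beta> \<gamma> u v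
    using assms that by (auto simp: affine_def)
  have neg: "k (map Not \<beta>) (map Not u) = k \<beta> u" if "length \<beta> = m" "length u = length x" for \<beta> u
    using assms that by (auto simp: affine_def)
  show ?thesis
  proof (cases g)
    case (Cup i b)
    then have le: "i \<le> length w" and lx: "length x = length w + 2" using assms by (auto split: if_splits)
    have "colour1 (Cup i b) (k (xors \<beta> \<gamma>)) (xors u v) = colour1 (Cup i b) (k \<beta>) u"
      if h: "length \<beta> = m" "length \<gamma> = m" "length u = length w" "length v = length w" "colour1 (Cup i b) (k \<gamma>) v \<noteq> 0" for \<beta> \<gamma> u v
    proof -
      obtain p q where u: "u = p @ q" "length p = i" by (rule split0[of i u]) (use le h in auto)
      obtain p' q' where v: "v = p' @ q'" "length p' = i" by (rule split0[of i v]) (use le h in auto)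
      have l: "length p = length p'" "length q = length q'" using u v h by auto
      have "k \<gamma> (p' @ False # False # q') \<noteq> 0 \<or> k \<gamma> (p' @ True # True # q') \<noteq> 0"
        using h(5) v by (auto simp: colour1_Cup simp del: colour1.simps)
      then obtain c where c: "k \<gamma> (p' @ c # c # q') \<noteq> 0" by blast
      \<comment> \<open>Adding the colour \<open>c\<close> permutes the two summands of the
        minimum.\<close>
      have "k (xors \<beta> \<gamma>) (xors p p' @ (d \<noteq> c) # (d \<noteq> c) # xors q q') = k \<beta> (p @ d # d # q)" for d
        using xor[of \<beta> \<gamma> "p @ d # d # q" "p' @ c # c # q'"] h c l u v lx by simp
      from this[of True] this[of False] show ?thesis
        using l u v by (cases c) (simp_all add: colour1_Cup del: colour1.simps)
    qed
    moreover have "colour1 (Cup i b) (k (map Not \<beta>)) (map Not u) = colour1 (Cup i b) (k \<beta>) u" if h: "length \<beta> = m" "length u = length w" for \<beta> u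
    proof -
      obtain p q where u: "u = p @ q" "length p = i" by (rule split0[of i u]) (use le h in auto)
      show ?thesis using neg[of \<beta> "p @ True # True # q"] neg[of \<beta> "p @ False # False # q"] u h lx
        by (simp add: colour1_Cup del: colour1.simps)
    qed
    ultimately show ?thesis unfolding affine_def Cup using pos by auto
  next
    case (Cap i)
    then have le: "i + 1 < length w" and lx: "length x + 2 = length w" using assms by (auto split: if_splits)
    have "colour1 (Cap i) (k (xors \<beta> \<gamma>)) (xors u v) = colour1 (Cap i) (k \<beta>) u"
      if h: "length \<beta> = m" "length \<gamma> = m" "length u = length w" "length v = length w" "colour1 (Cap i) (k \<gamma>) v \<noteq> 0" for \<beta> \<gamma> u v
    proof -
      obtain p r s q where u: "u = p @ r # s # q" "length p = i" by (rule split2[of i u]) (use le h in auto)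
      obtain p' r' s' q' where v: "v = p' @ r' # s' # q'" "length p' = i" by (rule split2[of i v]) (use le h in auto)
      have l: "length p = length p'" "length q = length q'" using u v h by auto
      have c: "k \<gamma> (p' @ q') \<noteq> 0" "r' = s'" using h(5) v by (auto simp: colour1_Cap simp del: colour1.simps split: if_splits)
      show ?thesis
        using l u v c xor[of \<beta> \<gamma> "p @ q" "p' @ q'"] h lx by (auto simp: colour1_Cap simp del: colour1.simps)
    qed
    moreover have "colour1 (Cap i) (k (map Not \<beta>)) (map Not u) = colour1 (Cap i) (k \<beta>) u" if h: "length \<beta> = m" "length u = length w" for \<beta> u
    proof -
      obtain p r s q where u: "u = p @ r # s # q" "length p = i" by (rule split2[of i u]) (use le h in auto)
      show ?thesis using neg[of \<beta> "p @ q"] u h lx by (simp add: colour1_Cap del: colour1.simps)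
    qed
    ultimately show ?thesis unfolding affine_def Cap using pos by auto
  next
    case (Cross i c)
    then have le: "i + 1 < length w" and lx: "length x = length w" using assms by (auto split: if_splits)
    have "colour1 (Cross i c) (k (xors \<beta> \<gamma>)) (xors u v) = colour1 (Cross i c) (k \<beta>) u"
      if h: "length \<beta> = m" "length \<gamma> = m" "length u = length w" "length v = length w" "colour1 (Cross i c) (k \<gamma>) v \<noteq> 0" for \<beta> \<gamma> u v
    proof -
      obtain p r s q where u: "u = p @ r # s # q" "length p = i" by (rule split2[of i u]) (use le h in auto)
      obtain p' r' s' q' where v: "v = p' @ r' # s' # q'" "length p' = i" by (rule split2[of i v]) (use le h in auto)
      have l: "length p = length p'" "length q = length q'" using u v h by auto
      have c: "k \<gamma> (p' @ s' # r' # q') \<noteq> 0" using h(5) v by (auto simp: colour1_Cross simp del: colour1.simps split: if_splits)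
      show ?thesis
        using l u v c xor[of \<beta> \<gamma> "p @ s # r # q" "p' @ s' # r' # q'"] h lx by (auto simp: colour1_Cross simp del: colour1.simps)
    qed
    moreover have "colour1 (Cross i c) (k (map Not \<beta>)) (map Not u) = colour1 (Cross i c) (k \<beta>) u" if h: "length \<beta> = m" "length u = length w" for \<beta> u
    proof -
      obtain p r s q where u: "u = p @ r # s # q" "length p = i" by (rule split2[of i u]) (use le h in auto)
      show ?thesis using neg[of \<beta> "p @ s # r # q"] u h lx by (simp add: colour1_Cross del: colour1.simps)
    qed
    ultimately show ?thesis unfolding affine_def Cross using pos by auto
  qed
qed

lemma affine_colour: "run D w = Some v \<Longrightarrow> affine m (length v) k \<Longrightarrow> affine m (length w) (\<lambda>\<beta>. colour D (k \<beta>))"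
proof (induction D arbitrary: w)
  case (Cons g D)
  then obtain x where x: "act g w = Some x" "run D x = Some v" by (auto simp: Option.bind_eq_Some_conv)
  show ?case using affine_colour1[OF x(1) Cons.IH[OF x(2) Cons.prems(2)]] by simp
qed simp

section \<open>Colourings outside the disk of a \<Delta>-move\<close>

text \<open>This cuts out the disk: the first three entries of \<open>\<beta>\<close> prescribe the
  colours at its lower endpoints, the last three those at its upper endpoints. Below a word
  \<open>A\<close> it counts the colourings of the outside with boundary values
  \<open>\<beta>\<close>.\<close>

definition block :: "nat \<Rightarrow> (bool list \<Rightarrow> real) \<Rightarrow> bool list \<Rightarrow> bool list \<Rightarrow> real" where
  "block i K \<beta> u = (if take 3 (drop i u) = take 3 \<beta> then K (take i u @ drop 3 \<beta> @ drop (i + 3) u) else 0)"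

lemma block_at: "length p = i \<Longrightarrow> block i K [b1, b2, b3, b4, b5, b6] (p @ x # y # z # q) =
    (if x = b1 \<and> y = b2 \<and> z = b3 then K (p @ b4 # b5 # b6 # q) else 0)"
  by (auto simp: block_def)

lemma length_6: "length \<beta> = 6 \<Longrightarrow> \<exists>b1 b2 b3 b4 b5 b6. \<beta> = [b1, b2, b3, b4, b5, b6]"
  by (simp add: numeral_eq_Suc length_Suc_conv) blast

lemma affine_block:
  assumes "affine 6 n (\<lambda>_. K)" "i + 2 < n"
  shows "affine 6 n (block i K)"
proof -
  have pos: "K u \<ge> 0" for u using affine_nonneg[OF assms(1)] .
  have xor: "K (xors u v) = K u" if "length u = n" "length v = n" "K v \<noteq> 0" for u v
    using affine_xors[OF assms(1), of "replicate 6 False" "replicate 6 False" u v] that by simp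
  have neg: "K (map Not u) = K u" if "length u = n" for u
    using affine_Not[OF assms(1), of "replicate 6 False" u] that by simp
  have "block i K (xors \<beta> \<gamma>) (xors u v) = block i K \<beta> u"
    if h: "length \<beta> = 6" "length \<gamma> = 6" "length u = n" "length v = n" "block i K \<gamma> v \<noteq> 0" for \<beta> \<gamma> u v
  proof -
    obtain b1 b2 b3 b4 b5 b6 where b: "\<beta> = [b1, b2, b3, b4, b5, b6]" using length_6[OF h(1)] by blast
    obtain c1 c2 c3 c4 c5 c6 where c: "\<gamma> = [c1, c2, c3, c4, c5, c6]" using length_6[OF h(2)] by blast
    obtain p x y z q where u: "u = p @ x # y # z # q" "length p = i" by (rule split3[of i u]) (use assms(2) h in auto)
    obtain p' x' y' z' q' where v: "v = p' @ x' # y' # z' # q'" "length p' = i" by (rule split3[of i v]) (use assms(2) h in auto)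
    have l: "length p = length p'" "length q = length q'" using u v h by auto
    have e: "x' = c1" "y' = c2" "z' = c3" "K (p' @ c4 # c5 # c6 # q') \<noteq> 0"
      using h(5) v(2) unfolding v(1) c by (simp_all add: block_at split: if_splits)
    have "K (xors p p' @ (b4 \<noteq> c4) # (b5 \<noteq> c5) # (b6 \<noteq> c6) # xors q q') = K (p @ b4 # b5 # b6 # q)"
      using xor[of "p @ b4 # b5 # b6 # q" "p' @ c4 # c5 # c6 # q'"] l u h v e(4) by simp
    moreover have "((x \<noteq> x') = (b1 \<noteq> c1)) = (x = b1)" "((y \<noteq> y') = (b2 \<noteq> c2)) = (y = b2)"
      "((z \<noteq> z') = (b3 \<noteq> c3)) = (z = b3)" using e by blast+
    ultimately show ?thesis
      using l u(2) unfolding u(1) v(1) b c by (simp add: block_at del: not_iff)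
  qed
  moreover have "block i K (map Not \<beta>) (map Not u) = block i K \<beta> u" if h: "length \<beta> = 6" "length u = n" for \<beta> u
  proof -
    obtain b1 b2 b3 b4 b5 b6 where b: "\<beta> = [b1, b2, b3, b4, b5, b6]" using length_6[OF h(1)] by blast
    obtain p x y z q where u: "u = p @ x # y # z # q" "length p = i" by (rule split3[of i u]) (use assms(2) h in auto)
    show ?thesis using neg[of "p @ b4 # b5 # b6 # q"] u h unfolding b by (auto simp: block_at)
  qed
  moreover have "block i K \<beta> u \<ge> 0" for \<beta> u using pos by (simp add: block_def)
  ultimately show ?thesis unfolding affine_def by blast
qed

lemma colour_sum: "finite S \<Longrightarrow> colour D (\<lambda>u. \<Sum>x\<in>S. g x u) u = (\<Sum>x\<in>S. colour D (g x) u)"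
proof (induction S rule: finite_induct)
  case empty
  then show ?case using colour_scale[of D 0 "\<lambda>_. 0" u] by simp
qed (simp add: colour_add)

text \<open>There are 16 terms. The two choices of \<open>x\<close>, \<open>y\<close>,
  \<open>z\<close> for which all three spins agree give the same boundary in both parts and cancel.
  For every choice of orientations, six of the other twelve terms have the sign plus and six the
  sign minus; since the values of \<open>f\<close> lie between 0 and 1, the sum is at most 6 in
  modulus.\<close>

lemma delta_sum_bound:
  fixes f :: "bool list \<Rightarrow> real"
  assumes f: "\<And>u. 0 \<le> f u" "\<And>b1 b2 b3 b4 b5 b6. f [b1, b2, b3, b4, b5, b6] \<le> 1"
  shows "\<bar>\<Sum>x\<in>UNIV. \<Sum>y\<in>UNIV. \<Sum>z\<in>UNIV.
   gauge [o1, o2, o3] [x, y, z] * gauge [o3, o2, o1] [o3 = (o2 = y), o2 = (o1 = x), o1 = (o3 = z)] * f [x, y, z, o3 = (o2 = y), o2 = (o1 = x), o1 = (o3 = z)]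
      + (- (gauge [o1, o2, o3] [x, y, z] * gauge [o3, o2, o1] [o3 = (o1 = x), o2 = (o3 = z), o1 = (o2 = y)])) * f [x, y, z, o3 = (o1 = x), o2 = (o3 = z), o1 = (o2 = y)]\<bar> \<le> 6"
proof -
  note [simp] = UNIV_bool
  show ?thesis
    by (cases o1; cases o2; cases o3; simp) (smt (verit) f)+
qed

text \<open>The value 2 says that there are only two colourings, as for a knot. The two constant
  boundary colourings extend to the outside equally often, and all these extensions are among the
  two, so each extends at most once. By the coset property no boundary colouring extends more often
  than a constant one, so all counts are at most 1 and \<open>delta_sum_bound\<close>
  applies.\<close>

lemma delta_colour_bound:
  assumes A: "run A [] = Some w" and w: "w = p @ o1 # o2 # o3 # q" "length p = i"
    and B: "run B (p @ o3 # o2 # o1 # q) = Some []"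
    and knot: "\<bar>bracket (- 1) (- 1) (A @ [Cross i s1, Cross (i + 1) s2, Cross i s3] @ B) (\<lambda>_. 1) []\<bar> = (2::real)"
  defines "K \<equiv> bracket (- 1) (- 1) B (\<lambda>_. 1 :: real)"
  shows "\<bar>bracket (- 1) (- 1) A (\<lambda>u. cap (- 1) i (cup (- 1) i K) u - cap (- 1) (i + 1) (cup (- 1) (i + 1) K) u) []\<bar> \<le> 6"
proof -
  let ?O = "[False, False, False, False, False, False]"
    and ?I = "[True, True, True, True, True, True]"
  define w' where "w' = p @ o3 # o2 # o1 # q"
  define n where "n = length w"
  define cK where "cK = colour B (\<lambda>_. 1)"
  define f where "f \<beta> = colour A (block i cK \<beta>) []" for \<beta>
  define sB where "sB = sign_run B w'"
  have n: "n = length w'" "i + 2 < n" using w by (auto simp: n_def w'_def)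
  have one: "affine 6 0 (\<lambda>_ _. 1)" by (simp add: affine_def)
  have "affine 6 n (\<lambda>_. cK)"
    unfolding cK_def n(1) by (rule affine_colour[of B w' "[]"]) (use B one in \<open>simp_all add: w'_def\<close>)
  then have "affine 6 n (block i cK)" using n(2) by (rule affine_block)
  then have aff: "affine 6 0 (\<lambda>\<beta>. colour A (block i cK \<beta>))"
    using affine_colour[OF A, of 6 "block i cK"] by (simp add: n_def)
  have f_pos: "f \<beta> \<ge> 0" for \<beta> using affine_nonneg[OF aff] unfolding f_def .
  have f_le: "f \<beta> \<le> f ?O" if h: "length \<beta> = 6" for \<beta>
  proof (cases "f \<beta> = 0")
    case False
    obtain b1 b2 b3 b4 b5 b6 where b: "\<beta> = [b1, b2, b3, b4, b5, b6]" using length_6[OF h] by blast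
    have "f (xors ?O \<beta>) = f ?O"
      using affine_xors[OF aff, of "?O" \<beta> "[]" "[]"] False h unfolding f_def by simp
    then show ?thesis by (simp add: b)
  qed (use f_pos in simp)
  have f_neg: "f ?I = f ?O"
  proof -
    have "f (map Not ?O) = f ?O"
      using affine_Not[OF aff, of "?O" "[]"] unfolding f_def by simp
    then show ?thesis by simp
  qed
  let ?l = "[Cross i s1, Cross (i + 1) s2, Cross i s3]"
  have rl: "run ?l w = Some w'"
    using w(2) unfolding w(1) w'_def by (simp add: act_Cross_at del: act.simps)
  have rD: "run (A @ ?l @ B) [] = Some []" unfolding run_append_Some using A rl B unfolding w'_def by blast
  have total: "colour (A @ ?l @ B) (\<lambda>_. 1) [] = 2"
  proof -
    have "bracket (- 1) (- 1) (A @ ?l @ B) (\<lambda>_. 1) [] = sign_run (A @ ?l @ B) [] * colour (A @ ?l @ B) (\<lambda>u'. gauge [] u') []"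
      using bracket_gauge[OF rD, of "[]" "\<lambda>_. 1"] by simp
    also have "colour (A @ ?l @ B) (\<lambda>u'. gauge [] u') [] = colour (A @ ?l @ B) (\<lambda>_. 1) []"
      by (rule colour_cong[OF rD]) simp_all
    finally have "\<bar>colour (A @ ?l @ B) (\<lambda>_. 1) []\<bar> = 2" using knot by (simp add: abs_mult)
    moreover have "affine 6 0 (\<lambda>_. colour (A @ ?l @ B) (\<lambda>_. 1))" using affine_colour[OF rD, of 6 "\<lambda>_ _. 1"] one by simp
    then have "colour (A @ ?l @ B) (\<lambda>_. 1) [] \<ge> 0" by (rule affine_nonneg)
    ultimately show ?thesis by simp
  qed
  \<comment> \<open>The three crossings reverse the order of the strands, whence the boundary values
    \<open>[x, y, z, z, y, x]\<close>.\<close>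
  have "colour (A @ ?l @ B) (\<lambda>_. 1) [] = colour A (\<lambda>u. \<Sum>x\<in>UNIV. \<Sum>y\<in>UNIV. \<Sum>z\<in>UNIV. block i cK [x, y, z, z, y, x] u) []"
    unfolding colour_simps(3)
  proof (rule colour_cong[OF A])
    fix u :: "bool list" assume "length u = length w"
    then obtain p' x y z q' where u: "u = p' @ x # y # z # q'" "length p' = i"
      by (metis split3 n(2) n_def)
    show "colour ?l (colour B (\<lambda>_. 1)) u = (\<Sum>x\<in>UNIV. \<Sum>y\<in>UNIV. \<Sum>z\<in>UNIV. block i cK [x, y, z, z, y, x] u)"
      using u(2) colour1_Cross[of "p' @ [y]" "i + 1"] colour1_Cross[of "p' @ [_]" "Suc i" s2 _ _ _ q'] unfolding u(1) cK_def[symmetric]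
      by (cases x; cases y; cases z; simp add: colour1_Cross block_at UNIV_bool nth_append del: colour1.simps)
  qed simp
  also have "\<dots> = (\<Sum>x\<in>UNIV. \<Sum>y\<in>UNIV. \<Sum>z\<in>UNIV. f [x, y, z, z, y, x])"
    by (simp add: colour_sum f_def)
  finally have "2 = (\<Sum>x\<in>UNIV. \<Sum>y\<in>UNIV. \<Sum>z\<in>UNIV. f [x, y, z, z, y, x])" using total by simp
  also have "\<dots> \<ge> f ?O + f ?I"
    using f_pos by (simp add: UNIV_bool add_nonneg_nonneg)
  finally have "f ?O \<le> 1" using f_neg by simp
  then have f_le1: "f [b1, b2, b3, b4, b5, b6] \<le> 1" for b1 b2 b3 b4 b5 b6
    using f_le[of "[b1, b2, b3, b4, b5, b6]"] by simp
  define c1 where "c1 x y z = gauge [o1, o2, o3] [x, y, z] * gauge [o3, o2, o1] [o3 = (o2 = y), o2 = (o1 = x), o1 = (o3 = z)]" for x y z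
  define c2 where "c2 x y z = gauge [o1, o2, o3] [x, y, z] * gauge [o3, o2, o1] [o3 = (o1 = x), o2 = (o3 = z), o1 = (o2 = y)]" for x y z
  have K: "K (spins w' u) = sB * gauge w' u * cK u" if "length u = n" for u
  proof -
    have "K (spins w' u) = sB * gauge w' u * colour B (\<lambda>u'. gauge [] u') u"
      using bracket_gauge[of B w' "[]" u "\<lambda>_. 1"] B that n unfolding K_def sB_def w'_def by simp
    also have "colour B (\<lambda>u'. gauge [] u') u = cK u"
      unfolding cK_def by (rule colour_cong[of B w' "[]"]) (use B that n in \<open>simp_all add: w'_def\<close>)
    finally show ?thesis .
  qed
  let ?\<Phi> = "\<lambda>u. cap (- 1) i (cup (- 1) i K) u - cap (- 1) (i + 1) (cup (- 1) (i + 1) K) u"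
  have "bracket (- 1) (- 1) A ?\<Phi> [] = sign_run A [] * colour A (\<lambda>u. gauge w u * ?\<Phi> (spins w u)) []"
    using bracket_gauge[OF A, of "[]" ?\<Phi>] by simp
  also have "colour A (\<lambda>u. gauge w u * ?\<Phi> (spins w u)) [] = colour A (\<lambda>u. sB * (\<Sum>x\<in>UNIV. \<Sum>y\<in>UNIV. \<Sum>z\<in>UNIV.
      c1 x y z * block i cK [x, y, z, o3 = (o2 = y), o2 = (o1 = x), o1 = (o3 = z)] u
      + (- c2 x y z) * block i cK [x, y, z, o3 = (o1 = x), o2 = (o3 = z), o1 = (o2 = y)] u)) []"
  proof (rule colour_cong[OF A])
    fix u :: "bool list" assume lu: "length u = length w"
    then obtain p' x y z q' where u: "u = p' @ x # y # z # q'" "length p' = i"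
      by (metis split3 n(2) n_def)
    have l: "length p = length p'" "length q = length q'" using u w lu by auto
    let ?u1 = "p' @ (o3 = (o2 = y)) # (o2 = (o1 = x)) # (o1 = (o3 = z)) # q'"
    let ?u2 = "p' @ (o3 = (o1 = x)) # (o2 = (o3 = z)) # (o1 = (o2 = y)) # q'"
    \<comment> \<open>\<open>K\<close> has to be read relative to \<open>w'\<close>, the
      orientations above the move: \<open>o3 = (o2 = y)\<close> is the colour whose spin on a strand
      oriented by \<open>o3\<close> is \<open>o2 = y\<close>.\<close>
    have r1: "spins p p' @ (o2 = y) # (o1 = x) # (o3 = z) # spins q q' = spins w' ?u1"
      using l by (auto simp: w'_def)
    have r2: "spins p p' @ (o1 = x) # (o3 = z) # (o2 = y) # spins q q' = spins w' ?u2"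
      using l by (auto simp: w'_def)
    have "?\<Phi> (spins w u) = K (spins p p' @ (o2 = y) # (o1 = x) # (o3 = z) # spins q q') - K (spins p p' @ (o1 = x) # (o3 = z) # (o2 = y) # spins q q')"
    proof -
      \<comment> \<open>At \<open>a = b = - 1\<close> a Temperley-Lieb generator is a transposition
        minus the identity, and the identities cancel.\<close>
      have "?\<Phi> (r @ X # Y # Z # t) = K (r @ Y # X # Z # t) - K (r @ X # Z # Y # t)" if "length r = i" for r X Y Z t
        using that by (cases X; cases Y; cases Z; simp add: cap_at cap_at3[simplified] cup_at cup_at1)
      from this[of "spins p p'"] show ?thesis using l w(2) unfolding w(1) u(1) by simp
    qed
    also have "\<dots> = sB * (gauge w' ?u1 * cK ?u1 - gauge w' ?u2 * cK ?u2)"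
      unfolding r1 r2 using K[of ?u1] K[of ?u2] lu u by (simp add: n_def algebra_simps)
    finally have \<Phi>: "?\<Phi> (spins w u) = sB * (gauge w' ?u1 * cK ?u1 - gauge w' ?u2 * cK ?u2)" .
    have "gauge w u * ?\<Phi> (spins w u) = sB * (gauge w u * gauge w' ?u1 * cK ?u1 - gauge w u * gauge w' ?u2 * cK ?u2)"
      unfolding \<Phi> by (simp only: right_diff_distrib mult_ac)
    also have "gauge w u * gauge w' ?u1 = c1 x y z"
      using l unfolding w(1) w'_def u(1) c1_def by (simp add: mult_ac)
    also have "gauge w u * gauge w' ?u2 = c2 x y z"
      using l unfolding w(1) w'_def u(1) c2_def by (simp add: mult_ac)
    finally show "gauge w u * ?\<Phi> (spins w u) = sB * (\<Sum>x\<in>UNIV. \<Sum>y\<in>UNIV. \<Sum>z\<in>UNIV.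
      c1 x y z * block i cK [x, y, z, o3 = (o2 = y), o2 = (o1 = x), o1 = (o3 = z)] u
      + (- c2 x y z) * block i cK [x, y, z, o3 = (o1 = x), o2 = (o3 = z), o1 = (o2 = y)] u)"
      using u(2) unfolding u(1) by (cases x; cases y; cases z; simp add: block_at UNIV_bool)
  qed simp
  also have "\<dots> = sB * (\<Sum>x\<in>UNIV. \<Sum>y\<in>UNIV. \<Sum>z\<in>UNIV.
      c1 x y z * f [x, y, z, o3 = (o2 = y), o2 = (o1 = x), o1 = (o3 = z)]
      + (- c2 x y z) * f [x, y, z, o3 = (o1 = x), o2 = (o3 = z), o1 = (o2 = y)])"
    unfolding colour_scale by (simp add: colour_sum colour_add colour_scale f_def del: mult_minus_left)
  finally have "\<bar>bracket (- 1) (- 1) A ?\<Phi> []\<bar> = \<bar>\<Sum>x\<in>UNIV. \<Sum>y\<in>UNIV. \<Sum>z\<in>UNIV.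
      c1 x y z * f [x, y, z, o3 = (o2 = y), o2 = (o1 = x), o1 = (o3 = z)]
      + (- c2 x y z) * f [x, y, z, o3 = (o1 = x), o2 = (o3 = z), o1 = (o2 = y)]\<bar>" (is "_ = \<bar>?S\<bar>")
    by (simp add: abs_mult sB_def)
  moreover have "\<bar>?S\<bar> \<le> 6"
    unfolding c1_def c2_def by (rule delta_sum_bound) (use f_pos f_le1 in auto)
  ultimately show ?thesis by simp
qed

section \<open>The lower bound\<close>

unbundle fps_syntax

text \<open>
  Expansion at \<open>a = - exp h\<close>.  The \<open>\<Delta>\<close>-move changes \<open>V\<close> by a multiple of \<open>(a\<^sup>2 - b\<^sup>2)\<^sup>2 = 16 h\<^sup>2 + \<dots>\<close>, so the
  cofactor is needed at \<open>h = 0\<close> only.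
\<close>

definition qa :: "real fps" where "qa = - fps_exp 1"
definition qb :: "real fps" where "qb = - fps_exp (- 1)"

lemma qa_qb: "qa * qb = 1"
  by (simp add: qa_def qb_def fps_exp_add_mult[symmetric])

lemma qab_0: "qa $ 0 = - 1" "qb $ 0 = - 1"
  by (simp_all add: qa_def qb_def)

lemma bracket_nth_0: "bracket a b D k u $ 0 = bracket (a $ 0) (b $ 0) D (\<lambda>u. k u $ 0) u"
proof (induction D arbitrary: u)
  case (Cons g D)
  then have "(\<lambda>u. bracket a b D k u $ 0) = bracket (a $ 0) (b $ 0) D (\<lambda>u. k u $ 0)" by auto
  then show ?case
    by (cases g) (auto simp: cup_def cap_def fps_nth_power_0 fps_mult_nth_0 fun_eq_iff)
qed simp

lemma framing_nth_0: "framing a b D w $ 0 = framing (a $ 0) (b $ 0) D w"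
proof (induction D arbitrary: w)
  case (Cons g D)
  then show ?case by (cases g) (auto simp: fps_nth_power_0 fps_mult_nth_0)
qed simp

lemma framing_minus_one: "framing (- 1) (- 1) D w = (1 :: real)"
proof (induction D arbitrary: w)
  case (Cons g D)
  then show ?case by (cases g) auto
qed simp

definition V :: "diagram \<Rightarrow> real fps" where "V D = jones qa qb D"

lemma isotopic_V: "isotopic D E \<Longrightarrow> V D = V E"
  unfolding V_def by (rule isotopic_jones[OF qa_qb])

lemma V_nth_0: "V D $ 0 = bracket (- 1) (- 1) D (\<lambda>_. 1) []"
  by (simp add: V_def jones_def fps_mult_nth_0 framing_nth_0 bracket_nth_0 qab_0 framing_minus_one)

lemma fps_power2: "qa\<^sup>2 = fps_exp 2" "qb\<^sup>2 = fps_exp (- 2)" "qa ^ 4 = fps_exp 4" "qb ^ 4 = fps_exp (- 4)"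
  by (simp_all add: qa_def qb_def fps_exp_power_mult)

text \<open>The difference of the squares is 2 sinh (2 h), which begins with 4 h, so its square
  begins with 16 h^2.\<close>

lemma delta_factor:
  fixes d :: "real fps" assumes "d $ 0 = - 1"
  shows "(- d * (qa\<^sup>2 - qb\<^sup>2)\<^sup>2 * x) $ 0 = 0" "(- d * (qa\<^sup>2 - qb\<^sup>2)\<^sup>2 * x) $ 2 = 16 * x $ 0"
proof -
  define y where "y = qa\<^sup>2 - qb\<^sup>2"
  have y: "y $ 0 = 0" "y $ 1 = 4" by (simp_all add: y_def fps_power2)
  have y2: "y\<^sup>2 $ 0 = 0" "y\<^sup>2 $ 1 = 0" "y\<^sup>2 $ 2 = 16"
    using y by (simp_all add: power2_eq_square fps_mult_nth numeral_2_eq_2)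
  have dy: "(- d * y\<^sup>2) $ 0 = 0" "(- d * y\<^sup>2) $ 1 = 0" "(- d * y\<^sup>2) $ 2 = 16"
    using y2 assms by (simp_all add: fps_mult_nth numeral_2_eq_2)
  show "(- d * (qa\<^sup>2 - qb\<^sup>2)\<^sup>2 * x) $ 0 = 0" "(- d * (qa\<^sup>2 - qb\<^sup>2)\<^sup>2 * x) $ 2 = 16 * x $ 0"
  proof -
    define m where "m = - d * y\<^sup>2"
    have "(m * x) $ 0 = 0" "(m * x) $ 2 = 16 * x $ 0"
      using dy[folded m_def] by (simp_all add: fps_mult_nth numeral_2_eq_2)
    then show "(- d * (qa\<^sup>2 - qb\<^sup>2)\<^sup>2 * x) $ 0 = 0" "(- d * (qa\<^sup>2 - qb\<^sup>2)\<^sup>2 * x) $ 2 = 16 * x $ 0"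
      unfolding m_def y_def .
  qed
qed

text \<open>Both sides have the same framing, so the factor from \<open>delta_bracket\<close> can be
  pulled out of the whole state sum. Being of second order, it leaves the constant term unchanged
  and reduces the change in degree two to the constant term of the cofactor \<open>G\<close>; 96 is
  16 times the bound 6.\<close>

lemma delta_V_rule:
  assumes D: "is_diagram (A @ [Cross i s, Cross (i + 1) (\<not> s), Cross i s] @ B)"
  shows "V (A @ [Cross i s, Cross (i + 1) (\<not> s), Cross i s] @ B) $ 0 = V (A @ [Cross (i + 1) s, Cross i (\<not> s), Cross (i + 1) s] @ B) $ 0"
    "V (A @ [Cross i s, Cross (i + 1) (\<not> s), Cross i s] @ B) $ 0 = - 2 \<Longrightarrow>
      \<bar>V (A @ [Cross i s, Cross (i + 1) (\<not> s), Cross i s] @ B) $ 2 - V (A @ [Cross (i + 1) s, Cross i (\<not> s), Cross (i + 1) s] @ B) $ 2\<bar> \<le> 96"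
proof -
  let ?l = "[Cross i s, Cross (i + 1) (\<not> s), Cross i s]" and ?r = "[Cross (i + 1) s, Cross i (\<not> s), Cross (i + 1) s]"
  obtain w w' where A: "run A [] = Some w" and l: "run ?l w = Some w'" and B: "run B w' = Some []"
    using D unfolding is_diagram_def run_append_Some by blast
  have r: "run ?r w = Some w'" using l run_R3 by metis
  have le: "i + 2 < length w" using l by (auto split: if_splits bind_splits)
  obtain p o1 o2 o3 q where w: "w = p @ o1 # o2 # o3 # q" "length p = i" by (rule split3[OF le])
  have w': "w' = p @ o3 # o2 # o1 # q"
    using l w(2) unfolding w(1) by (simp add: act_Cross_at del: act.simps)
  have framing_same: "framing qa qb ?l w = framing qa qb ?r w"
    using w(2) unfolding w(1) by (auto simp add: framing1_Cross_at act_Cross_at mult_ac simp del: act.simps framing1.simps(1))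
  let ?d = "if s then qb else qa"
  define K where "K = bracket qa qb B (\<lambda>_. 1)"
  let ?b = "bracket qa qb"
    and ?f = "framing qa qb"
    and ?E = "(\<lambda>u. cap qa i (cup qb i K) u - cap qa (i + 1) (cup qb (i + 1) K) u)"
  have "?b A (?b ?l K) [] - ?b A (?b ?r K) []
      = ?b A (\<lambda>u. ?b ?l K u + - 1 * ?b ?r K u) []"
    unfolding bracket_add bracket_scale by simp
  also have "\<dots> = ?b A (\<lambda>u. (- ?d * (qa\<^sup>2 - qb\<^sup>2)\<^sup>2) * (cap qa i (cup qb i K) u - cap qa (i + 1) (cup qb (i + 1) K) u)) []"
  proof (rule bracket_cong[OF A])
    fix u :: "bool list" assume "length u = length w"
    then have "i + 2 < length u" using le by simp
    from delta_bracket[OF qa_qb this refl, of s K]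
    show "?b ?l K u + - 1 * ?b ?r K u = (- ?d * (qa\<^sup>2 - qb\<^sup>2)\<^sup>2) * (cap qa i (cup qb i K) u - cap qa (i + 1) (cup qb (i + 1) K) u)"
      by (simp only: mult_minus1 add_uminus_conv_diff)
  qed simp
  also have "\<dots> = - ?d * (qa\<^sup>2 - qb\<^sup>2)\<^sup>2 * ?b A ?E []"
    by (rule bracket_scale)
  finally have diff: "?b A (?b ?l K) [] - ?b A (?b ?r K) [] =
      - ?d * (qa\<^sup>2 - qb\<^sup>2)\<^sup>2 * ?b A ?E []" .
  define G where "G = ?f A [] * ?f ?l w * ?f B w' * ?b A ?E []"
  have "V (A @ ?l @ B) - V (A @ ?r @ B) = ?f A [] * ?f ?l w * ?f B w' *
      (?b A (?b ?l K) [] - ?b A (?b ?r K) [])"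
    unfolding V_def jones_split[OF A l] jones_split[OF A r] framing_same K_def by (simp only: right_diff_distrib)
  also have "\<dots> = - ?d * (qa\<^sup>2 - qb\<^sup>2)\<^sup>2 * G"
    unfolding diff G_def by (simp only: mult_ac)
  finally have VG: "V (A @ ?l @ B) - V (A @ ?r @ B) = - ?d * (qa\<^sup>2 - qb\<^sup>2)\<^sup>2 * G" .
  have d: "?d $ 0 = - 1" using qab_0 by simp
  show "V (A @ ?l @ B) $ 0 = V (A @ ?r @ B) $ 0"
    using arg_cong[OF VG, of "\<lambda>x. x $ 0"] unfolding fps_sub_nth delta_factor(1)[OF d] by (rule eq_iff_diff_eq_0[THEN iffD2])
  have "G $ 0 = bracket (- 1) (- 1) A (\<lambda>u. cap (- 1) i (cup (- 1) i (bracket (- 1) (- 1) B (\<lambda>_. 1))) u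
      - cap (- 1) (i + 1) (cup (- 1) (i + 1) (bracket (- 1) (- 1) B (\<lambda>_. 1))) u) []"
  proof -
    have K0: "(\<lambda>u. K u $ 0) = bracket (- 1) (- 1) B (\<lambda>_. 1)" by (simp add: K_def bracket_nth_0 qab_0 fun_eq_iff)
    have c: "cap qa j (cup qb j K) u $ 0 = cap (- 1) j (cup (- 1) j (\<lambda>u. K u $ 0)) u" for j u
      by (simp add: cap_def cup_def fps_nth_power_0 qab_0)
    show ?thesis
      unfolding G_def fps_mult_nth_0 framing_nth_0 bracket_nth_0 qab_0 framing_minus_one fps_sub_nth c K0 by simp
  qed
  moreover assume knot: "V (A @ ?l @ B) $ 0 = - 2"
  have "\<bar>bracket (- 1) (- 1) A (\<lambda>u. cap (- 1) i (cup (- 1) i (bracket (- 1) (- 1) B (\<lambda>_. 1 :: real))) u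
      - cap (- 1) (i + 1) (cup (- 1) (i + 1) (bracket (- 1) (- 1) B (\<lambda>_. 1))) u) []\<bar> \<le> 6"
    by (rule delta_colour_bound[OF A w]) (use B w' knot V_nth_0 in auto)
  ultimately have "\<bar>G $ 0\<bar> \<le> 6" by simp
  moreover have "V (A @ ?l @ B) $ 2 - V (A @ ?r @ B) $ 2 = 16 * G $ 0"
    using arg_cong[OF VG, of "\<lambda>x. x $ 2"] unfolding fps_sub_nth delta_factor(2)[OF d] .
  ultimately show "\<bar>V (A @ ?l @ B) $ 2 - V (A @ ?r @ B) $ 2\<bar> \<le> 96" by simp
qed

lemma delta_V:
  assumes "local_move delta_rule D E" "V D $ 0 = - 2"
  shows "V E $ 0 = - 2 \<and> \<bar>V D $ 2 - V E $ 2\<bar> \<le> 96"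
  using assms(1)
proof cases
  case (1 l r A B)
  from 1(3) show ?thesis
  proof
    assume "delta_rule l r"
    then obtain i s where l: "l = [Cross i s, Cross (i + 1) (\<not> s), Cross i s]" "r = [Cross (i + 1) s, Cross i (\<not> s), Cross (i + 1) s]"
      by cases auto
    show ?thesis
      using delta_V_rule[OF 1(4)[unfolded l]] assms(2) unfolding 1(1,2) l by simp
  next
    assume "delta_rule r l"
    then obtain i s where r: "r = [Cross i s, Cross (i + 1) (\<not> s), Cross i s]" "l = [Cross (i + 1) s, Cross i (\<not> s), Cross (i + 1) s]"
      by cases auto
    show ?thesis
      using delta_V_rule[OF 1(5)[unfolded r]] assms(2) unfolding 1(1,2) r by (simp add: abs_minus_commute)
  qed
qed

text \<open>The value -2 at h = 0 marks a knot. It is carried along because the bound for a single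
  move depends on it.\<close>

lemma delta_connected_V:
  assumes "delta_connected k D E" "V D $ 0 = - 2"
  shows "V E $ 0 = - 2 \<and> \<bar>V D $ 2 - V E $ 2\<bar> \<le> 96 * real k"
  using assms
proof (induction k arbitrary: D)
  case 0
  then show ?case using isotopic_V[of D E] by simp
next
  case (Suc k)
  then obtain X Y where 1: "isotopic D X" "local_move delta_rule X Y" "delta_connected k Y E"
    unfolding delta_connected_Suc by blast
  have X: "V X = V D" using isotopic_V[OF 1(1)] by simp
  have Y: "V Y $ 0 = - 2" "\<bar>V D $ 2 - V Y $ 2\<bar> \<le> 96" using delta_V[OF 1(2)] Suc.prems X by auto
  have "V E $ 0 = - 2" "\<bar>V Y $ 2 - V E $ 2\<bar> \<le> 96 * real k" using Suc.IH[OF 1(3) Y(1)] by auto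
  then show ?case using Y by (auto simp: algebra_simps abs_if split: if_splits)
qed

section \<open>Jones polynomials of pretzel links\<close>

text \<open>Eliminating the identity term \<open>X\<close> from the Kauffman expansions of the two
  crossings leaves the term \<open>Y\<close>, which for antiparallel strands is the oriented
  smoothing.\<close>

lemma skein_V:
  assumes "skein_triple Dn Dp D0"
  shows "qa ^ 4 * V Dp - qb ^ 4 * V Dn = (qb\<^sup>2 - qa\<^sup>2) * V D0"
proof -
  let ?b = "bracket qa qb"
    and ?f = "framing qa qb"
  obtain A B i w where s: "Dn = A @ [P i] @ B" "Dp = A @ [N i] @ B" "D0 = A @ smoothing i w @ B"
     "run A [] = Some w" "i + 1 < length w" "w ! i \<noteq> w ! (i + 1)" using assms unfolding skein_triple_def by blast
  obtain p x y q where w: "w = p @ x # y # q" "length p = i" by (rule split2[OF s(5)])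
  have xy: "y = (\<not> x)" using s(6) w by (auto simp: nth_append)
  define v where "v = p @ y # x # q"
  have rc: "run [Cross i c] w = Some v" for c using w(2) unfolding w(1) v_def by (simp add: act_Cross_at del: act.simps)
  have sm: "smoothing i w = [Cap i, Cup i y]" using s(6) w by (simp add: smoothing_def nth_append)
  have rs: "run (smoothing i w) w = Some v"
    using w(2) unfolding sm unfolding w(1) v_def by (simp add: act_Cap act_Cup xy del: act.simps)
  define K where "K = ?b B (\<lambda>_. 1)"
  define F where "F = ?f A [] * ?f B v"
  define X where "X = F * ?b A K []"
  define Y where "Y = F * ?b A (cap qa i (cup qb i K)) []"
  have fn: "?f [P i] w = - (qa ^ 3)" "?f [N i] w = - (qb ^ 3)" "?f (smoothing i w) w = 1"
    using w(2) s(6) unfolding sm by simp_all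
  have cr: "?b A (?b [Cross i c] K) [] = (if c then qa else qb) * ?b A K [] + (if c then qb else qa) * ?b A (cap qa i (cup qb i K)) []" for c
    by (simp add: bracket_add bracket_scale)
  have 1: "V Dn = - (qa ^ 3) * (qa * X + qb * Y)"
    unfolding V_def s(1) jones_split[OF s(4) rc] fn K_def[symmetric] cr X_def Y_def F_def by (simp add: algebra_simps)
  have 2: "V Dp = - (qb ^ 3) * (qb * X + qa * Y)"
    unfolding V_def s(2) jones_split[OF s(4) rc] fn K_def[symmetric] cr X_def Y_def F_def by (simp add: algebra_simps)
  have 3: "V D0 = Y"
    unfolding V_def s(3) jones_split[OF s(4) rs] fn K_def[symmetric] Y_def F_def by (simp add: sm algebra_simps)
  have e: "qa ^ 4 * qb ^ 3 = qa" "qb ^ 4 * qa ^ 3 = qb"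
    using qa_qb by algebra+
  have "qa ^ 4 * V Dp - qb ^ 4 * V Dn = - (qa ^ 4 * qb ^ 3) * (qb * X + qa * Y) + qb ^ 4 * qa ^ 3 * (qa * X + qb * Y)"
    unfolding 1 2 by (simp add: algebra_simps)
  also have "\<dots> = (qb\<^sup>2 - qa\<^sup>2) * Y" unfolding e by (simp add: algebra_simps power2_eq_square)
  finally show ?thesis unfolding 3 .
qed

lemma skein_V_nth:
  assumes "skein_triple Dn Dp D0"
  shows "V Dp $ 0 = V Dn $ 0" "V Dp $ 1 = V Dn $ 1 - 8 * V Dn $ 0 - 4 * V D0 $ 0"
    "V Dp $ 2 = V Dn $ 2 - 4 * (V Dp $ 1 + V Dn $ 1) - 4 * V D0 $ 1"
proof -
  note sk = skein_V[OF assms, unfolded fps_power2]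
  have "(fps_exp 4 * V Dp) $ 0 = V Dp $ 0" "(fps_exp (- 4) * V Dn) $ 0 = V Dn $ 0" "((fps_exp (- 2) - fps_exp 2) * V D0) $ 0 = 0"
    by simp_all
  then show 0: "V Dp $ 0 = V Dn $ 0" using arg_cong[OF sk, of "\<lambda>x. x $ 0"] by simp
  have "(fps_exp 4 * V Dp) $ 1 = V Dp $ 1 + 4 * V Dp $ 0" "(fps_exp (- 4) * V Dn) $ 1 = V Dn $ 1 - 4 * V Dn $ 0"
    "((fps_exp (- 2) - fps_exp 2) * V D0) $ 1 = - 4 * V D0 $ 0"
    by (simp_all add: fps_mult_nth)
  then show 1: "V Dp $ 1 = V Dn $ 1 - 8 * V Dn $ 0 - 4 * V D0 $ 0" using arg_cong[OF sk, of "\<lambda>x. x $ 1"] 0 by simp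
  have "(fps_exp 4 * V Dp) $ 2 = V Dp $ 2 + 4 * V Dp $ 1 + 8 * V Dp $ 0"
    "(fps_exp (- 4) * V Dn) $ 2 = V Dn $ 2 - 4 * V Dn $ 1 + 8 * V Dn $ 0"
    "((fps_exp (- 2) - fps_exp 2) * V D0) $ 2 = - 4 * V D0 $ 1"
    by (simp_all add: fps_mult_nth numeral_2_eq_2)
  then show "V Dp $ 2 = V Dn $ 2 - 4 * (V Dp $ 1 + V Dn $ 1) - 4 * V D0 $ 1" using arg_cong[OF sk, of "\<lambda>x. x $ 2"] 0 1 by simp
qed

lemma V_circle: "V unknot = - (fps_exp 2 + fps_exp (- 2))"
proof -
  have "V unknot = - qb\<^sup>2 - qa\<^sup>2"
    using cup_at[of "[]" 0 qb "cap qa 0 (\<lambda>_. 1)" "[]"] cap_at[of "[]" 0 qa "\<lambda>_. 1" False True "[]"] cap_at[of "[]" 0 qa "\<lambda>_. 1" True False "[]"]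
    by (simp add: V_def jones_def unknot_def)
  then show ?thesis by (simp add: fps_power2)
qed

lemma V_unlink: "V (odd_pretzel c []) = (fps_exp 2 + fps_exp (- 2))\<^sup>2"
proof -
  have *: "cup qb 0 (cap qa 0 k) [] = (- qa\<^sup>2 - qb\<^sup>2) * k []" for k
  proof -
    have "cap qa 0 k [False, True] = - qa\<^sup>2 * k []" "cap qa 0 k [True, False] = k []"
      by (simp_all add: cap_def)
    then show ?thesis by (simp add: cup_def left_diff_distrib)
  qed
  have "V (odd_pretzel c []) = cup qb 0 (cap qa 0 (cup qb 0 (cap qa 0 (\<lambda>_. 1)))) []"
    by (simp add: V_def jones_def odd_pretzel_def)
  also have "\<dots> = (- qa\<^sup>2 - qb\<^sup>2)\<^sup>2" by (simp add: * power2_eq_square)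
  also have "\<dots> = (qa\<^sup>2 + qb\<^sup>2)\<^sup>2" by algebra
  finally show ?thesis by (simp add: fps_power2)
qed

lemma skein_isotopic_V_nth:
  assumes "\<exists>Dp D0. skein_triple Dn Dp D0 \<and> isotopic Dp D \<and> isotopic D0 E"
  shows "V D $ 0 = V Dn $ 0" "V D $ 1 = V Dn $ 1 - 8 * V Dn $ 0 - 4 * V E $ 0"
    "V D $ 2 = V Dn $ 2 - 4 * (V D $ 1 + V Dn $ 1) - 4 * V E $ 1"
proof -
  obtain Dp D0 where s: "skein_triple Dn Dp D0" "isotopic Dp D" "isotopic D0 E" using assms by blast
  from skein_V_nth[OF s(1), unfolded isotopic_V[OF s(2)] isotopic_V[OF s(3)]]
  show "V D $ 0 = V Dn $ 0" "V D $ 1 = V Dn $ 1 - 8 * V Dn $ 0 - 4 * V E $ 0"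
    "V D $ 2 = V Dn $ 2 - 4 * (V D $ 1 + V Dn $ 1) - 4 * V E $ 1" .
qed

lemma V_odd_pretzel_skein:
  assumes "odds (p # M)" "p > 0"
  shows "V (odd_pretzel c ((p - 2) # M)) $ 0 = V (odd_pretzel c (p # M)) $ 0"
    "V (odd_pretzel c ((p - 2) # M)) $ 1 = V (odd_pretzel c (p # M)) $ 1 - 8 * V (odd_pretzel c (p # M)) $ 0 - 4 * V (odd_pretzel c M) $ 0"
    "V (odd_pretzel c ((p - 2) # M)) $ 2 = V (odd_pretzel c (p # M)) $ 2
       - 4 * (V (odd_pretzel c ((p - 2) # M)) $ 1 + V (odd_pretzel c (p # M)) $ 1) - 4 * V (odd_pretzel c M) $ 1"
  using skein_isotopic_V_nth[OF skein_odd_pretzel[of p M c]] oddsD[OF assms(1)] assms(2) by blast+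

lemma V_odd_pretzel_skein2:
  assumes "odds (- 1 # q # M)" "q > 0"
  shows "V (odd_pretzel c (- 1 # (q - 2) # M)) $ 0 = V (odd_pretzel c (- 1 # q # M)) $ 0"
    "V (odd_pretzel c (- 1 # (q - 2) # M)) $ 1 = V (odd_pretzel c (- 1 # q # M)) $ 1 - 8 * V (odd_pretzel c (- 1 # q # M)) $ 0 - 4 * V (odd_pretzel c (- 1 # M)) $ 0"
    "V (odd_pretzel c (- 1 # (q - 2) # M)) $ 2 = V (odd_pretzel c (- 1 # q # M)) $ 2
       - 4 * (V (odd_pretzel c (- 1 # (q - 2) # M)) $ 1 + V (odd_pretzel c (- 1 # q # M)) $ 1) - 4 * V (odd_pretzel c (- 1 # M)) $ 1"
  using skein_isotopic_V_nth[OF skein_odd_pretzel2[where q = q and c = c]] oddsD[OF assms(1)] assms(2) by blast+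

lemma V_odd_pretzel_cancel: "odds M \<Longrightarrow> V (odd_pretzel c (- 1 # 1 # M)) = V (odd_pretzel c M)"
proof -
  assume "odds M"
  from isotopic_V[OF isotopic_odd_pretzel_cancel[OF oddsD[OF this]]] show ?thesis .
qed

lemma V_odd_pretzel_single: "odd p \<Longrightarrow> V (odd_pretzel c [p]) = V unknot"
proof -
  assume "odd p"
  then have "is_diagram (odd_pretzel c [p])" by (intro is_diagram_odd_pretzel) auto
  then have "isotopic (odd_pretzel c [p]) unknot" using deform_closed[OF deform_odd_pretzel_single] by fastforce
  then show ?thesis by (rule isotopic_V)
qed

lemma V_unknot_nth: "V unknot $ 0 = - 2" "V unknot $ 1 = 0"
  by (simp_all add: V_circle)

lemma V_unlink_nth: "V (odd_pretzel c []) $ 0 = 4" "V (odd_pretzel c []) $ 1 = 0"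
  by (simp_all add: V_unlink power2_eq_square fps_mult_nth)

text \<open>At h = 0 every component contributes a factor -2.\<close>

lemma V_odd_pretzel_0: "odds L \<Longrightarrow> V (odd_pretzel c L) $ 0 = (if even (length L) then 4 else - 2)"
  using parity_invariant[of "even (length L)" "\<lambda>L. V (odd_pretzel c L) $ 0" L] V_odd_pretzel_skein(1)[of _ _ c] V_odd_pretzel_skein2(1)[of _ _ c] V_odd_pretzel_cancel[of _ c]
    V_unknot_nth V_unlink_nth V_odd_pretzel_single[of "- 1" c] by simp

text \<open>In the skein relation of a knot, 8 times -2 cancels against 4 times 4 from the
  two-component smoothing, so the value is that of the unknot.\<close>

lemma V_odd_pretzel_1: "odds L \<Longrightarrow> odd (length L) \<Longrightarrow> V (odd_pretzel c L) $ 1 = 0"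
proof -
  assume L: "odds L" "odd (length L)"
  have "V (odd_pretzel c L) $ 1 = (if False then V (odd_pretzel c []) $ 1 else V (odd_pretzel c [- 1]) $ 1)"
  proof (rule parity_invariant[where f = "\<lambda>L. V (odd_pretzel c L) $ 1"])
    fix p M assume "odds (p # M)" "(0::int) < p" "even (length (p # M)) = False"
    then show "V (odd_pretzel c (p # M)) $ 1 = V (odd_pretzel c ((p - 2) # M)) $ 1"
      using V_odd_pretzel_skein(2)[of p M c] V_odd_pretzel_0[of "p # M" c] V_odd_pretzel_0[of M c] by simp
  next
    fix q M assume "odds (q # M)" "(0::int) < q" "even (length M) = False"
    then show "V (odd_pretzel c (- 1 # q # M)) $ 1 = V (odd_pretzel c (- 1 # (q - 2) # M)) $ 1"
      using V_odd_pretzel_skein2(2)[of q M c] V_odd_pretzel_0[of "- 1 # q # M" c] V_odd_pretzel_0[of "- 1 # M" c] by simp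
  qed (use L V_odd_pretzel_cancel in auto)
  then show ?thesis using V_odd_pretzel_single[of "- 1" c] V_unknot_nth by simp
qed

text \<open>For a two-component link the skein relation in degree one gives the step 8 times 4 plus
  4 times -2, which is 24. For a knot, the relation in degree two adds 4 times the degree-one
  coefficient of the smoothed link, hence 96 per unit of linking number.\<close>

lemma V_odd_pretzel_2:
  assumes "\<And>p. p \<in> set L \<Longrightarrow> odd p \<and> p > 0" "odd (length L)"
  shows "8 * ((V (odd_pretzel c L) $ 2 - V unknot $ 2) / 96) = 2 * real_of_int (esym2 L) + real (length L) - 1"
proof (rule a2_formula[where l = "\<lambda>L. V (odd_pretzel c L) $ 1 / 24" and a = "\<lambda>L. (V (odd_pretzel c L) $ 2 - V unknot $ 2) / 96"])
  show "V (odd_pretzel c (p # q # M)) $ 1 / 24 = V (odd_pretzel c ((p - 2) # q # M)) $ 1 / 24 + 1"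
    if "odds (p # q # M)" "p > 0" "even (length M)" for p q M
    using V_odd_pretzel_skein(2)[of p "q # M" c] V_odd_pretzel_0[of "p # q # M" c] V_odd_pretzel_0[of "q # M" c] that by (simp add: diff_divide_distrib)
  show "V (odd_pretzel c (- 1 # q # M)) $ 1 / 24 = V (odd_pretzel c (- 1 # (q - 2) # M)) $ 1 / 24 + 1"
    if "odds (q # M)" "q > 0" "even (length M)" for q M
    using V_odd_pretzel_skein2(2)[of q M c] V_odd_pretzel_0[of "- 1 # q # M" c] V_odd_pretzel_0[of "- 1 # M" c] that by (simp add: diff_divide_distrib)
  show "(V (odd_pretzel c (p # q # M)) $ 2 - V unknot $ 2) / 96 = (V (odd_pretzel c ((p - 2) # q # M)) $ 2 - V unknot $ 2) / 96 + V (odd_pretzel c (q # M)) $ 1 / 24"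
    if "odds (p # q # M)" "p > 0" "odd (length M)" for p q M
    using V_odd_pretzel_skein(3)[of p "q # M" c] V_odd_pretzel_1[of "p # q # M" c] V_odd_pretzel_1[of "(p - 2) # q # M" c] that by (simp add: diff_divide_distrib)
  show "(V (odd_pretzel c (- 1 # q # M)) $ 2 - V unknot $ 2) / 96 = (V (odd_pretzel c (- 1 # (q - 2) # M)) $ 2 - V unknot $ 2) / 96 + V (odd_pretzel c (- 1 # M)) $ 1 / 24"
    if "odds (q # M)" "q > 0" "odd (length M)" for q M
    using V_odd_pretzel_skein2(3)[of q M c] V_odd_pretzel_1[of "- 1 # q # M" c] V_odd_pretzel_1[of "- 1 # (q - 2) # M" c] that by (simp add: diff_divide_distrib)
qed (use V_odd_pretzel_cancel V_unlink_nth V_odd_pretzel_single assms in auto)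

section \<open>Comparison of the two bounds\<close>

lemma delta_unknotting_number_odd_pretzel:
  assumes "\<And>p. p \<in> set L \<Longrightarrow> odd p \<and> p > 0" "odd (length L)" "isotopic (odd_pretzel c L) D"
  shows "\<exists>k. delta_unknotting_number D = enat k \<and> 8 * int k = 2 * esym2 L + int (length L) - 1"
proof -
  obtain k where k: "delta_connected k (odd_pretzel c L) unknot" "8 * int k = 2 * esym2 L + int (length L) - 1"
    using delta_connected_odd_pretzel_unknot assms by blast
  have "k \<le> j" if "delta_connected j D unknot" for j
  proof -
    have "V D = V (odd_pretzel c L)" using isotopic_V assms(3) by simp
    moreover have "V (odd_pretzel c L) $ 0 = - 2" using V_odd_pretzel_0[of L c] oddsI[of L] assms by simp
    ultimately have "\<bar>V (odd_pretzel c L) $ 2 - V unknot $ 2\<bar> \<le> 96 * real j"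
      using delta_connected_V[OF that] by simp
    moreover have "8 * ((V (odd_pretzel c L) $ 2 - V unknot $ 2) / 96) = 8 * real_of_int (int k)"
      using V_odd_pretzel_2[OF assms(1,2), of c] k(2) by (metis of_int_add of_int_diff of_int_mult of_int_numeral of_int_of_nat_eq of_int_1)
    ultimately show ?thesis by simp
  qed
  moreover have "delta_connected k D unknot"
    using isotopic_delta_connected[OF isotopic_sym[OF assms(3)] k(1)] .
  ultimately have "Inf {enat j | j. delta_connected j D unknot} = enat k"
    by (intro Inf_eqI) auto
  then show ?thesis using k(2) by (auto simp: delta_unknotting_number_def delta_gordian_distance_def)
qed

lemma esym2_sum:
  "esym2 (rev (map p [1..<Suc n])) = (\<Sum>(i, j) \<in> {(i, j). 1 \<le> i \<and> i < j \<and> j \<le> n}. p i * p j)"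
proof (induction n)
  case 0
  have "{(i, j). 1 \<le> i \<and> i < j \<and> j \<le> (0 :: nat)} = {}" by auto
  then show ?case by (simp only:) simp
next
  case (Suc n)
  have "{(i, j). 1 \<le> i \<and> i < j \<and> j \<le> Suc n} = {(i, j). 1 \<le> i \<and> i < j \<and> j \<le> n} \<union> (\<lambda>i. (i, Suc n)) ` {1..n}"
    by auto
  moreover have "finite {(i, j). 1 \<le> i \<and> i < j \<and> j \<le> n}"
    by (rule finite_subset[of _ "{..n} \<times> {..n}"]) auto
  moreover have "{(i, j). 1 \<le> i \<and> i < j \<and> j \<le> n} \<inter> (\<lambda>i. (i, Suc n)) ` {1..n} = {}" by auto
  moreover have "(\<Sum>(i, j) \<in> (\<lambda>i. (i, Suc n)) ` {1..n}. p i * p j) = p (Suc n) * (\<Sum>i = 1..n. p i)"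
    by (subst sum.reindex) (auto simp: inj_on_def sum_distrib_left mult.commute)
  moreover have "sum_list (rev (map p [1..<Suc n])) = (\<Sum>i = 1..n. p i)"
    by (simp add: sum_list_rev interv_sum_list_conv_sum_set_nat atLeastLessThanSuc_atLeastAtMost del: upt_Suc)
  ultimately show ?case using Suc.IH by (simp add: sum.union_disjoint)
qed

theorem theorem1p1:
  fixes n :: nat and p :: "nat \<Rightarrow> int" and b :: "nat \<Rightarrow> bool" and P :: diagram
  assumes "odd n"
    and "\<And>i. 1 \<le> i \<Longrightarrow> i \<le> n \<Longrightarrow> 0 < p i \<and> odd (p i)"
    and "P = pretzel b (map p [1..<Suc n])"
    and "is_diagram P"
  shows "ereal_of_enat (delta_unknotting_number P) =
           ereal (1 / 4 * (\<Sum>(i, j) \<in> {(i, j). 1 \<le> i \<and> i < j \<and> j \<le> n}. real_of_int (p i * p j))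
                  + 1 / 8 * (real n - 1)) \<and>
         (\<forall>nabla. conway_polynomial nabla \<longrightarrow>
           real_of_int (coeff (nabla P) 2) =
             1 / 4 * (\<Sum>(i, j) \<in> {(i, j). 1 \<le> i \<and> i < j \<and> j \<le> n}. real_of_int (p i * p j))
             + 1 / 8 * (real n - 1))"
proof -
  define L where "L = rev (map p [1..<Suc n])"
  define c where "c = (\<not> b 0)"
  let ?s = "\<Sum>(i, j) \<in> {(i, j). 1 \<le> i \<and> i < j \<and> j \<le> n}. real_of_int (p i * p j)"
  have L: "\<And>x. x \<in> set L \<Longrightarrow> odd x \<and> x > 0" "odd (length L)"
    using assms(1,2) by (auto simp: L_def simp del: upt_Suc)
  have s: "?s = real_of_int (esym2 L)"
    unfolding L_def esym2_sum of_int_sum by (rule sum.cong) auto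
  have iso: "isotopic (odd_pretzel c L) P"
    unfolding c_def L_def assms(3)
  proof (rule isotopic_pretzel_odd_pretzel)
    show "b i = (\<not> b 0)" if "0 < i" "i < length (map p [1..<Suc n])" for i
      by (rule pretzel_orientation[of b "map p [1..<Suc n]"]) (use assms that in \<open>auto simp del: upt_Suc\<close>)
  qed (use assms in \<open>auto simp del: upt_Suc elim: oddE\<close>)
  obtain k where k: "delta_unknotting_number P = enat k" "8 * int k = 2 * esym2 L + int (length L) - 1"
    using delta_unknotting_number_odd_pretzel[OF L iso] by blast
  have "8 * real k = real_of_int (8 * int k)" by simp
  also have "\<dots> = 2 * ?s + real n - 1" unfolding k(2) s by (simp add: L_def)
  finally have "real k = 1 / 4 * ?s + 1 / 8 * (real n - 1)" by (simp add: field_simps)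
  moreover have "real_of_int (coeff (nabla P) 2) = 1 / 4 * ?s + 1 / 8 * (real n - 1)" if "conway_polynomial nabla" for nabla
  proof -
    have "nabla P = nabla (odd_pretzel c L)"
      using that is_diagram_odd_pretzel[of L c] L(1) iso unfolding conway_polynomial_def by metis
    then have "8 * real_of_int (coeff (nabla P) 2) = 2 * ?s + real n - 1"
      using conway_coeff_odd_pretzel[OF that L, of c] unfolding s by (simp add: L_def)
    then show ?thesis by (simp add: field_simps)
  qed
  ultimately show ?thesis unfolding k(1) by simp
qed

end
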